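(* Let $n,h\ge 1$, let $\mu\vdash h$ be a partition with conjugate partition $\widetilde\mu$, and let $\mathbf T$ be a multilinear standard tableau of shape $\mu$. Then the quantum immanant $Tr(\mathbb E_{\mathbf T})\in \mathbf U(gl(n))$ satisfies $$Tr(\mathbb E_{\mathbf T})=(-1)^{\binom h2}\sum_{h_1+h_2+\cdots+h_n=h}\frac{H(\mu)}{h_1!\,h_2!\cdots h_n!}\;Cimm_{\widetilde\mu}[1^{h_1}2^{h_2}\cdots n^{h_n};1^{h_1}2^{h_2}\cdots n^{h_n}],$$ where the sum is over all $n$-tuples of nonnegative integers $(h_1,\dots,h_n)$ with sum $h$, and $1^{h_1}2^{h_2}\cdots n^{h_n}$ denotes the nondecreasing sequence $i_1i_2\cdots i_h$ in which each $p\in\{1,\dots,n\}$ occurs exactly $h_p$ times.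
   Context: **Virtual variables.** Let $A_0=\{\alpha_1,\dots,\alpha_{m_0}\}$, $A_1=\{\beta_1,\dots,\beta_{m_1}\}$, $L=\{1,\dots,n\}$ be disjoint sets of symbols ($m_0,m_1$ sufficiently large), with parities $|\alpha_s|=0$, $|\beta_t|=|i|=1$ in $\mathbb Z_2$. $gl(m_0|m_1+n)$ is the complex Lie superalgebra with basis $e_{a,b}$, $a,b\in A_0\cup A_1\cup L$, $|e_{a,b}|=|a|+|b|$, and superbracket $[e_{a,b},e_{c,d}]=\delta_{bc}e_{a,d}-(-1)^{(|a|+|b|)(|c|+|d|)}\delta_{ad}e_{c,b}$; $gl(n)$ is its Lie subalgebra spanned by $e_{ij}=e_{i,j}$, $i,j\in L$. A product $e_{a_m,b_m}\cdots e_{a_1,b_1}$ in $\mathbf U(gl(m_0|m_1+n))$ is irregular if there are $i\le m$ and $\gamma\in A_0\cup A_1$ with $\#\{j\le i: b_j=\gamma\}>\#\{j<i: a_j=\gamma\}$. $\mathbf{Irr}$ is the left ideal generated by irregular products. It is known that $\mathbf U(gl(n))\cap\mathbf{Irr}=0$ and that $Virt(m_0+m_1,n)=\mathbf U(gl(n))\oplus\mathbf{Irr}$ is a subalgebra in which $\mathbf{Irr}$ is a two-sided ideal; $\mathfrak p:Virt(m_0+m_1,n)\to\mathbf U(gl(n))$ is the projection with kernel $\mathbf{Irr}$. **Column Capelli bitableaux.** For $i_1,\dots,i_h,j_1,\dots,j_h\in\{1,\dots,n\}$ and distinct $\alpha_1,\dots,\alpha_h\in A_0$, $$\left[\begin{array}{c}i_1\\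 \vdots\\ i_h\end{array}\right|\left.\begin{array}{c}j_1\\ \vdots\\ j_h\end{array}\right]=\mathfrak p\big(e_{i_1,\alpha_1}\cdots e_{i_h,\alpha_h}\,e_{\alpha_1,j_1}\cdots e_{\alpha_h,j_h}\big)\in\mathbf U(gl(n))$$ (the argument of $\mathfrak p$ lies in $Virt(m_0+m_1,n)$, and the result does not depend on the choice of the $\alpha$'s). **Capelli immanants.** For $\lambda\vdash h$, $\chi^\lambda$ denotes the irreducible character of the symmetric group $\mathbf S_h$ labelled so that $\lambda=(1^h)$ gives the trivial and $\lambda=(h)$ the sign character (i.e. $\chi^\lambda$ is the character usually attached to the conjugate partition $\widetilde\lambda$). Put $$Cimm_\lambda[i_1\cdots i_h;j_1\cdots j_h]=\sum_{\sigma\in\mathbf S_h}\chi^\lambda(\sigma)\left[\begin{array}{c}i_{\sigma(1)}\\ \vdots\\ i_{\sigma(h)}\end{array}\right|\left.\begin{array}{c}j_1\\ \vdots\\ j_h\end{array}\right].$$ **Quantum immanants (Okounkov).** $\mathbf T$ is a multilinear standard tableau of shape $\mu\vdash h$: the entries are $1,\dots,h$, each once, increasing along rows and columns. If $s$ is in row $i$ and column $j$ of $\mathbf T$, put $\mathbf c_{\mathbf T}(s)=j-i$. $V^\mu$ is the irreducible representation of $\mathbf S_h$ attached to $\mu$ in the usual (James–Kerber) convention ($V^{(h)}$ trivial), with an $\mathbf S_h$-invariant inner product, and $v_{\mathbf T}\in V^\mu$ is the unit vector of the seminormal Young basis attached to $\mathbf T$ (the simultaneous eigenvector of the Jucys–Murphy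 elements $\sum_{r<s}(r\,s)$ with eigenvalues $\mathbf c_{\mathbf T}(s)$, $s=1,\dots,h$). Let $\Psi_{\mathbf T}=\sum_{\sigma\in\mathbf S_h}(\sigma\cdot v_{\mathbf T},v_{\mathbf T})\,\sigma^{-1}\in\mathbb C[\mathbf S_h]$ and let $\Psi^h_{\mathbf T}$ be the $n^h\times n^h$ matrix of $\Psi_{\mathbf T}$ acting on $(\mathbb C^n)^{\otimes h}$ by permuting tensor factors. With $E=[e_{ij}]_{i,j=1,\dots,n}$, put $$\mathbb E_{\mathbf T}=\big((E-\mathbf c_{\mathbf T}(1))\otimes(E-\mathbf c_{\mathbf T}(2))\otimes\cdots\otimes(E-\mathbf c_{\mathbf T}(h))\big)\,\Psi^h_{\mathbf T},$$ an $n^h\times n^h$ matrix over $\mathbf U(gl(n))$ (scalars stand for scalar matrices; entries of the tensor product are products of entries in the order of the tensor factors). The quantum immanant is the trace $Tr(\mathbb E_{\mathbf T})\in\mathbf U(gl(n))$. $H(\mu)$ is the product of hook lengths of $\mu$, so $\dim V^\mu=h!/H(\mu)$. *)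

theory Defs
  imports
    Complex_Main
    "HOL-Library.FuncSet"
    "HOL-Library.Function_Algebras"
    "HOL-Library.Poly_Mapping"
    "HOL-Combinatorics.Permutations"
begin

section \<open>The enveloping algebra of the general linear Lie superalgebra\<close>

text \<open>
  The symbol sets are types: \<open>m\<^sub>0 = CARD('p)\<close>, \<open>m\<^sub>1 = CARD('q)\<close>, \<open>n = CARD('n)\<close>; in the order on
  \<open>'n\<close> (needed only to speak of nondecreasing sequences) the elements of \<open>'n\<close> are the
  proper symbols \<open>1 < \<dots> < n\<close>.
\<close>

datatype ('p, 'q, 'n) symb = Alpha 'p | Beta 'q | Proper 'n

fun odd_symb :: "('p, 'q, 'n) symb \<Rightarrow> bool" where
  "odd_symb (Alpha _) = False"
| "odd_symb (Beta _) = True"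
| "odd_symb (Proper _) = True"

fun is_virtual :: "('p, 'q, 'n) symb \<Rightarrow> bool" where
  "is_virtual (Alpha _) = True"
| "is_virtual (Beta _) = True"
| "is_virtual (Proper _) = False"

text \<open>The pair \<open>(a, b)\<close> stands for the basis element \<open>e\<^sub>a\<^sub>,\<^sub>b\<close>.\<close>

type_synonym ('p, 'q, 'n) unit_ix = "('p, 'q, 'n) symb \<times> ('p, 'q, 'n) symb"

definition odd_unit :: "('p, 'q, 'n) unit_ix \<Rightarrow> bool" where
  "odd_unit x \<longleftrightarrow> odd_symb (fst x) \<noteq> odd_symb (snd x)"

definition super_sign :: "('p, 'q, 'n) unit_ix \<Rightarrow> ('p, 'q, 'n) unit_ix \<Rightarrow> 'r::ring_1" where
  "super_sign x y = (if odd_unit x \<and> odd_unit y then - 1 else 1)"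

text \<open>
  Words form a monoid under concatenation, written additively so that finitely supported
  functions on words, with their convolution product, are the free associative algebra.
\<close>

datatype 'a word = Word (letters: "'a list")

instantiation word :: (type) monoid_add
begin

definition zero_word :: "'a word" where
  "zero_word = Word []"

definition plus_word :: "'a word \<Rightarrow> 'a word \<Rightarrow> 'a word" where
  "plus_word u v = Word (letters u @ letters v)"

instance
  by standard (simp_all add: zero_word_def plus_word_def)

end

type_synonym ('p, 'q, 'n) tensor_alg = "('p, 'q, 'n) unit_ix word \<Rightarrow>\<^sub>0 complex"

definition letter :: "('p, 'q, 'n) unit_ix \<Rightarrow> ('p, 'q, 'n) tensor_alg" where
  "letter x = Poly_Mapping.single (Word [x]) 1"

fun superbracket :: "('p, 'q, 'n) unit_ix \<Rightarrow> ('p, 'q, 'n) unit_ix \<Rightarrow> ('p, 'q, 'n) tensor_alg" where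
  "superbracket (a, b) (c, d) =
     (if b = c then letter (a, d) else 0)
     - super_sign (a, b) (c, d) * (if a = d then letter (c, b) else 0)"

text \<open>Complex scalars lie in the tensor algebra, so closure under products covers scalar multiples.\<close>

inductive_set env_ideal :: "('p, 'q, 'n) tensor_alg set" where
  zero: "0 \<in> env_ideal"
| add: "x \<in> env_ideal \<Longrightarrow> y \<in> env_ideal \<Longrightarrow> x + y \<in> env_ideal"
| gen: "u * (letter x * letter y - super_sign x y * (letter y * letter x) - superbracket x y) * v
          \<in> env_ideal"

lemma env_ideal_mult_left: "x \<in> env_ideal \<Longrightarrow> w * x \<in> env_ideal"
proof (induction rule: env_ideal.induct)
  case (gen u x y v)
  show ?case
    using env_ideal.gen[of "w * u" x y v] by (simp add: mult.assoc)
qed (simp_all add: distrib_left env_ideal.intros)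

lemma env_ideal_mult_right: "x \<in> env_ideal \<Longrightarrow> x * w \<in> env_ideal"
proof (induction rule: env_ideal.induct)
  case (gen u x y v)
  show ?case
    using env_ideal.gen[of u x y "v * w"] by (simp add: mult.assoc)
qed (simp_all add: distrib_right env_ideal.intros)

lemma env_ideal_uminus: "x \<in> env_ideal \<Longrightarrow> - x \<in> env_ideal"
  using env_ideal_mult_left[of x "- 1"] by simp

lemma env_ideal_diff: "x \<in> env_ideal \<Longrightarrow> y \<in> env_ideal \<Longrightarrow> x - y \<in> env_ideal"
  using env_ideal.add[of x "- y"] env_ideal_uminus[of y] by simp

text \<open>The augmentation, which kills all letters, shows that the quotient is nontrivial.\<close>

lemma lookup_0_mult:
  fixes f g :: "'a word \<Rightarrow>\<^sub>0 complex"
  shows "Poly_Mapping.lookup (f * g) 0 = Poly_Mapping.lookup f 0 * Poly_Mapping.lookup g 0"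
proof -
  have split: "0 = l + q \<longleftrightarrow> l = 0 \<and> q = 0" for l q :: "'a word"
    by (cases l; cases q) (auto simp: zero_word_def plus_word_def)
  have "Poly_Mapping.lookup (f * g) 0
      = (\<Sum>l. Poly_Mapping.lookup f l * (\<Sum>q. Poly_Mapping.lookup g q when 0 = l + q))"
    by (simp add: times_poly_mapping.rep_eq prod_fun_def)
  also have "\<dots> = (\<Sum>l. Poly_Mapping.lookup f l * Poly_Mapping.lookup g 0 when l = 0)"
  proof (rule arg_cong[where f = Sum_any], rule ext)
    fix l
    show "Poly_Mapping.lookup f l * (\<Sum>q. Poly_Mapping.lookup g q when 0 = l + q)
        = (Poly_Mapping.lookup f l * Poly_Mapping.lookup g 0 when l = 0)"
      by (cases "l = 0") (simp_all add: split)
  qed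
  also have "\<dots> = Poly_Mapping.lookup f 0 * Poly_Mapping.lookup g 0"
    by simp
  finally show ?thesis .
qed

lemma lookup_0_letter [simp]: "Poly_Mapping.lookup (letter x) 0 = 0"
  by (simp add: letter_def lookup_single zero_word_def when_def)

lemma lookup_env_ideal_0: "x \<in> env_ideal \<Longrightarrow> Poly_Mapping.lookup x 0 = 0"
proof (induction rule: env_ideal.induct)
  case (gen u x y v)
  have "Poly_Mapping.lookup (superbracket x y) 0 = 0"
    by (cases x; cases y) (simp add: lookup_minus lookup_0_mult)
  then show ?case
    by (simp add: lookup_0_mult lookup_minus)
qed (simp_all add: lookup_add)

definition env_rel :: "('p, 'q, 'n) tensor_alg \<Rightarrow> ('p, 'q, 'n) tensor_alg \<Rightarrow> bool" where
  "env_rel x y \<longleftrightarrow> x - y \<in> env_ideal"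

lemma equivp_env_rel: "equivp env_rel"
proof (intro equivpI reflpI sympI transpI)
  fix x y z :: "('p, 'q, 'n) tensor_alg"
  show "env_rel x x"
    by (simp add: env_rel_def env_ideal.zero)
  show "env_rel y x" if "env_rel x y"
    using env_ideal_uminus[of "x - y"] that by (simp add: env_rel_def)
  show "env_rel x z" if "env_rel x y" "env_rel y z"
    using env_ideal.add[of "x - y" "y - z"] that by (simp add: env_rel_def)
qed

text \<open>\<open>\<^bold>U(gl(m\<^sub>0|m\<^sub>1+n))\<close>\<close>

quotient_type ('p, 'q, 'n) env = "('p, 'q, 'n) tensor_alg" / env_rel
  by (rule equivp_env_rel)

instantiation env :: (type, type, type) ring_1
begin

lift_definition zero_env :: "('a, 'b, 'c) env" is 0 .

lift_definition one_env :: "('a, 'b, 'c) env" is 1 .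

lift_definition plus_env :: "('a, 'b, 'c) env \<Rightarrow> ('a, 'b, 'c) env \<Rightarrow> ('a, 'b, 'c) env" is "(+)"
  unfolding env_rel_def by (metis add_diff_add env_ideal.add)

lift_definition uminus_env :: "('a, 'b, 'c) env \<Rightarrow> ('a, 'b, 'c) env" is uminus
  unfolding env_rel_def by (metis env_ideal_uminus minus_diff_minus)

lift_definition minus_env :: "('a, 'b, 'c) env \<Rightarrow> ('a, 'b, 'c) env \<Rightarrow> ('a, 'b, 'c) env" is "(-)"
proof -
  fix x x' y y' :: "('a, 'b, 'c) tensor_alg"
  assume "env_rel x x'" "env_rel y y'"
  then show "env_rel (x - y) (x' - y')"
    using env_ideal_diff[of "x - x'" "y - y'"] by (simp add: env_rel_def algebra_simps)
qed

lift_definition times_env :: "('a, 'b, 'c) env \<Rightarrow> ('a, 'b, 'c) env \<Rightarrow> ('a, 'b, 'c) env" is "(*)"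
proof -
  fix x x' y y' :: "('a, 'b, 'c) tensor_alg"
  assume *: "env_rel x x'" "env_rel y y'"
  have "x * y - x' * y' = (x - x') * y + x' * (y - y')"
    by (simp add: algebra_simps)
  then show "env_rel (x * y) (x' * y')"
    using * by (simp add: env_rel_def env_ideal.add env_ideal_mult_left env_ideal_mult_right)
qed

instance
proof
  show "(0 :: ('a, 'b, 'c) env) \<noteq> 1"
  proof transfer
    show "\<not> env_rel (0 :: ('a, 'b, 'c) tensor_alg) 1"
      using lookup_env_ideal_0[of "0 - 1 :: ('a, 'b, 'c) tensor_alg"]
      by (auto simp: env_rel_def lookup_one)
  qed
qed (transfer; simp add: env_rel_def env_ideal.zero algebra_simps)+

end

lift_definition scalar :: "complex \<Rightarrow> ('p, 'q, 'n) env" is "Poly_Mapping.single 0" .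

lift_definition gl_unit :: "('p, 'q, 'n) symb \<Rightarrow> ('p, 'q, 'n) symb \<Rightarrow> ('p, 'q, 'n) env"
  is "\<lambda>a b. letter (a, b)" .

inductive_set U_gl :: "('p, 'q, 'n) env set" where
  scalar: "scalar c \<in> U_gl"
| unit: "gl_unit (Proper i) (Proper j) \<in> U_gl"
| add: "x \<in> U_gl \<Longrightarrow> y \<in> U_gl \<Longrightarrow> x + y \<in> U_gl"
| mult: "x \<in> U_gl \<Longrightarrow> y \<in> U_gl \<Longrightarrow> x * y \<in> U_gl"


section \<open>Irregular products and the projection onto \<open>\<^bold>U(gl(n))\<close>\<close>

text \<open>
  A list \<open>w\<close> stands for the product of its letters from left to right, i.e.\ for
  \<open>e\<^bsub>a\<^sub>m,b\<^sub>m\<^esub> \<cdots> e\<^bsub>a\<^sub>1,b\<^sub>1\<^esub>\<close> with \<open>rev w = [(a\<^sub>1, b\<^sub>1), \<dots>, (a\<^sub>m, b\<^sub>m)]\<close>.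
\<close>

definition unit_prod :: "('p, 'q, 'n) unit_ix list \<Rightarrow> ('p, 'q, 'n) env" where
  "unit_prod w = prod_list (map (\<lambda>(a, b). gl_unit a b) w)"

definition irregular :: "('p, 'q, 'n) unit_ix list \<Rightarrow> bool" where
  "irregular w \<longleftrightarrow>
     (\<exists>i \<in> {1..length w}. \<exists>\<gamma>. is_virtual \<gamma> \<and>
        count_list (map snd (take i (rev w))) \<gamma> > count_list (map fst (take (i - 1) (rev w))) \<gamma>)"

inductive_set Irr :: "('p, 'q, 'n) env set" where
  zero: "0 \<in> Irr"
| add: "x \<in> Irr \<Longrightarrow> y \<in> Irr \<Longrightarrow> x + y \<in> Irr"
| gen: "irregular w \<Longrightarrow> u * unit_prod w \<in> Irr"

text \<open>Meaningful on \<open>Virt(m\<^sub>0+m\<^sub>1, n) = \<^bold>U(gl(n)) \<oplus> Irr\<close>, unspecified elsewhere.\<close>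

definition virt_proj :: "('p, 'q, 'n) env \<Rightarrow> ('p, 'q, 'n) env" where
  "virt_proj x = (THE y. y \<in> U_gl \<and> x - y \<in> Irr)"

text \<open>Sequences of length \<open>h\<close> are functions on \<open>nat\<close>, used at the arguments \<open>1, \<dots>, h\<close> only.\<close>

definition column_capelli ::
    "(nat \<Rightarrow> 'p) \<Rightarrow> nat \<Rightarrow> (nat \<Rightarrow> 'n) \<Rightarrow> (nat \<Rightarrow> 'n) \<Rightarrow> ('p, 'q, 'n) env" where
  "column_capelli \<alpha> h i j =
     virt_proj (prod_list (map (\<lambda>s. gl_unit (Proper (i s)) (Alpha (\<alpha> s))) [1..<Suc h])
              * prod_list (map (\<lambda>s. gl_unit (Alpha (\<alpha> s)) (Proper (j s))) [1..<Suc h]))"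


section \<open>Partitions and tableaux\<close>

definition partition_of :: "nat list \<Rightarrow> nat \<Rightarrow> bool" where
  "partition_of \<mu> h \<longleftrightarrow> sorted_wrt (\<ge>) \<mu> \<and> 0 \<notin> set \<mu> \<and> sum_list \<mu> = h"

definition conj_part :: "nat list \<Rightarrow> nat list" where
  "conj_part \<mu> = map (\<lambda>j. length (filter (\<lambda>r. j \<le> r) \<mu>)) [1..<Suc (foldr max \<mu> 0)]"

definition cells :: "nat list \<Rightarrow> (nat \<times> nat) set" where
  "cells \<mu> = {(i, j). 1 \<le> i \<and> i \<le> length \<mu> \<and> 1 \<le> j \<and> j \<le> \<mu> ! (i - 1)}"

definition hook_length :: "nat list \<Rightarrow> nat \<times> nat \<Rightarrow> nat" where
  "hook_length \<mu> = (\<lambda>(i, j).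
     card {(i', j') \<in> cells \<mu>. (i' = i \<and> j \<le> j') \<or> (j' = j \<and> i \<le> i')})"

definition hook_product :: "nat list \<Rightarrow> nat" where
  "hook_product \<mu> = (\<Prod>c \<in> cells \<mu>. hook_length \<mu> c)"

definition standard_tableau :: "nat list \<Rightarrow> (nat \<times> nat \<Rightarrow> nat) \<Rightarrow> bool" where
  "standard_tableau \<mu> T \<longleftrightarrow>
     bij_betw T (cells \<mu>) {1..sum_list \<mu>} \<and>
     (\<forall>i j j'. (i, j) \<in> cells \<mu> \<and> (i, j') \<in> cells \<mu> \<and> j < j' \<longrightarrow> T (i, j) < T (i, j')) \<and>
     (\<forall>i i' j. (i, j) \<in> cells \<mu> \<and> (i', j) \<in> cells \<mu> \<and> i < i' \<longrightarrow> T (i, j) < T (i', j))"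

definition content :: "nat list \<Rightarrow> (nat \<times> nat \<Rightarrow> nat) \<Rightarrow> nat \<Rightarrow> int" where
  "content \<mu> T s = (case the_inv_into (cells \<mu>) T s of (i, j) \<Rightarrow> int j - int i)"


section \<open>Irreducible representations of the symmetric group\<close>

text \<open>
  \<open>\<^bold>S\<^sub>h\<close> consists of the \<open>\<sigma>\<close> with \<open>\<sigma> permutes {1..h}\<close>. The element \<open>\<Sum>\<^sub>\<sigma> x\<^sub>\<sigma> \<sigma>\<close> of the group algebra
  is the function \<open>\<sigma> \<mapsto> x\<^sub>\<sigma>\<close>, extended by 0 outside \<open>\<^bold>S\<^sub>h\<close>.
\<close>

type_synonym galg = "(nat \<Rightarrow> nat) \<Rightarrow> complex"

definition galg_scale :: "complex \<Rightarrow> galg \<Rightarrow> galg" where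
  "galg_scale c x = (\<lambda>\<sigma>. c * x \<sigma>)"

interpretation galg: vector_space galg_scale
  by unfold_locales (simp_all add: galg_scale_def fun_eq_iff algebra_simps)

definition group_alg :: "nat \<Rightarrow> galg set" where
  "group_alg h = {x. \<forall>\<sigma>. \<not> \<sigma> permutes {1..h} \<longrightarrow> x \<sigma> = 0}"

definition galg_mult :: "nat \<Rightarrow> galg \<Rightarrow> galg \<Rightarrow> galg" where
  "galg_mult h x y = (\<lambda>\<sigma>. \<Sum>\<tau> | \<tau> permutes {1..h}. x \<tau> * y (inv \<tau> \<circ> \<sigma>))"

text \<open>Left multiplication by the permutation \<open>\<tau>\<close>.\<close>

definition perm_act :: "(nat \<Rightarrow> nat) \<Rightarrow> galg \<Rightarrow> galg" where
  "perm_act \<tau> x = (\<lambda>\<sigma>. x (inv \<tau> \<circ> \<sigma>))"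

definition row_reading :: "nat list \<Rightarrow> nat \<times> nat \<Rightarrow> nat" where
  "row_reading \<mu> = (\<lambda>(i, j). sum_list (take (i - 1) \<mu>) + j)"

definition row_group :: "nat list \<Rightarrow> (nat \<Rightarrow> nat) set" where
  "row_group \<mu> = {\<sigma>. \<sigma> permutes {1..sum_list \<mu>} \<and>
     (\<forall>(i, j) \<in> cells \<mu>. \<exists>j'. (i, j') \<in> cells \<mu> \<and>
        \<sigma> (row_reading \<mu> (i, j)) = row_reading \<mu> (i, j'))}"

definition col_group :: "nat list \<Rightarrow> (nat \<Rightarrow> nat) set" where
  "col_group \<mu> = {\<sigma>. \<sigma> permutes {1..sum_list \<mu>} \<and>
     (\<forall>(i, j) \<in> cells \<mu>. \<exists>i'. (i', j) \<in> cells \<mu> \<and>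
        \<sigma> (row_reading \<mu> (i, j)) = row_reading \<mu> (i', j))}"

definition young_symmetrizer :: "nat list \<Rightarrow> galg" where
  "young_symmetrizer \<mu> =
     galg_mult (sum_list \<mu>)
       (\<lambda>\<sigma>. if \<sigma> \<in> row_group \<mu> then 1 else 0)
       (\<lambda>\<sigma>. if \<sigma> \<in> col_group \<mu> then of_int (sign \<sigma>) else 0)"

text \<open>
  The irreducible representation attached to \<open>\<mu>\<close> in the James--Kerber convention, as the left ideal
  of the group algebra generated by a Young symmetrizer; \<open>\<mu> = (h)\<close> gives the trivial
  representation.
\<close>

definition irrep :: "nat list \<Rightarrow> galg set" where
  "irrep \<mu> = {galg_mult (sum_list \<mu>) x (young_symmetrizer \<mu>) | x. x \<in> group_alg (sum_list \<mu>)}"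

definition trace_on :: "galg set \<Rightarrow> (galg \<Rightarrow> galg) \<Rightarrow> complex" where
  "trace_on V f =
     (let B = (SOME B. galg.independent B \<and> galg.span B = V)
      in \<Sum>b\<in>B. galg.representation B (f b) b)"

text \<open>
  Labelled so that \<open>\<nu> = (1\<^sup>h)\<close> gives the trivial and \<open>\<nu> = (h)\<close> the sign character; this is why the
  conjugate partition enters.
\<close>

definition irr_char :: "nat list \<Rightarrow> (nat \<Rightarrow> nat) \<Rightarrow> complex" where
  "irr_char \<nu> \<sigma> = trace_on (irrep (conj_part \<nu>)) (perm_act \<sigma>)"

definition Cimm ::
    "(nat \<Rightarrow> 'p) \<Rightarrow> nat list \<Rightarrow> (nat \<Rightarrow> 'n) \<Rightarrow> (nat \<Rightarrow> 'n) \<Rightarrow> ('p, 'q, 'n) env" where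
  "Cimm \<alpha> \<nu> i j =
     (\<Sum>\<sigma> | \<sigma> permutes {1..sum_list \<nu>}.
        scalar (irr_char \<nu> \<sigma>) * column_capelli \<alpha> (sum_list \<nu>) (i \<circ> \<sigma>) j)"


section \<open>Quantum immanants\<close>

definition invariant_inner_product :: "nat \<Rightarrow> galg set \<Rightarrow> (galg \<Rightarrow> galg \<Rightarrow> complex) \<Rightarrow> bool" where
  "invariant_inner_product h V ip \<longleftrightarrow>
     (\<forall>x\<in>V. \<forall>y\<in>V. \<forall>z\<in>V. ip (x + y) z = ip x z + ip y z) \<and>
     (\<forall>c. \<forall>x\<in>V. \<forall>y\<in>V. ip (galg_scale c x) y = c * ip x y) \<and>
     (\<forall>x\<in>V. \<forall>y\<in>V. ip y x = cnj (ip x y)) \<and>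
     (\<forall>x\<in>V. x \<noteq> 0 \<longrightarrow> Re (ip x x) > 0) \<and>
     (\<forall>\<sigma>. \<sigma> permutes {1..h} \<longrightarrow> (\<forall>x\<in>V. \<forall>y\<in>V. ip (perm_act \<sigma> x) (perm_act \<sigma> y) = ip x y))"

text \<open>\<open>v\<close> is a unit vector of the seminormal Young basis attached to \<open>T\<close>; this determines \<open>v\<close> up to a
  phase, on which \<open>young_psi\<close> does not depend.\<close>

definition young_vector ::
    "nat list \<Rightarrow> (nat \<times> nat \<Rightarrow> nat) \<Rightarrow> (galg \<Rightarrow> galg \<Rightarrow> complex) \<Rightarrow> galg \<Rightarrow> bool" where
  "young_vector \<mu> T ip v \<longleftrightarrow>
     v \<in> irrep \<mu> \<and> ip v v = 1 \<and>
     (\<forall>s \<in> {1..sum_list \<mu>}.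
        (\<Sum>r \<in> {1..<s}. perm_act (Transposition.transpose r s) v)
          = galg_scale (of_int (content \<mu> T s)) v)"

definition young_psi :: "nat \<Rightarrow> (galg \<Rightarrow> galg \<Rightarrow> complex) \<Rightarrow> galg \<Rightarrow> galg" where
  "young_psi h ip v =
     (\<Sum>\<sigma> | \<sigma> permutes {1..h}.
        galg_scale (ip (perm_act \<sigma> v) v) (\<lambda>\<tau>. if \<tau> = inv \<sigma> then 1 else 0))"

text \<open>
  A basis vector \<open>e\<^bsub>I 1\<^esub> \<otimes> \<cdots> \<otimes> e\<^bsub>I h\<^esub>\<close> of \<open>(\<complex>\<^sup>n)\<^sup>\<otimes>\<^sup>h\<close> is indexed by \<open>I \<in> multi_index h\<close>. A permutation \<open>\<tau>\<close> moves
  the tensor factor in position \<open>s\<close> to position \<open>\<tau> s\<close>, so it maps the basis vector \<open>K\<close> to the basis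
  vector \<open>K \<circ> inv \<tau>\<close>.
\<close>

definition multi_index :: "nat \<Rightarrow> (nat \<Rightarrow> 'n) set" where
  "multi_index h = {1..h} \<rightarrow>\<^sub>E UNIV"

definition tensor_perm_matrix :: "nat \<Rightarrow> galg \<Rightarrow> (nat \<Rightarrow> 'n) \<Rightarrow> (nat \<Rightarrow> 'n) \<Rightarrow> complex" where
  "tensor_perm_matrix h x J K =
     (\<Sum>\<tau> | \<tau> permutes {1..h}. x \<tau> * (if J = K \<circ> inv \<tau> then 1 else 0))"

definition shifted_E :: "complex \<Rightarrow> 'n \<Rightarrow> 'n \<Rightarrow> ('p, 'q, 'n) env" where
  "shifted_E c i j = gl_unit (Proper i) (Proper j) - (if i = j then scalar c else 0)"

definition tensor_E ::
    "nat \<Rightarrow> (nat \<Rightarrow> complex) \<Rightarrow> (nat \<Rightarrow> 'n) \<Rightarrow> (nat \<Rightarrow> 'n) \<Rightarrow> ('p, 'q, 'n) env" where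
  "tensor_E h c I J = prod_list (map (\<lambda>s. shifted_E (c s) (I s) (J s)) [1..<Suc h])"

definition E_tableau ::
    "nat list \<Rightarrow> (nat \<times> nat \<Rightarrow> nat) \<Rightarrow> (galg \<Rightarrow> galg \<Rightarrow> complex) \<Rightarrow> galg
      \<Rightarrow> (nat \<Rightarrow> 'n) \<Rightarrow> (nat \<Rightarrow> 'n) \<Rightarrow> ('p, 'q, 'n) env" where
  "E_tableau \<mu> T ip v I K =
     (\<Sum>J \<in> multi_index (sum_list \<mu>).
        tensor_E (sum_list \<mu>) (\<lambda>s. of_int (content \<mu> T s)) I J
        * scalar (tensor_perm_matrix (sum_list \<mu>) (young_psi (sum_list \<mu>) ip v) J K))"

definition quantum_immanant ::
    "nat list \<Rightarrow> (nat \<times> nat \<Rightarrow> nat) \<Rightarrow> (galg \<Rightarrow> galg \<Rightarrow> complex) \<Rightarrow> galg \<Rightarrow> ('p, 'q, 'n) env" where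
  "quantum_immanant \<mu> T ip v = (\<Sum>I \<in> multi_index (sum_list \<mu>). E_tableau \<mu> T ip v I I)"


section \<open>Compositions\<close>

definition compositions :: "nat \<Rightarrow> ('n::finite \<Rightarrow> nat) set" where
  "compositions h = {c. (\<Sum>p\<in>UNIV. c p) = h}"

text \<open>The sequence \<open>1\<^bsup>c 1\<^esup> 2\<^bsup>c 2\<^esup> \<cdots> n\<^bsup>c n\<^esup>\<close>, with positions counted from 1.\<close>

definition weakly_increasing_seq :: "('n::{finite, linorder} \<Rightarrow> nat) \<Rightarrow> nat \<Rightarrow> 'n" where
  "weakly_increasing_seq c s =
     concat (map (\<lambda>p. replicate (c p) p) (sorted_list_of_set UNIV)) ! (s - 1)"

end

theory Submission
  imports Defs "HOL-Combinatorics.Multiset_Permutations"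
begin

text \<open>
  \<open>U(gl(n)) \<inter> Irr = 0\<close>: the superalgebra acts on supersymmetric polynomials so that irregular products kill the vacuum
  while \<open>y \<in> U(gl(n))\<close> is recovered from \<open>y \<cdot> 1\<close> by normal ordering. Moving the last \<open>e\<^bsub>i,\<alpha>\<^esub>\<close> of a column Capelli
  bitableau to the right identifies it, up to the sign \<open>(-1)\<^bsup>h(h-1)/2\<^esup>\<close>, with a normally ordered product, and
  shows that the matrices \<open>N\<^sub>h\<close> of normally ordered products satisfy \<open>N\<^sub>h = (N\<^bsub>h-1\<^esub> \<otimes> 1)(E\<^sub>h - X\<^sub>h)\<close> with \<open>X\<^sub>h\<close> the
  Jucys--Murphy element. In front of \<open>\<Psi>\<^sub>T\<close>, \<open>X\<^sub>s\<close> acts as the content \<open>c\<^sub>T(s)\<close>, so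
  \<open>Tr E\<^sub>T = Tr (N\<^sub>h \<Psi>\<^sub>T) = \<Sum>\<^sub>\<sigma> (\<sigma> v, v) t(\<sigma>)\<close> for a class function \<open>t\<close>, and Schur averaging replaces \<open>(\<sigma> v, v)\<close> by
  \<open>\<kappa> \<chi>(\<sigma>) / h!\<close>, where \<open>\<kappa>\<close> is the factor in \<open>(ab)\<^sup>2 = \<kappa> ab\<close> for the Young symmetrizer \<open>ab\<close>. That \<open>\<kappa>\<close> is the hook product
  follows by removing the first column: the partial trace over the letters of its cells produces one hook length
  after the other. On the other side, each tuple \<open>(h\<^sub>1, \<dots>, h\<^sub>n)\<close> collects its \<open>h!/(h\<^sub>1! \<cdots> h\<^sub>n!)\<close> index sequences.
\<close>

text \<open>A PBW basis would give functionals that detect the elements of \<open>U_gl\<close>. Here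
  a single function, \<open>normal\<close>, does this: its values lie in the enveloping algebra
  itself, and every \<open>y\<close> in \<open>U_gl\<close> acts on it by left multiplication, so
  the value at the empty word after the action is \<open>y\<close>. The algebra acts on functions of
  lists from the right; supercommuting monomials can then stay plain lists, and supercommutativity
  becomes a property (\<open>supersym\<close>) of the functions.

  Both sides of the theorem reduce to the same class function \<open>\<zeta>\<close>, which is
  \<kappa> times the character, so the constant to be found is exactly \<kappa>. Its value is the
  hook length formula in disguise. It is computed on tensors over an alphabet with as many letters
  as the diagram has rows: distinct letters in the first column then form a permutation of the whole
  alphabet. Tracing out a cell of that column gives the number of letters for the identity, +1 for
  every cell to its right and -1 for every cell above it; the mixed terms vanish by a Garnir
  argument. The total is the hook length of the cell.\<close>

abbreviation swap :: "'a \<Rightarrow> 'a \<Rightarrow> 'a \<Rightarrow> 'a" where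
  "swap \<equiv> Transposition.transpose"

section \<open>The representation of the superalgebra on supersymmetric functions\<close>

text \<open>
  A list of pairs \<open>(a, k)\<close> stands for a monomial in supercommuting variables \<open>x\<^sub>a\<^sub>,\<^sub>k\<close>, where \<open>x\<^sub>a\<^sub>,\<^sub>k\<close> is odd iff
  \<open>a\<close> is some \<open>Alpha\<close>. The unit \<open>(a, b)\<close> acts on monomials by the superderivation \<open>\<Sum>\<^sub>k x\<^sub>a\<^sub>,\<^sub>k \<partial>\<^sub>b\<^sub>,\<^sub>k\<close>
  (\<open>polarize\<close>), to which \<open>gl_act\<close> adds multiplication by \<open>x\<^sub>a\<^sub>,\<^sub>j\<close> if \<open>b = Proper j\<close>; functions of monomials carry
  the dual right action \<open>(F \<cdot> u)(w) = F(u \<cdot> w)\<close>.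
\<close>

type_synonym ('p, 'q, 'n) vlist = "(('p, 'q, 'n) symb \<times> 'n) list"

text \<open>Koszul sign of moving a unit past a variable. The parity of a variable is opposite to
  that of its symbol because \<open>(a, Proper j)\<close>, which is to multiply by a variable with
  symbol \<open>a\<close>, is odd exactly when \<open>a\<close> is even.\<close>

definition pass_sign :: "('p, 'q, 'n) unit_ix \<Rightarrow> ('p, 'q, 'n) symb \<Rightarrow> 'r::ring_1" where
  "pass_sign u c = (if odd_unit u \<and> \<not> odd_symb c then - 1 else 1)"

section \<open>Superderivations by polarization\<close>

fun polarize :: "('p, 'q, 'n) unit_ix \<Rightarrow> (('p, 'q, 'n) vlist \<Rightarrow> 'r::ring_1) \<Rightarrow> ('p, 'q, 'n) vlist \<Rightarrow> 'r" where
  "polarize u F [] = 0"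
| "polarize u F ((c, k) # w) =
     (if c = snd u then F ((fst u, k) # w) else 0)
     + pass_sign u c * polarize u (\<lambda>w. F ((c, k) # w)) w"

lemma polarize_Cons:
  "polarize u F (z # w) =
     (if fst z = snd u then F ((fst u, snd z) # w) else 0)
     + pass_sign u (fst z) * polarize u (\<lambda>w. F (z # w)) w"
  by (cases z) simp

declare polarize.simps(2) [simp del]

lemma polarize_add: "polarize u (\<lambda>w. F w + G w) w = polarize u F w + polarize u G w"
  by (induction w arbitrary: F G) (auto simp: polarize_Cons algebra_simps)

lemma polarize_mult_left: "polarize u (\<lambda>w. r * F w) w = r * polarize u F w"
  by (induction w arbitrary: F) (auto simp: polarize_Cons pass_sign_def algebra_simps)

lemma polarize_mult_right: "polarize u (\<lambda>w. F w * r) w = polarize u F w * r"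
  by (induction w arbitrary: F) (auto simp: polarize_Cons pass_sign_def algebra_simps)

lemma polarize_zero [simp]: "polarize u (\<lambda>w. 0) w = 0"
  using polarize_mult_left[of u 0 "\<lambda>w. 0" w] by simp

lemma polarize_diff: "polarize u (\<lambda>w. F w - G w) w = polarize u F w - polarize u G w"
  using polarize_add[of u "\<lambda>w. F w - G w" G w] by (simp add: algebra_simps)

lemma polarize_if: "polarize u (\<lambda>w. if P then F w else G w) w = (if P then polarize u F w else polarize u G w)"
  by simp

lemma polarize_cong:
  "(\<And>w'. length w' = length w \<Longrightarrow> F w' = G w') \<Longrightarrow> polarize u F w = polarize u G w"
proof (induction w arbitrary: F G)
  case (Cons z w)
  have "polarize u (\<lambda>w. F (z # w)) w = polarize u (\<lambda>w. G (z # w)) w"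
    by (rule Cons.IH) (simp add: Cons.prems)
  then show ?case by (simp add: polarize_Cons Cons.prems)
qed simp

text \<open>The case analysis behind \<open>polarize_commutator\<close>: equalities of symbols
  become Booleans and the recursive terms free ring elements, which leaves finitely many sign
  patterns.\<close>

lemma commutator_signs:
  fixes s :: "'r::ring_1"
  assumes "s \<in> {1, - 1}" "pe \<in> {1, - 1}" "re \<in> {1, - 1}"
    and "ed \<Longrightarrow> pc = s * pe" "eb \<Longrightarrow> ra = s * re" "bc \<Longrightarrow> t = re * pe" "ad \<Longrightarrow> u = re * pe"
  shows "(if ed then (if bc then Xa else 0) + pc * A else 0)
      + re * ((if eb then B else 0) + pe * (s * Q + ((if bc then R1 else 0) - s * (if ad then R2 else 0))))
      - s * ((if eb then (if ad then Xc else 0) + ra * B else 0) + pe * ((if ed then A else 0) + re * Q))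
     = (if bc then (if ed then Xa else 0) + t * R1 else 0) - s * (if ad then (if eb then Xc else 0) + u * R2 else 0)"
proof -
  have "s = 1 \<or> s = - 1" "pe = 1 \<or> pe = - 1" "re = 1 \<or> re = - 1"
    using assms by simp_all
  then show ?thesis
    using assms(4-)
    by (elim disjE; cases ed; cases eb; cases bc; cases ad; simp add: algebra_simps)
qed

text \<open>The inner polarization is the left factor: in a right action \<open>F\<close> meets
  \<open>(a, b)\<close> first, so the composition stands for the product of \<open>(a, b)\<close> by
  \<open>(c, d)\<close>.\<close>

lemma polarize_commutator:
  "polarize (c, d) (\<lambda>w. polarize (a, b) F w) w - super_sign (a, b) (c, d) * polarize (a, b) (\<lambda>w. polarize (c, d) F w) w
   = (if b = c then polarize (a, d) F w else 0) - super_sign (a, b) (c, d) * (if a = d then polarize (c, b) F w else 0)"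
proof (induction w arbitrary: F)
  case (Cons z w)
  obtain e k where z: "z = (e, k)" by (cases z)
  note IH = Cons.IH[of "\<lambda>w. F ((e, k) # w)"]
  define P where "P = polarize (c, d) (\<lambda>w. polarize (a, b) (\<lambda>w. F ((e, k) # w)) w) w"
  define Q where "Q = polarize (a, b) (\<lambda>w. polarize (c, d) (\<lambda>w. F ((e, k) # w)) w) w"
  have P: "P = super_sign (a, b) (c, d) * Q + ((if b = c then polarize (a, d) (\<lambda>w. F ((e, k) # w)) w else 0) - super_sign (a, b) (c, d) * (if a = d then polarize (c, b) (\<lambda>w. F ((e, k) # w)) w else 0))"
    using IH by (simp add: P_def Q_def algebra_simps)
  have 1: "polarize (c, d) (\<lambda>w. polarize (a, b) F w) (z # w) =
     (if e = d then (if c = b then F ((a, k) # w) else 0) + pass_sign (a, b) c * polarize (a, b) (\<lambda>w. F ((c, k) # w)) w else 0)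
     + pass_sign (c, d) e * ((if e = b then polarize (c, d) (\<lambda>w. F ((a, k) # w)) w else 0) + pass_sign (a, b) e * P)"
    by (simp add: z polarize_Cons polarize_add polarize_mult_left polarize_if P_def)
  have 2: "polarize (a, b) (\<lambda>w. polarize (c, d) F w) (z # w) =
     (if e = b then (if a = d then F ((c, k) # w) else 0) + pass_sign (c, d) a * polarize (c, d) (\<lambda>w. F ((a, k) # w)) w else 0)
     + pass_sign (a, b) e * ((if e = d then polarize (a, b) (\<lambda>w. F ((c, k) # w)) w else 0) + pass_sign (c, d) e * Q)"
    by (simp add: z polarize_Cons polarize_add polarize_mult_left polarize_if Q_def)
  show ?case
    unfolding 1 2 unfolding P unfolding z polarize_Cons fst_conv snd_conv eq_commute[of c b]
    by (rule commutator_signs)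
      (auto simp: pass_sign_def super_sign_def odd_unit_def)
qed simp

text \<open>Conjugating the superderivation by the exponential of the sum of all variables with
  symbol \<open>Proper j\<close> and index \<open>j\<close> produces exactly the additional term,
  because the derivative of that sum is 1 at \<open>b = Proper k\<close> and 0 otherwise. The
  commutation relations therefore survive.\<close>

definition gl_act :: "('p, 'q, 'n) unit_ix \<Rightarrow> (('p, 'q, 'n) vlist \<Rightarrow> 'r::ring_1) \<Rightarrow> ('p, 'q, 'n) vlist \<Rightarrow> 'r" where
  "gl_act u F w = (case snd u of Proper j \<Rightarrow> F ((fst u, j) # w) | _ \<Rightarrow> 0) + polarize u F w"

definition swap_sign :: "('p, 'q, 'n) symb \<Rightarrow> ('p, 'q, 'n) symb \<Rightarrow> 'r::ring_1" where
  "swap_sign c d = (if \<not> odd_symb c \<and> \<not> odd_symb d then - 1 else 1)"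

text \<open>These are the functions of words that come from linear functionals on supercommutative
  polynomials.\<close>

definition supersym :: "(('p, 'q, 'n) vlist \<Rightarrow> 'r::ring_1) \<Rightarrow> bool" where
  "supersym F \<longleftrightarrow> (\<forall>p x y v. F (p @ x # y # v) =
     swap_sign (fst x) (fst y) * F (p @ y # x # v))"

lemma supersymD: "supersym F \<Longrightarrow> F (p @ x # y # v) =
     swap_sign (fst x) (fst y) * F (p @ y # x # v)"
  unfolding supersym_def by blast

lemma supersym_Cons: "supersym F \<Longrightarrow> supersym (\<lambda>w. F (z # w))"
  unfolding supersym_def by (metis append_Cons)

text \<open>Replacing a letter changes the sign of its exchange with a neighbour by exactly the sign
  of moving the unit past that neighbour.\<close>

lemma polarize_swap:
  assumes "supersym F"
  shows "polarize u F (p @ x # y # v) = swap_sign (fst x) (fst y) * polarize u F (p @ y # x # v)"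
  using assms
proof (induction p arbitrary: F)
  case Nil
  obtain a b where u: "u = (a, b)" by (cases u)
  obtain c k where x: "x = (c, k)" by (cases x)
  obtain d l where y: "y = (d, l)" by (cases y)
  note s = supersymD[OF Nil, of "[]", unfolded append_Nil]
  define F1 where "F1 = F ((d, l) # (a, k) # v)"
  define F2 where "F2 = F ((c, k) # (a, l) # v)"
  define Q where "Q = polarize u (\<lambda>w. F ((d, l) # (c, k) # w)) v"
  have F1: "F ((a, k) # (d, l) # v) = swap_sign a d * F1"
    unfolding F1_def by (subst s) simp
  have F2: "F ((a, l) # (c, k) # v) = swap_sign a c * F2"
    unfolding F2_def by (subst s) simp
  have Q: "polarize u (\<lambda>w. F ((c, k) # (d, l) # w)) v = swap_sign c d * Q"
    unfolding Q_def by (subst s) (simp add: polarize_mult_left)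
  have 1: "polarize u F ([] @ x # y # v) =
      (if c = b then swap_sign a d * F1 else 0)
      + pass_sign u c * ((if d = b then F2 else 0) + pass_sign u d * (swap_sign c d * Q))"
    unfolding Q[symmetric] F1[symmetric] F2_def by (simp add: polarize_Cons x y u)
  have 2: "polarize u F ([] @ y # x # v) =
      (if d = b then swap_sign a c * F2 else 0)
      + pass_sign u d * ((if c = b then F1 else 0) + pass_sign u c * Q)"
    unfolding Q_def F2[symmetric] F1_def by (simp add: polarize_Cons x y u)
  have signs: "c = b \<Longrightarrow> swap_sign a d = swap_sign c d * (pass_sign u d :: 'd)"
    "d = b \<Longrightarrow> pass_sign u c = swap_sign c d * (swap_sign a c :: 'd)"
    "pass_sign u c * (pass_sign u d * (swap_sign c d * Q)) = swap_sign c d * (pass_sign u d * (pass_sign u c * Q))"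
    by (auto simp: swap_sign_def pass_sign_def odd_unit_def u)
  have square: "swap_sign c d * (swap_sign c d * r) = r" for c d :: "('a, 'b, 'c) symb" and r :: 'd
    by (simp add: swap_sign_def)
  show ?case
    unfolding 1 2 unfolding x y fst_conv distrib_left signs(3) using signs(1,2)
    by (cases "c = b"; cases "d = b"; simp add: distrib_left mult.assoc square)
next
  case (Cons z p)
  have "F ((fst u, snd z) # p @ x # y # v) = swap_sign (fst x) (fst y) * F ((fst u, snd z) # p @ y # x # v)"
    using supersymD[OF Cons.prems, of "(fst u, snd z) # p" x y v] unfolding append_Cons .
  with Cons.IH[OF supersym_Cons[OF Cons.prems]] show ?case
    by (simp only: append_Cons polarize_Cons) (simp add: pass_sign_def swap_sign_def)
qed

lemma supersym_gl_act:
  assumes "supersym F"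
  shows "supersym (gl_act u F)"
  unfolding supersym_def
proof (intro allI)
  fix p x y v
  have "F ((fst u, j) # p @ x # y # v) = swap_sign (fst x) (fst y) * F ((fst u, j) # p @ y # x # v)" for j
    using supersymD[OF assms, of "(fst u, j) # p" x y v] unfolding append_Cons .
  then show "gl_act u F (p @ x # y # v) = swap_sign (fst x) (fst y) * gl_act u F (p @ y # x # v)"
    unfolding gl_act_def polarize_swap[OF assms, of u p x y v]
    by (cases "snd u") (simp_all only: symb.case distrib_left mult_zero_right)
qed

lemma gl_act_signs:
  fixes s :: "'r::ring_1"
  assumes "s \<in> {1, - 1}"
    and "dp \<Longrightarrow> pc = s" "bp \<Longrightarrow> ra = s" "bp \<and> dp \<Longrightarrow> Y = s * X"
  shows "(if dp then (if bp then Y else 0) + ((if bc then L1 else 0) + pc * A) else 0) + ((if bp then B else 0)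
      + (s * Q + ((if bc then R1 else 0) - s * (if ad then R2 else 0))))
      - s * ((if bp then (if dp then X else 0) + ((if ad then L2 else 0) + ra * B) else 0) + ((if dp then A else 0) + Q))
     = (if bc then (if dp then L1 else 0) + R1 else 0) - s * (if ad then (if bp then L2 else 0) + R2 else 0)"
proof -
  have "s = 1 \<or> s = - 1"
    using assms by simp
  then show ?thesis
    using assms(2-)
    by (elim disjE; cases bp; cases dp; cases bc; cases ad; simp add: algebra_simps)
qed

text \<open>Together with \<open>col_of\<close> this turns the case distinction in
  \<open>gl_act\<close> into a conditional, the form that \<open>gl_act_signs\<close>
  handles.\<close>

definition is_proper :: "('p, 'q, 'n) symb \<Rightarrow> bool" where
  "is_proper a \<longleftrightarrow> \<not> is_virtual a"

definition col_of :: "('p, 'q, 'n) symb \<Rightarrow> 'n" where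
  "col_of a = (THE j. a = Proper j)"

lemma col_of_Proper [simp]: "col_of (Proper j) = j"
  by (simp add: col_of_def)

lemma case_symb_proper: "(case a of Proper j \<Rightarrow> f j | _ \<Rightarrow> z) = (if is_proper a then f (col_of a) else z)"
  by (cases a) (simp_all add: is_proper_def)

text \<open>Beyond \<open>polarize_commutator\<close> there are terms with two new letters in either
  order. They cancel because \<open>supersym\<close> lets the two letters be exchanged, with the
  sign of the superbracket.\<close>

lemma gl_act_commutator:
  assumes "supersym F"
  shows "gl_act (c, d) (gl_act (a, b) F) w - super_sign (a, b) (c, d) * gl_act (a, b) (gl_act (c, d) F) w
   = (if b = c then gl_act (a, d) F w else 0) - super_sign (a, b) (c, d) * (if a = d then gl_act (c, b) F w else 0)"
proof -
  define P where "P = polarize (c, d) (\<lambda>w. polarize (a, b) F w) w"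
  define Q where "Q = polarize (a, b) (\<lambda>w. polarize (c, d) F w) w"
  have P: "P = super_sign (a, b) (c, d) * Q + ((if b = c then polarize (a, d) F w else 0) - super_sign (a, b) (c, d) * (if a = d then polarize (c, b) F w else 0))"
    using polarize_commutator[of c d a b F w] by (simp add: P_def Q_def algebra_simps)
  have s: "F ((a, k) # (c, l) # w) = swap_sign a c * F ((c, l) # (a, k) # w)" for k l
    using supersymD[OF assms, of "[]" "(a, k)" "(c, l)" w] by simp
  have 1: "gl_act (c, d) (gl_act (a, b) F) w =
     (if is_proper d then (if is_proper b then F ((a, col_of b) # (c, col_of d) # w) else 0)
        + ((if b = c then F ((a, col_of d) # w) else 0) + pass_sign (a, b) c * polarize (a, b) (\<lambda>w. F ((c, col_of d) # w)) w) else 0)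
     + ((if is_proper b then polarize (c, d) (\<lambda>w. F ((a, col_of b) # w)) w else 0) + P)"
    unfolding gl_act_def P_def case_symb_proper by (simp add: polarize_Cons polarize_add eq_commute)
  have 2: "gl_act (a, b) (gl_act (c, d) F) w =
     (if is_proper b then (if is_proper d then F ((c, col_of d) # (a, col_of b) # w) else 0)
        + ((if a = d then F ((c, col_of b) # w) else 0) + pass_sign (c, d) a * polarize (c, d) (\<lambda>w. F ((a, col_of b) # w)) w) else 0)
     + ((if is_proper d then polarize (a, b) (\<lambda>w. F ((c, col_of d) # w)) w else 0) + Q)"
    unfolding gl_act_def Q_def case_symb_proper by (simp add: polarize_Cons polarize_add)
  have R: "gl_act (a, d) F w = (if is_proper d then F ((a, col_of d) # w) else 0) + polarize (a, d) F w"
    "gl_act (c, b) F w = (if is_proper b then F ((c, col_of b) # w) else 0) + polarize (c, b) F w"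
    by (simp_all add: gl_act_def case_symb_proper)
  show ?thesis
    unfolding 1 2 unfolding P R
  proof (rule gl_act_signs)
    show "super_sign (a, b) (c, d) \<in> {1, - 1 :: 'd}"
      by (simp add: super_sign_def)
    show "is_proper d \<Longrightarrow> pass_sign (a, b) c = (super_sign (a, b) (c, d) :: 'd)"
      by (cases d) (auto simp: is_proper_def super_sign_def pass_sign_def odd_unit_def)
    show "is_proper b \<Longrightarrow> pass_sign (c, d) a = (super_sign (a, b) (c, d) :: 'd)"
      by (cases b) (auto simp: is_proper_def super_sign_def pass_sign_def odd_unit_def)
    assume "is_proper b \<and> is_proper d"
    then have "swap_sign a c = (super_sign (a, b) (c, d) :: 'd)"
      by (cases b; cases d) (auto simp: is_proper_def super_sign_def swap_sign_def odd_unit_def)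
    then show "F ((a, col_of b) # (c, col_of d) # w) = super_sign (a, b) (c, d) * F ((c, col_of d) # (a, col_of b) # w)"
      by (subst s) simp
  qed
qed

section \<open>The action of the tensor algebra and of its quotient\<close>

lemma poly_mapping_single_induct [case_names zero single_add]:
  fixes f :: "'a \<Rightarrow>\<^sub>0 'b::comm_monoid_add"
  assumes "P 0" "\<And>k c f. P f \<Longrightarrow> P (Poly_Mapping.single k c + f)"
  shows "P f"
proof (induction f rule: update_induct)
  case const
  then show ?case using assms(1) by simp
next
  case (update f a b)
  have "Poly_Mapping.update a b f = Poly_Mapping.single a b + f"
    using update(1) by (intro poly_mapping_eqI) (auto simp: lookup_update lookup_add lookup_single when_def in_keys_iff)
  then show ?case using assms(2)[OF update(3)] by simp
qed

lemma scalar_0 [simp]: "scalar 0 = 0"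
  by transfer (simp add: env_rel_def env_ideal.zero)

lemma scalar_1 [simp]: "scalar 1 = 1"
  by transfer (simp add: env_rel_def env_ideal.zero)

lemma scalar_add: "scalar (c + d) = scalar c + scalar d"
  by transfer (simp add: env_rel_def env_ideal.zero single_add)

lemma scalar_uminus: "scalar (- c) = - scalar c"
  by transfer (simp add: env_rel_def env_ideal.zero single_uminus)

lemma scalar_mult: "scalar (c * d) = scalar c * scalar d"
  by transfer (simp add: env_rel_def env_ideal.zero mult_single)

lemma scalar_sum: "scalar (\<Sum>x\<in>A. f x) = (\<Sum>x\<in>A. scalar (f x))"
  by (induction A rule: infinite_finite_induct) (simp_all add: scalar_add)

lemma scalar_commute: "x * scalar c = scalar c * x"
proof transfer
  fix x :: "('a, 'b, 'c) tensor_alg" and c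
  have "x * Poly_Mapping.single 0 c = Poly_Mapping.single 0 c * x"
    by (induction x rule: poly_mapping_single_induct) (simp_all add: distrib_left distrib_right mult_single mult.commute)
  then show "env_rel (x * Poly_Mapping.single 0 c) (Poly_Mapping.single 0 c * x)"
    by (simp add: env_rel_def env_ideal.zero)
qed

lemma gl_act_add: "gl_act u (\<lambda>w. F w + G w) = (\<lambda>w. gl_act u F w + gl_act u G w)"
  by (rule ext) (cases "snd u"; simp add: gl_act_def polarize_add)

lemma gl_act_mult_left: "gl_act u (\<lambda>w. r * F w) = (\<lambda>w. r * gl_act u F w)"
  by (rule ext) (cases "snd u"; simp add: gl_act_def polarize_mult_left distrib_left)

lemma fold_gl_act_add: "fold gl_act us (\<lambda>w. F w + G w) = (\<lambda>w. fold gl_act us F w + fold gl_act us G w)"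
  by (induction us arbitrary: F G) (simp_all add: gl_act_add)

lemma fold_gl_act_mult_left: "fold gl_act us (\<lambda>w. r * F w) = (\<lambda>w. r * fold gl_act us F w)"
  by (induction us arbitrary: F) (simp_all add: gl_act_mult_left)

lemma supersym_zero: "supersym (\<lambda>w. 0)"
  by (simp add: supersym_def)

lemma supersym_add: "supersym F \<Longrightarrow> supersym G \<Longrightarrow> supersym (\<lambda>w. F w + G w)"
  unfolding supersym_def by (metis distrib_left)

lemma supersym_mult_left:
  assumes "supersym F"
  shows "supersym (\<lambda>w. r * F w)"
  unfolding supersym_def
proof (intro allI)
  fix p x y v
  show "r * F (p @ x # y # v) = swap_sign (fst x) (fst y) * (r * F (p @ y # x # v))"
    unfolding supersymD[OF assms, of p x y v] by (simp add: swap_sign_def)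
qed

lemma supersym_fold_gl_act: "supersym F \<Longrightarrow> supersym (fold gl_act us F)"
  by (induction us arbitrary: F) (simp_all add: supersym_gl_act)

text \<open>\<open>fold\<close> applies the first letter of a word first, as a right action
  requires. The values lie in the enveloping algebra so that \<open>normal\<close> is among the
  functions acted on.\<close>

definition tensor_act :: "('p, 'q, 'n) tensor_alg \<Rightarrow> (('p, 'q, 'n) vlist \<Rightarrow> ('p, 'q, 'n) env) \<Rightarrow> ('p, 'q, 'n) vlist \<Rightarrow> ('p, 'q, 'n) env" where
  "tensor_act f F w = (\<Sum>u\<in>Poly_Mapping.keys f. scalar (Poly_Mapping.lookup f u) * fold gl_act (letters u) F w)"

lemma tensor_act_superset:
  assumes "finite A" "Poly_Mapping.keys f \<subseteq> A"
  shows "tensor_act f F w = (\<Sum>u\<in>A. scalar (Poly_Mapping.lookup f u) * fold gl_act (letters u) F w)"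
  unfolding tensor_act_def
  by (rule sum.mono_neutral_left) (use assms in \<open>auto simp: in_keys_iff\<close>)

lemma tensor_act_zero_left [simp]: "tensor_act 0 F w = 0"
  by (simp add: tensor_act_def)

lemma tensor_act_add: "tensor_act (f + g) F w = tensor_act f F w + tensor_act g F w"
proof -
  let ?A = "Poly_Mapping.keys f \<union> Poly_Mapping.keys g"
  have "Poly_Mapping.keys (f + g) \<subseteq> ?A"
    by (rule Poly_Mapping.keys_add)
  then show ?thesis
    by (simp add: tensor_act_superset[of ?A] lookup_add scalar_add distrib_right sum.distrib)
qed

lemma tensor_act_uminus: "tensor_act (- f) F w = - tensor_act f F w"
  using tensor_act_add[of f "- f" F w] by (simp add: eq_neg_iff_add_eq_0 add.commute)

lemma tensor_act_diff: "tensor_act (f - g) F w = tensor_act f F w - tensor_act g F w"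
  using tensor_act_add[of f "- g" F w] by (simp add: tensor_act_uminus)

lemma tensor_act_single: "tensor_act (Poly_Mapping.single u c) F w = scalar c * fold gl_act (letters u) F w"
  by (cases "c = 0") (simp_all add: tensor_act_def)

lemma tensor_act_add_right: "tensor_act f (\<lambda>w. F w + G w) w = tensor_act f F w + tensor_act f G w"
  by (simp add: tensor_act_def fold_gl_act_add distrib_left sum.distrib)

lemma tensor_act_mult_right: "tensor_act f (\<lambda>w. r * F w) w = r * tensor_act f F w"
  unfolding tensor_act_def fold_gl_act_mult_left sum_distrib_left
  by (intro sum.cong refl) (simp add: mult.assoc[symmetric] scalar_commute)

lemma tensor_act_zero_right: "tensor_act f (\<lambda>w. 0) w = 0"
  using tensor_act_mult_right[of f 0 "\<lambda>w. 0" w] by simp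

lemma tensor_act_mult: "tensor_act (f * g) F w = tensor_act g (tensor_act f F) w"
proof (induction f rule: poly_mapping_single_induct)
  case zero
  have "tensor_act 0 F = (\<lambda>w. 0)" by (rule ext) simp
  then show ?case by (simp add: tensor_act_zero_right)
next
  case (single_add u c f)
  have "tensor_act (Poly_Mapping.single u c * g) F w = tensor_act g (tensor_act (Poly_Mapping.single u c) F) w"
  proof (induction g rule: poly_mapping_single_induct)
    case (single_add v d g)
    have "tensor_act (Poly_Mapping.single u c) F = (\<lambda>w. scalar c * fold gl_act (letters u) F w)"
      by (rule ext) (simp add: tensor_act_single)
    moreover have "scalar (c * d) * x = scalar d * (scalar c * x)" for x :: "('a, 'b, 'c) env"
      by (simp add: scalar_mult[symmetric] mult.assoc[symmetric] mult.commute[of c])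
    ultimately show ?case using single_add
      by (simp add: distrib_left mult_single tensor_act_add tensor_act_single plus_word_def fold_gl_act_mult_left mult.assoc)
  qed simp
  moreover have "tensor_act (Poly_Mapping.single u c + f) F = (\<lambda>w. tensor_act (Poly_Mapping.single u c) F w + tensor_act f F w)"
    by (rule ext) (rule tensor_act_add)
  ultimately show ?case
    using single_add by (simp add: distrib_right tensor_act_add tensor_act_add_right)
qed

lemma supersym_tensor_act:
  assumes "supersym F"
  shows "supersym (tensor_act f F)"
proof (induction f rule: poly_mapping_single_induct)
  case zero
  have "tensor_act 0 F = (\<lambda>w. 0)" by (rule ext) simp
  then show ?case by (simp add: supersym_zero)
next
  case (single_add u c f)
  have "tensor_act (Poly_Mapping.single u c + f) F = (\<lambda>w. scalar c * fold gl_act (letters u) F w + tensor_act f F w)"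
    by (rule ext) (simp add: tensor_act_add tensor_act_single)
  then show ?case
    by (simp add: supersym_add supersym_mult_left supersym_fold_gl_act assms single_add)
qed

lemma tensor_act_letter: "tensor_act (letter x) F = gl_act x F"
  by (rule ext) (simp add: letter_def tensor_act_single)

lemma tensor_act_super_sign: "tensor_act (super_sign x y * f) F w = super_sign x y * tensor_act f F w"
  by (simp add: super_sign_def tensor_act_uminus)

lemma tensor_act_if: "tensor_act (if P then f else g) F w = (if P then tensor_act f F w else tensor_act g F w)"
  by simp

lemma tensor_act_env_ideal:
  assumes "f \<in> env_ideal" "supersym F"
  shows "tensor_act f F w = 0"
  using assms
proof (induction arbitrary: w rule: env_ideal.induct)
  case (gen u x y v)
  obtain a b c d where xy: "x = (a, b)" "y = (c, d)" by (cases x; cases y)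
  define G where "G = tensor_act u F"
  have "supersym G" by (simp add: G_def supersym_tensor_act gen)
  have "tensor_act (letter x * letter y - super_sign x y * (letter y * letter x) - superbracket x y) G w = 0" for w
    using gl_act_commutator[OF \<open>supersym G\<close>, of c d a b w]
    by (simp only: xy tensor_act_diff tensor_act_super_sign superbracket.simps tensor_act_if tensor_act_zero_left)
      (simp only: tensor_act_mult tensor_act_letter diff_self)
  then have "tensor_act (letter x * letter y - super_sign x y * (letter y * letter x) - superbracket x y) G = (\<lambda>w. 0)"
    by (rule ext)
  then show ?case
    by (simp add: ext[OF tensor_act_mult] tensor_act_zero_right G_def)
qed (simp_all add: tensor_act_add)

text \<open>The ideal is known to act as zero on supersymmetric functions; the default 0 on all
  others makes the result independent of the representative.\<close>

lift_definition env_act :: "('p, 'q, 'n) env \<Rightarrow> (('p, 'q, 'n) vlist \<Rightarrow> ('p, 'q, 'n) env) \<Rightarrow> ('p, 'q, 'n) vlist \<Rightarrow> ('p, 'q, 'n) env"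
  is "\<lambda>f F. if supersym F then tensor_act f F else (\<lambda>w. 0)"
proof -
  fix f g :: "('p, 'q, 'n) tensor_alg"
  assume "env_rel f g"
  then have "supersym F \<Longrightarrow> tensor_act f F = tensor_act g F" for F
    by (intro ext) (metis env_rel_def tensor_act_env_ideal tensor_act_diff eq_iff_diff_eq_0)
  then show "(\<lambda>F. if supersym F then tensor_act f F else (\<lambda>w. 0)) = (\<lambda>F. if supersym F then tensor_act g F else (\<lambda>w. 0))"
    by auto
qed

lemma supersym_env_act: "supersym F \<Longrightarrow> supersym (env_act x F)"
  by (induction x) (simp add: env_act.abs_eq supersym_tensor_act)

lemma env_act_add: "env_act (x + y) F w = env_act x F w + env_act y F w"
  by (induction x; induction y) (simp add: env_act.abs_eq plus_env.abs_eq tensor_act_add)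

lemma env_act_zero: "env_act 0 F w = 0"
  by (simp add: env_act.abs_eq zero_env_def)

lemma env_act_mult: "supersym F \<Longrightarrow> env_act (x * y) F w = env_act y (env_act x F) w"
  by (induction x; induction y) (simp add: env_act.abs_eq times_env.abs_eq tensor_act_mult supersym_tensor_act)

lemma env_act_scalar: "supersym F \<Longrightarrow> env_act (scalar c) F w = scalar c * F w"
  by (simp add: env_act.abs_eq scalar.abs_eq tensor_act_single zero_word_def)

lemma env_act_one: "supersym F \<Longrightarrow> env_act 1 F w = F w"
  using env_act_scalar[of F 1 w] by simp

lemma env_act_gl_unit: "supersym F \<Longrightarrow> env_act (gl_unit a b) F = gl_act (a, b) F"
  by (simp add: env_act.abs_eq gl_unit.abs_eq tensor_act_letter)

lemma env_act_mult_right: "supersym F \<Longrightarrow> env_act x (\<lambda>w. r * F w) w = r * env_act x F w"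
  by (induction x) (simp add: env_act.abs_eq supersym_mult_left tensor_act_mult_right)

lemma env_act_unit_prod: "supersym F \<Longrightarrow> env_act (unit_prod us) F w = fold gl_act us F w"
proof (induction us arbitrary: F)
  case Nil
  then show ?case by (simp add: unit_prod_def env_act_one)
next
  case (Cons u us)
  then show ?case
    by (cases u) (simp add: unit_prod_def env_act_mult env_act_gl_unit supersym_gl_act)
qed

section \<open>Irregular products annihilate the vacuum\<close>

lemma polarize_count_eq_0:
  assumes "count_list (map fst w) (snd u) = 0"
  shows "polarize u F w = 0"
  using assms
  by (induction w arbitrary: F) (auto simp: polarize_Cons split: if_splits)

text \<open>Polarization trades one letter \<open>snd u\<close> for one \<open>fst u\<close>, which
  fixes the number of letters \<gamma> in all words at which \<open>F\<close> is evaluated.\<close>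

lemma polarize_vanish:
  assumes "\<And>w'. length w' = length w \<Longrightarrow> count_list (map fst w') \<gamma> + of_bool (snd u = \<gamma>) = count_list (map fst w) \<gamma> + of_bool (fst u = \<gamma>) \<Longrightarrow> F w' = 0"
  shows "polarize u F w = 0"
  using assms
proof (induction w arbitrary: F)
  case (Cons z w)
  have "polarize u (\<lambda>w. F (z # w)) w = 0"
    by (rule Cons.IH, rule Cons.prems) auto
  moreover have "fst z = snd u \<Longrightarrow> F ((fst u, snd z) # w) = 0"
    by (rule Cons.prems) auto
  ultimately show ?case by (simp add: polarize_Cons)
qed simp

text \<open>The extra count \<open>count_list (map fst w) \<gamma>\<close> is what makes the induction on the word go through.\<close>

lemma fold_gl_act_irregular:
  assumes "is_virtual \<gamma>" "i \<in> {1..length us}"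
    and "count_list (map snd (take i (rev us))) \<gamma> > count_list (map fst w) \<gamma> + count_list (map fst (take (i - 1) (rev us))) \<gamma>"
  shows "fold gl_act us F w = 0"
  using assms(2-)
proof (induction us arbitrary: i w rule: rev_induct)
  case (snoc u us)
  let ?G = "fold gl_act us F"
  have prepend: "(case snd u of Proper j \<Rightarrow> ?G ((fst u, j) # w) | _ \<Rightarrow> 0) = 0 \<and> polarize u ?G w = 0"
  \<comment> \<open>For \<open>i = 1\<close> the rightmost unit, which acts on the word first, asks
    for a letter \<gamma> that \<open>w\<close> does not contain. Otherwise it alters the count of
    \<gamma> in the word by as much as it contributes to the two sides of the inequality.\<close>
  proof (cases "i = 1")
    case True
    then have u: "snd u = \<gamma>" "count_list (map fst w) (snd u) = 0"
      using snoc.prems by (auto split: if_splits)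
    then show ?thesis
      using assms(1) polarize_count_eq_0[OF u(2)] by (cases "snd u") auto
  next
    case False
    then obtain k where i: "i = Suc (Suc k)"
      using snoc.prems(1) by (metis atLeastAtMost_iff not0_implies_Suc not_less_eq_eq One_nat_def zero_le)
    have zero: "?G w' = 0"
      if "count_list (map fst w') \<gamma> + of_bool (snd u = \<gamma>) \<le> count_list (map fst w) \<gamma> + of_bool (fst u = \<gamma>)" for w'
      by (rule snoc.IH[of "Suc k"]) (use snoc.prems that in \<open>auto simp: i split: if_splits\<close>)
    have "polarize u ?G w = 0"
      by (rule polarize_vanish[of _ \<gamma>], rule zero) simp
    moreover have "?G ((fst u, j) # w) = 0" if "snd u = Proper j" for j
      using that assms(1) by (intro zero) (cases \<gamma>; auto)
    ultimately show ?thesis by (cases "snd u") auto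
  qed
  have "fold gl_act (us @ [u]) F w = gl_act u ?G w" by simp
  also have "\<dots> = 0" using prepend by (simp add: gl_act_def)
  finally show ?case .
qed simp

text \<open>In a right action the left factor of \<open>u * unit_prod w\<close> is absorbed into the
  function, so a left ideal is handled by letting \<open>F\<close> vary.\<close>

lemma env_act_Irr:
  assumes "x \<in> Irr" "supersym F"
  shows "env_act x F [] = 0"
  using assms
proof (induction arbitrary: F rule: Irr.induct)
  case (gen us u)
  then obtain i \<gamma> where "i \<in> {1..length us}" "is_virtual \<gamma>"
    "count_list (map snd (take i (rev us))) \<gamma> > count_list (map fst (take (i - 1) (rev us))) \<gamma>"
    unfolding irregular_def by blast
  then have "fold gl_act us (env_act u F) [] = 0"
    by (intro fold_gl_act_irregular[of \<gamma> i]) auto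
  then show ?case
    using gen by (simp add: env_act_mult env_act_unit_prod supersym_env_act)
qed (simp_all add: env_act_add env_act_zero)

section \<open>Normally ordered products and the projection onto \<open>\<^bold>U(gl(n))\<close>\<close>

lemma gl_unit_commutator:
  "gl_unit a b * gl_unit c d - super_sign (a, b) (c, d) * (gl_unit c d * gl_unit a b)
   = (if b = c then gl_unit a d else 0) - super_sign (a, b) (c, d) * (if a = d then gl_unit c b else 0)"
proof -
  have "gl_unit a b * gl_unit c d - super_sign (a, b) (c, d) * (gl_unit c d * gl_unit a b)
    - ((if b = c then gl_unit a d else 0) - super_sign (a, b) (c, d) * (if a = d then gl_unit c b else 0)) =
    abs_env (1 * (letter (a, b) * letter (c, d) - super_sign (a, b) (c, d) * (letter (c, d) * letter (a, b)) - superbracket (a, b) (c, d)) * 1)"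
    by (simp add: super_sign_def gl_unit.abs_eq times_env.abs_eq minus_env.abs_eq plus_env.abs_eq uminus_env.abs_eq zero_env_def)
  also have "\<dots> = 0"
    unfolding zero_env_def env.abs_eq_iff env_rel_def diff_zero by (rule env_ideal.gen)
  finally show ?thesis by simp
qed

text \<open>The recursion solves \<open>gl_act (Proper i, Proper k) F w = gl_unit (Proper i) (Proper
  k) * F w\<close> for the value of \<open>F\<close> at the longer word. The bound on the length
  makes it primitive, since polarization leads to words of the length of the tail other than the
  tail.\<close>

primrec normal_aux :: "nat \<Rightarrow> ('p, 'q, 'n) vlist \<Rightarrow> ('p, 'q, 'n) env" where
  "normal_aux 0 w = (if w = [] then 1 else 0)"
| "normal_aux (Suc m) w = (case w of [] \<Rightarrow> 1 | z # w \<Rightarrow>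
     if is_proper (fst z) then gl_unit (fst z) (Proper (snd z)) * normal_aux m w - polarize (fst z, Proper (snd z)) (normal_aux m) w else 0)"

text \<open>
  The normally ordered product of the \<open>gl_unit c (Proper k)\<close>, for \<open>(c, k)\<close> running through the list, set to 0
  if some \<open>c\<close> is virtual.
\<close>

definition normal :: "('p, 'q, 'n) vlist \<Rightarrow> ('p, 'q, 'n) env" where
  "normal w = normal_aux (length w) w"

lemma normal_Nil [simp]: "normal [] = 1"
  by (simp add: normal_def)

lemma normal_Cons:
  "normal ((Proper i, k) # w) = gl_unit (Proper i) (Proper k) * normal w - polarize (Proper i, Proper k) normal w"
proof -
  have "polarize (Proper i, Proper k) (normal_aux (length w)) w = polarize (Proper i, Proper k) normal w"
    by (rule polarize_cong) (simp add: normal_def)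
  then show ?thesis by (simp add: normal_def is_proper_def)
qed

text \<open>The recursion stops at 0 as soon as a virtual symbol stands in front; until then its
  units have proper symbols and never remove a virtual letter.\<close>

lemma normal_aux_virtual:
  assumes "\<gamma> \<in> set (map fst w)" "is_virtual \<gamma>"
  shows "normal_aux m w = 0"
  using assms(1)
proof (induction m arbitrary: w)
  case (Suc m)
  then obtain z w' where w: "w = z # w'" by (cases w) auto
  show ?case
  proof (cases "is_virtual (fst z)")
    case False
    then have \<gamma>: "\<gamma> \<in> set (map fst w')" "Proper (snd z) \<noteq> \<gamma>" "fst z \<noteq> \<gamma>"
      using Suc.prems w assms(2) by auto
    have "polarize (fst z, Proper (snd z)) (normal_aux m) w' = 0"
    proof (rule polarize_vanish[of _ \<gamma>])
      fix w'' :: "('a, 'b, 'c) vlist"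
      assume "count_list (map fst w'') \<gamma> + of_bool (snd (fst z, Proper (snd z)) = \<gamma>)
        = count_list (map fst w') \<gamma> + of_bool (fst (fst z, Proper (snd z)) = \<gamma>)"
      then have "count_list (map fst w'') \<gamma> = count_list (map fst w') \<gamma>"
        using \<gamma> by simp
      then have "\<gamma> \<in> set (map fst w'')"
        using \<gamma>(1) count_list_0_iff[of "map fst w'" \<gamma>] count_list_0_iff[of "map fst w''" \<gamma>] by presburger
      then show "normal_aux m w'' = 0"
        by (rule Suc.IH)
    qed
    then show ?thesis using Suc.IH[OF \<gamma>(1)] w by simp
  qed (simp add: w is_proper_def)
qed auto

lemma normal_virtual: "\<gamma> \<in> set (map fst w) \<Longrightarrow> is_virtual \<gamma> \<Longrightarrow> normal w = 0"
  unfolding normal_def by (rule normal_aux_virtual)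

lemma normal_aux_Cons_Proper:
  "normal_aux (Suc m) ((Proper i, k) # w) =
     gl_unit (Proper i) (Proper k) * normal_aux m w - polarize (Proper i, Proper k) (normal_aux m) w"
  by (simp add: is_proper_def)

text \<open>Unfolding the recursion twice leaves the commutator of two units and that of two
  polarizations. Their values cancel against the terms in which the first polarization hits the
  second letter.\<close>

lemma normal_aux_swap:
  "normal_aux m ((Proper i, k) # (Proper j, l) # v) = normal_aux m ((Proper j, l) # (Proper i, k) # v)"
proof (cases m)
  case (Suc m1)
  show ?thesis
  proof (cases m1)
    case 0
    have "polarize u (normal_aux 0) (z # v) = polarize u (\<lambda>w. 0) (z # v)" for u z
      by (rule polarize_cong) auto
    then show ?thesis using 0 Suc by (simp add: is_proper_def)
  next
    case m2: (Suc m2)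
    define A where "A = normal_aux m2 v"
    define e where "e i k = (gl_unit (Proper i) (Proper k) :: ('a, 'b, 'c) env)" for i k
    define D where "D i k = polarize (Proper i, Proper k) (normal_aux m2 :: _ \<Rightarrow> ('a, 'b, 'c) env) v" for i k
    define DD where "DD i k j l = polarize (Proper i, Proper k) (\<lambda>w. polarize (Proper j, Proper l) (normal_aux m2 :: _ \<Rightarrow> ('a, 'b, 'c) env) w) v" for i k j l
    have expand: "normal_aux m ((Proper i, k) # (Proper j, l) # v) =
      e i k * (e j l * A - D j l) - ((if j = k then e i l * A - D i l else 0) + (e j l * D i k - DD i k j l))" for i j k l
    proof -
      have "polarize (Proper i, Proper k) (normal_aux m1) ((Proper j, l) # v) =
        (if j = k then normal_aux m1 ((Proper i, l) # v) else 0)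
          + polarize (Proper i, Proper k) (\<lambda>w. normal_aux m1 ((Proper j, l) # w)) v"
        by (simp add: polarize_Cons pass_sign_def)
      also have "polarize (Proper i, Proper k) (\<lambda>w. normal_aux m1 ((Proper j, l) # w)) v = e j l * D i k - DD i k j l"
        unfolding m2 normal_aux_Cons_Proper polarize_diff polarize_mult_left D_def DD_def e_def ..
      finally have pol: "polarize (Proper i, Proper k) (normal_aux m1) ((Proper j, l) # v) =
        (if j = k then normal_aux m1 ((Proper i, l) # v) else 0) + (e j l * D i k - DD i k j l)" .
      show ?thesis
        unfolding Suc normal_aux_Cons_Proper pol unfolding m2 normal_aux_Cons_Proper A_def D_def e_def ..
    qed
    have DD: "DD i k j l = DD j l i k + ((if l = i then D j k else 0) - (if j = k then D i l else 0))"
      using polarize_commutator[of "Proper i" "Proper k" "Proper j" "Proper l" "normal_aux m2" v]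
      by (auto simp: DD_def D_def super_sign_def odd_unit_def algebra_simps split: if_splits)
    have "e i k * e j l = e j l * e i k + ((if k = j then e i l else 0) - (if i = l then e j k else 0))"
      using gl_unit_commutator[of "Proper i" "Proper k" "Proper j" "Proper l"]
      by (auto simp: e_def super_sign_def odd_unit_def algebra_simps split: if_splits)
    then have ee: "e i k * (e j l * A) = e j l * (e i k * A) + ((if k = j then e i l * A else 0) - (if i = l then e j k * A else 0))"
      by (simp add: mult.assoc[symmetric] distrib_right left_diff_distrib)
    show ?thesis
      unfolding expand right_diff_distrib ee DD by (cases "j = k"; cases "i = l"; auto simp: algebra_simps)
  qed
qed simp

lemma supersym_normal_aux: "supersym (normal_aux m)"
proof (induction m)
  case 0
  show ?case by (simp add: supersym_def)
next
  case (Suc m)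
  show ?case unfolding supersym_def
  proof (intro allI)
    fix p :: "('a, 'b, 'c) vlist" and x y v
    show "normal_aux (Suc m) (p @ x # y # v) = swap_sign (fst x) (fst y) * normal_aux (Suc m) (p @ y # x # v)"
    proof (cases p)
      case Nil
      consider i k j l where "x = (Proper i, k)" "y = (Proper j, l)" | "is_virtual (fst x)" | "is_virtual (fst y)"
        by (cases "fst x"; cases "fst y"; cases x; cases y; force)
      then show ?thesis
      proof cases
        case 1
        then show ?thesis using normal_aux_swap[of "Suc m" i k j l v] Nil by (simp only: append_Nil) (simp add: swap_sign_def)
      next
        case 2
        then show ?thesis
          using normal_aux_virtual[of "fst x" "p @ x # y # v" "Suc m"] normal_aux_virtual[of "fst x" "p @ y # x # v" "Suc m"]
          by (simp del: normal_aux.simps)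
      next
        case 3
        then show ?thesis
          using normal_aux_virtual[of "fst y" "p @ x # y # v" "Suc m"] normal_aux_virtual[of "fst y" "p @ y # x # v" "Suc m"]
          by (simp del: normal_aux.simps)
      qed
    next
      case (Cons z p')
      show ?thesis
        using polarize_swap[OF Suc, of _ p' x y v] supersymD[OF Suc, of p' x y v]
        by (simp add: Cons) (simp add: swap_sign_def)
    qed
  qed
qed

lemma supersym_normal: "supersym normal"
  unfolding supersym_def
proof (intro allI)
  fix p :: "('a, 'b, 'c) vlist" and x y v
  show "normal (p @ x # y # v) = swap_sign (fst x) (fst y) * normal (p @ y # x # v)"
    using supersymD[OF supersym_normal_aux, of _ p x y v] by (simp add: normal_def del: normal_aux.simps)
qed

text \<open>For the generators this is the recursion defining \<open>normal\<close>. It passes to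
  products because the right action commutes with left multiplication by a constant
  (\<open>env_act_mult_right\<close>).\<close>

lemma env_act_normal:
  assumes "x \<in> U_gl"
  shows "env_act x normal = (\<lambda>w. x * normal w)"
  using assms
proof induction
  case (scalar c)
  show ?case by (rule ext) (simp add: env_act_scalar supersym_normal)
next
  case (unit i j)
  show ?case by (rule ext) (simp add: env_act_gl_unit supersym_normal gl_act_def normal_Cons)
next
  case (add x y)
  then show ?case by (intro ext) (simp add: env_act_add distrib_right)
next
  case (mult x y)
  then show ?case by (intro ext) (simp add: env_act_mult supersym_normal env_act_mult_right mult.assoc)
qed

lemma U_gl_Int_Irr: "x \<in> U_gl \<Longrightarrow> x \<in> Irr \<Longrightarrow> x = 0"
  using env_act_Irr[OF _ supersym_normal, of x] env_act_normal[of x] by simp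

section \<open>Uniqueness of the projection\<close>

lemma Irr_mult_left: "x \<in> Irr \<Longrightarrow> y * x \<in> Irr"
proof (induction rule: Irr.induct)
  case (gen w u)
  then show ?case using Irr.gen[of w "y * u"] by (simp add: mult.assoc)
qed (simp_all add: distrib_left Irr.intros)

lemma Irr_uminus: "x \<in> Irr \<Longrightarrow> - x \<in> Irr"
  using Irr_mult_left[of x "- 1"] by simp

lemma Irr_diff: "x \<in> Irr \<Longrightarrow> y \<in> Irr \<Longrightarrow> x - y \<in> Irr"
  using Irr.add[of x "- y"] Irr_uminus[of y] by simp

lemma U_gl_uminus: "x \<in> U_gl \<Longrightarrow> - x \<in> U_gl"
  using U_gl.mult[OF U_gl.scalar[of "- 1"], of x] by (simp add: scalar_uminus)

lemma U_gl_diff: "x \<in> U_gl \<Longrightarrow> y \<in> U_gl \<Longrightarrow> x - y \<in> U_gl"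
  using U_gl.add[of x "- y"] U_gl_uminus[of y] by simp

lemma U_gl_0: "0 \<in> U_gl"
  using U_gl.scalar[of 0] by simp

lemma U_gl_1: "1 \<in> U_gl"
  using U_gl.scalar[of 1] by simp

lemma virt_proj_eqI:
  assumes "y \<in> U_gl" "x - y \<in> Irr"
  shows "virt_proj x = y"
  unfolding virt_proj_def
proof (rule the_equality)
  fix y' assume y': "y' \<in> U_gl \<and> x - y' \<in> Irr"
  have "(x - y) - (x - y') \<in> Irr"
    by (rule Irr_diff[OF assms(2) conjunct2[OF y']])
  then have "y' - y \<in> Irr" by simp
  then have "y' - y = 0"
    using U_gl_Int_Irr U_gl_diff assms y' by blast
  then show "y' = y" by simp
qed (use assms in simp)

text \<open>The counterpart of \<open>polarize\<close> on the second index of the variables. It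
  leaves the symbols alone, hence carries no sign.\<close>

fun replace_col :: "'n \<Rightarrow> 'n \<Rightarrow> (('a \<times> 'n) list \<Rightarrow> 'r::ring_1) \<Rightarrow> ('a \<times> 'n) list \<Rightarrow> 'r" where
  "replace_col i j F [] = 0"
| "replace_col i j F (z # w) =
     (if snd z = i then F ((fst z, j) # w) else 0) + replace_col i j (\<lambda>w. F (z # w)) w"

text \<open>Serves both for equality and, in \<open>devirt_cong_normal\<close>, for congruence
  modulo \<open>Irr\<close>.\<close>

lemma replace_col_rel:
  assumes "R 0 0" "\<And>x y x' y'. R x y \<Longrightarrow> R x' y' \<Longrightarrow> R (x + x') (y + y')"
    and "\<And>w'. map fst w' = map fst w \<Longrightarrow> R (F w') (G w')"
  shows "R (replace_col i j F w) (replace_col i j G w)"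
  using assms(3)
proof (induction w arbitrary: F G)
  case (Cons z w)
  have "R (replace_col i j (\<lambda>w. F (z # w)) w) (replace_col i j (\<lambda>w. G (z # w)) w)"
    by (rule Cons.IH, rule Cons.prems) simp
  moreover have "R (F ((fst z, j) # w)) (G ((fst z, j) # w))"
    by (rule Cons.prems) simp
  ultimately show ?case using assms(1,2) by simp
qed (simp add: assms(1))

lemma replace_col_cong:
  "(\<And>w'. map fst w' = map fst w \<Longrightarrow> F w' = G w') \<Longrightarrow> replace_col i j F w = replace_col i j G w"
  by (rule replace_col_rel[where R = "(=)"]) auto

lemma replace_col_add: "replace_col i j (\<lambda>w. F w + G w) w = replace_col i j F w + replace_col i j G w"
  by (induction w arbitrary: F G) auto

lemma replace_col_mult_left: "replace_col i j (\<lambda>w. r * F w) w = r * replace_col i j F w"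
  by (induction w arbitrary: F) (auto simp: distrib_left)

lemma replace_col_zero [simp]: "replace_col i j (\<lambda>w. 0) w = 0"
  by (induction w) auto

lemma replace_col_diff: "replace_col i j (\<lambda>w. F w - G w) w = replace_col i j F w - replace_col i j G w"
  using replace_col_add[of i j "\<lambda>w. F w - G w" G w] by (simp add: algebra_simps)

lemma replace_col_map:
  "replace_col i j (\<lambda>w. F (map (map_prod f id) w)) w = replace_col i j F (map (map_prod f id) w)"
  by (induction w arbitrary: F) auto

text \<open>The two operators act on different indices of the variables.\<close>

lemma replace_col_polarize:
  "polarize u (\<lambda>w. replace_col i j F w) w = replace_col i j (\<lambda>w. polarize u F w) w"
proof (induction w arbitrary: F)
  case (Cons z w)
  show ?case
    by (simp add: polarize_Cons polarize_add Cons.IH replace_col_add replace_col_mult_left distrib_left)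
qed simp

lemma supersym_rotate:
  assumes "supersym F" "odd_symb (fst z)"
  shows "F (p @ w @ z # v) = F (p @ z # w @ v)"
proof (induction w arbitrary: p)
  case (Cons y w)
  have "F (p @ (y # w) @ z # v) = F (p @ y # z # w @ v)"
    using Cons.IH[of "p @ [y]"] by simp
  also have "\<dots> = F (p @ z # y # w @ v)"
    using supersymD[OF assms(1), of p y z "w @ v"] assms(2) by (simp add: swap_sign_def)
  finally show ?case by simp
qed simp

lemma supersym_mset:
  assumes "supersym F" "mset u = mset v" "\<forall>z\<in>set u. odd_symb (fst z)"
  shows "F (p @ u) = F (p @ v)"
  using assms(2,3)
proof (induction u arbitrary: p v)
  case (Cons z u)
  have "z \<in> set v" using Cons.prems(1) by (metis list.set_intros(1) mset_eq_setD)
  then obtain v1 v2 where v: "v = v1 @ z # v2" by (auto dest: split_list)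
  have "F (p @ z # u) = F ((p @ [z]) @ v1 @ v2)"
    using Cons.IH[of "v1 @ v2" "p @ [z]"] Cons.prems v by simp
  also have "\<dots> = F (p @ v)"
    using supersym_rotate[OF assms(1), of z p v1 v2] Cons.prems(2) v by simp
  finally show ?case .
qed simp

lemma normal_mset:
  assumes "mset u = mset v" "\<forall>z\<in>set u. odd_symb (fst z)"
  shows "normal u = normal v"
  using supersym_mset[OF supersym_normal assms, of "[]"] by simp

lemma polarize_snoc:
  assumes "\<not> odd_unit u"
  shows "polarize u F (w @ [z]) = polarize u (\<lambda>w. F (w @ [z])) w + (if fst z = snd u then F (w @ [(fst u, snd z)]) else 0)"
  using assms by (induction w arbitrary: F) (simp_all add: polarize_Cons pass_sign_def)

text \<open>Normal ordering unfolded from the right end. The contractions on the two sides commute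
  by \<open>replace_col_polarize\<close>; the one extra term on either side contracts the first
  factor with the last, and these two terms agree.\<close>

lemma normal_snoc:
  "normal (w @ [(Proper i, j)]) = normal w * gl_unit (Proper i) (Proper j) - replace_col i j normal w"
proof (induction "length w" arbitrary: w i j)
  case 0
  then show ?case by (simp add: normal_Cons)
next
  case (Suc n)
  then obtain z w' where w: "w = z # w'" "length w' = n" by (cases w) auto
  show ?case
  proof (cases "is_virtual (fst z)")
    case True
    then have "normal (z # w'') = 0" "normal ((fst z, k) # w'') = 0" for w'' k
      using normal_virtual[of "fst z" "z # w''"] normal_virtual[of "fst z" "(fst z, k) # w''"] by simp_all
    then show ?thesis by (simp add: w)
  next
    case False
    then obtain k l where z: "z = (Proper k, l)" by (cases z; cases "fst z") auto
    define e where "e i j = (gl_unit (Proper i) (Proper j) :: ('a, 'b, 'c) env)" for i j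
    let ?P = "polarize (Proper k, Proper l)"
    have even: "\<not> odd_unit (Proper k, Proper l)" by (simp add: odd_unit_def)
    have "?P normal (w' @ [(Proper i, j)]) =
      ?P (\<lambda>w. normal (w @ [(Proper i, j)])) w' + (if i = l then normal (w' @ [(Proper k, j)]) else 0)"
      by (simp add: polarize_snoc[OF even])
    also have "?P (\<lambda>w. normal (w @ [(Proper i, j)])) w' = ?P (\<lambda>w. normal w * e i j - replace_col i j normal w) w'"
      by (rule polarize_cong) (simp add: Suc.hyps(1) w(2) e_def)
    also have "\<dots> = ?P normal w' * e i j - replace_col i j (\<lambda>w. ?P normal w) w'"
      by (simp only: polarize_diff polarize_mult_right replace_col_polarize)
    also have "normal (w' @ [(Proper k, j)]) = normal ((Proper k, j) # w')"
      using supersym_rotate[OF supersym_normal, of "(Proper k, j)" "[]" w' "[]"] by simp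
    finally have pol: "?P normal (w' @ [(Proper i, j)]) = ?P normal w' * e i j - replace_col i j (\<lambda>w. ?P normal w) w'
      + (if i = l then normal ((Proper k, j) # w') else 0)" .
    have rep: "replace_col i j (\<lambda>w. normal ((Proper k, l) # w)) w' = e k l * replace_col i j normal w' - replace_col i j (\<lambda>w. ?P normal w) w'"
      unfolding normal_Cons replace_col_diff replace_col_mult_left e_def ..
    have "normal (w @ [(Proper i, j)]) = e k l * normal (w' @ [(Proper i, j)]) - ?P normal (w' @ [(Proper i, j)])"
      by (simp add: w z normal_Cons e_def)
    also have "normal (w' @ [(Proper i, j)]) = normal w' * e i j - replace_col i j normal w'"
      using Suc.hyps(1)[of w'] w(2) by (simp add: e_def)
    finally have s1: "normal (w @ [(Proper i, j)]) = e k l * (normal w' * e i j - replace_col i j normal w') - ?P normal (w' @ [(Proper i, j)])" .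
    have s2: "normal w * e i j - replace_col i j normal w
      = (e k l * normal w' - ?P normal w') * e i j - ((if l = i then normal ((Proper k, j) # w') else 0)
          + (e k l * replace_col i j normal w' - replace_col i j (\<lambda>w. ?P normal w) w'))"
      unfolding rep[symmetric] by (simp add: w z normal_Cons[of k l] e_def)
    show ?thesis
      unfolding e_def[symmetric] s1 s2 pol by (auto simp: algebra_simps)
  qed
qed

section \<open>Closure properties of \<open>U_gl\<close> and \<open>Irr\<close>\<close>

lemma U_gl_polarize:
  assumes "\<And>w'. map snd w' = map snd w \<Longrightarrow> F w' \<in> U_gl"
  shows "polarize u F w \<in> U_gl"
  using assms
proof (induction w arbitrary: F)
  case (Cons z w)
  have "polarize u (\<lambda>w. F (z # w)) w \<in> U_gl"
    by (rule Cons.IH, rule Cons.prems) simp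
  moreover have "F ((fst u, snd z) # w) \<in> U_gl"
    by (rule Cons.prems) simp
  ultimately show ?case
    by (auto simp: polarize_Cons pass_sign_def U_gl_0 U_gl.add U_gl_uminus U_gl_diff)
qed (simp add: U_gl_0)

lemma normal_in_U_gl: "normal w \<in> U_gl"
proof (induction "length w" arbitrary: w)
  case 0
  then show ?case by (simp add: U_gl_1)
next
  case (Suc n)
  then obtain z w' where w: "w = z # w'" "length w' = n" by (cases w) auto
  show ?case
  proof (cases "is_virtual (fst z)")
    case True
    then show ?thesis
      using normal_virtual[of "fst z" w] w U_gl_0 by simp
  next
    case False
    then obtain k l where z: "z = (Proper k, l)" by (cases z; cases "fst z") auto
    have "polarize (Proper k, Proper l) normal w' \<in> U_gl"
    proof (rule U_gl_polarize)
      fix w'' :: "('a, 'b, 'c) vlist"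
      assume "map snd w'' = map snd w'"
      then show "normal w'' \<in> U_gl"
        using Suc.hyps(1)[of w''] w(2) by (metis length_map)
    qed
    then show ?thesis
      using Suc.hyps(1)[of w'] w by (simp add: z normal_Cons U_gl_diff U_gl.mult U_gl.unit)
  qed
qed

text \<open>A proper unit on the right shifts the position that witnesses irregularity by one and
  changes no count of a virtual symbol.\<close>

lemma Irr_mult_Proper:
  assumes "x \<in> Irr"
  shows "x * gl_unit (Proper i) (Proper j) \<in> Irr"
  using assms
proof induction
  case (gen w u)
  then obtain m \<gamma> where m: "m \<in> {1..length w}" "is_virtual \<gamma>"
    "count_list (map snd (take m (rev w))) \<gamma> > count_list (map fst (take (m - 1) (rev w))) \<gamma>"
    unfolding irregular_def by blast
  have "irregular (w @ [(Proper i, Proper j)])"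
    unfolding irregular_def
  proof (intro bexI[of _ "Suc m"] exI[of _ \<gamma>] conjI)
    have "take (Suc m - 1) (rev (w @ [(Proper i, Proper j)])) = (Proper i, Proper j) # take (m - 1) (rev w)"
      using m(1) by (cases m) auto
    then show "count_list (map fst (take (Suc m - 1) (rev (w @ [(Proper i, Proper j)])))) \<gamma>
      < count_list (map snd (take (Suc m) (rev (w @ [(Proper i, Proper j)])))) \<gamma>"
      using m by auto
  qed (use m in auto)
  then have "u * unit_prod (w @ [(Proper i, Proper j)]) \<in> Irr"
    by (rule Irr.gen)
  then show ?case by (simp add: unit_prod_def mult.assoc)
qed (simp_all add: distrib_right Irr.intros)

lemma gl_unit_virtual_in_Irr: "is_virtual \<gamma> \<Longrightarrow> x * gl_unit a \<gamma> \<in> Irr"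
proof -
  assume "is_virtual \<gamma>"
  then have "irregular [(a, \<gamma>)]"
    unfolding irregular_def by (intro bexI[of _ 1] exI[of _ \<gamma>]) auto
  from Irr.gen[OF this, of x] show ?thesis by (simp add: unit_prod_def)
qed

section \<open>Column Capelli bitableaux\<close>

text \<open>Both halves of a bitableau share one list, with entries arranged so that
  \<open>replace_col\<close>, which alters the last component, leaves the left half
  unchanged.\<close>

definition devirt_left :: "(('n \<times> 'p) \<times> 'n) list \<Rightarrow> ('p, 'q, 'n) env" where
  "devirt_left l = prod_list (map (\<lambda>((i, a), j). gl_unit (Proper i) (Alpha a)) l)"

definition devirt_right :: "(('n \<times> 'p) \<times> 'n) list \<Rightarrow> ('p, 'q, 'n) env" where
  "devirt_right l = prod_list (map (\<lambda>((i, a), j). gl_unit (Alpha a) (Proper j)) l)"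

lemma devirt_right_Cons: "devirt_right (((i, a), j) # l) = gl_unit (Alpha a) (Proper j) * devirt_right l"
  by (simp add: devirt_right_def)

section \<open>Moving virtual units to the right\<close>

lemma gl_unit_odd_swap:
  "gl_unit (Alpha b) (Proper k) * gl_unit (Alpha a) (Proper j) = - (gl_unit (Alpha a) (Proper j) * gl_unit (Alpha b) (Proper k))"
  using gl_unit_commutator[of "Alpha b" "Proper k" "Alpha a" "Proper j"]
  by (simp add: super_sign_def odd_unit_def eq_neg_iff_add_eq_0)

lemma gl_unit_even_commute:
  "g \<noteq> b \<Longrightarrow> gl_unit (Alpha a) (Alpha g) * gl_unit (Alpha b) (Proper k) = gl_unit (Alpha b) (Proper k) * gl_unit (Alpha a) (Alpha g)"
  using gl_unit_commutator[of "Alpha a" "Alpha g" "Alpha b" "Proper k"]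
  by (simp add: super_sign_def odd_unit_def)

lemma gl_unit_even_collapse:
  "gl_unit (Alpha a) (Alpha g) * gl_unit (Alpha g) (Proper j)
      = gl_unit (Alpha g) (Proper j) * gl_unit (Alpha a) (Alpha g) + gl_unit (Alpha a) (Proper j)"
  using gl_unit_commutator[of "Alpha a" "Alpha g" "Alpha g" "Proper j"]
  by (simp add: super_sign_def odd_unit_def algebra_simps)

lemma gl_unit_odd_collapse:
  "gl_unit (Proper i) (Alpha g) * gl_unit (Alpha a) (Proper k) =
     (if k = i then gl_unit (Alpha a) (Alpha g) else 0) + (if a = g then gl_unit (Proper i) (Proper k) else 0)
      - gl_unit (Alpha a) (Proper k) * gl_unit (Proper i) (Alpha g)"
  using gl_unit_commutator[of "Proper i" "Alpha g" "Alpha a" "Proper k"]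
  by (auto simp: super_sign_def odd_unit_def algebra_simps split: if_splits)

lemma sign_commute: "(- 1) ^ m * x = x * (- 1) ^ m" for x :: "'r::ring_1"
  by (cases "even m") auto

lemma devirt_right_anticommute:
  "(devirt_right l * gl_unit (Alpha a) (Proper j) :: ('p, 'q, 'n) env) = (- 1) ^ length l * (gl_unit (Alpha a) (Proper j) * devirt_right l)"
proof (induction l)
  case (Cons z l)
  obtain i b k where z: "z = ((i, b), k)" by (cases z; cases "fst z") auto
  let ?R = "devirt_right :: (('n \<times> 'p) \<times> 'n) list \<Rightarrow> ('p, 'q, 'n) env"
  let ?e = "gl_unit (Alpha b) (Proper k)" and ?f = "gl_unit (Alpha a) (Proper j)"
  have "?R (z # l) * ?f = ?e * (?R l * ?f)"
    by (simp add: z devirt_right_Cons mult.assoc)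
  also have "\<dots> = (- 1) ^ length l * (?e * ?f) * ?R l"
    unfolding Cons by (cases "even (length l)") (simp_all add: mult.assoc)
  also have "\<dots> = (- 1) ^ length (z # l) * (?f * ?R (z # l))"
    unfolding gl_unit_odd_swap[of b k a j] by (simp add: z devirt_right_Cons mult.assoc)
  finally show ?case .
qed (simp add: devirt_right_def)

lemma devirt_even:
  assumes "g \<notin> snd ` fst ` set l"
  shows "(gl_unit (Alpha a) (Alpha g) * devirt_right l :: ('p, 'q, 'n) env) = devirt_right l * gl_unit (Alpha a) (Alpha g)"
  using assms
proof (induction l)
  case (Cons z l)
  obtain i b k where z: "z = ((i, b), k)" by (cases z; cases "fst z") auto
  let ?R = "devirt_right :: (('n \<times> 'p) \<times> 'n) list \<Rightarrow> ('p, 'q, 'n) env"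
  have "g \<noteq> b" using Cons.prems by (auto simp: z)
  then have "gl_unit (Alpha a) (Alpha g) * ?R (z # l) = gl_unit (Alpha b) (Proper k) * (gl_unit (Alpha a) (Alpha g) * ?R l)"
    unfolding z devirt_right_Cons by (simp add: mult.assoc[symmetric] gl_unit_even_commute)
  also have "\<dots> = ?R (z # l) * gl_unit (Alpha a) (Alpha g)"
    using Cons by (simp add: z devirt_right_Cons mult.assoc)
  finally show ?case .
qed (simp add: devirt_right_def)

definition irr_cong :: "('p, 'q, 'n) env \<Rightarrow> ('p, 'q, 'n) env \<Rightarrow> bool" where
  "irr_cong x y \<longleftrightarrow> x - y \<in> Irr"

lemma irr_cong_refl [simp]: "irr_cong x x"
  by (simp add: irr_cong_def Irr.zero)

lemma irr_cong_trans [trans]: "irr_cong x y \<Longrightarrow> irr_cong y z \<Longrightarrow> irr_cong x z"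
  using Irr.add[of "x - y" "y - z"] by (simp add: irr_cong_def)

lemma irr_cong_add: "irr_cong x y \<Longrightarrow> irr_cong x' y' \<Longrightarrow> irr_cong (x + x') (y + y')"
  using Irr.add[of "x - y" "x' - y'"] by (simp add: irr_cong_def algebra_simps)

lemma irr_cong_mult_left: "irr_cong x y \<Longrightarrow> irr_cong (z * x) (z * y)"
  using Irr_mult_left[of "x - y" z] by (simp add: irr_cong_def algebra_simps)

lemma irr_cong_diff: "irr_cong x y \<Longrightarrow> irr_cong x' y' \<Longrightarrow> irr_cong (x - x') (y - y')"
  using irr_cong_add[of x y "- x'" "- y'"] irr_cong_mult_left[of x' y' "- 1"] by simp

lemma irr_cong_mult_Proper: "irr_cong x y \<Longrightarrow> irr_cong (x * gl_unit (Proper i) (Proper j)) (y * gl_unit (Proper i) (Proper j))"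
  using Irr_mult_Proper[of "x - y" i j] by (simp add: irr_cong_def algebra_simps)

text \<open>The even unit commutes with all letters free of \<open>g\<close> and turns the
  \<open>g\<close> of the last one into \<open>a\<close>. The other summand ends in a unit with
  second symbol \<open>g\<close>, hence lies in \<open>Irr\<close>.\<close>

lemma devirt_even_cong:
  assumes "g \<notin> snd ` fst ` set l"
  shows "irr_cong (gl_unit (Alpha a) (Alpha g) * devirt_right l * gl_unit (Alpha g) (Proper j) :: ('p, 'q, 'n) env)
    ((- 1) ^ length l * (gl_unit (Alpha a) (Proper j) * devirt_right l))"
proof -
  let ?R = "devirt_right :: (('n \<times> 'p) \<times> 'n) list \<Rightarrow> ('p, 'q, 'n) env"
  have "gl_unit (Alpha a) (Alpha g) * ?R l * gl_unit (Alpha g) (Proper j) =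
    ?R l * gl_unit (Alpha g) (Proper j) * gl_unit (Alpha a) (Alpha g) + ?R l * gl_unit (Alpha a) (Proper j)"
    by (simp add: devirt_even[OF assms] mult.assoc gl_unit_even_collapse distrib_left)
  then show ?thesis
    using gl_unit_virtual_in_Irr[of "Alpha g" "?R l * gl_unit (Alpha g) (Proper j)" "Alpha a"]
    by (simp add: irr_cong_def devirt_right_anticommute)
qed

text \<open>On its way to the right the odd unit contracts with every letter whose second symbol is
  \<open>Proper i\<close>; \<open>devirt_even_cong\<close> turns such a contraction into a change of
  column from \<open>i\<close> to \<open>j\<close>. Contraction with the last letter yields the
  proper unit, and what is left over ends in a virtual second symbol.\<close>

lemma devirt_step:
  assumes "g \<notin> snd ` fst ` set l"
  shows "irr_cong (gl_unit (Proper i) (Alpha g) * devirt_right l * gl_unit (Alpha g) (Proper j) :: ('p, 'q, 'n) env)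
    ((- 1) ^ length l * (devirt_right l * gl_unit (Proper i) (Proper j) - replace_col i j devirt_right l))"
  using assms
proof (induction l)
  case Nil
  have "(if j = i then gl_unit (Alpha g) (Alpha g) else 0) - gl_unit (Alpha g) (Proper j) * gl_unit (Proper i) (Alpha g) \<in> (Irr :: ('p, 'q, 'n) env set)"
    using gl_unit_virtual_in_Irr[of "Alpha g" 1 "Alpha g"]
    by (intro Irr_diff gl_unit_virtual_in_Irr) (auto intro: Irr.zero)
  then show ?case
    by (simp add: devirt_right_def irr_cong_def gl_unit_odd_collapse)
next
  case (Cons z l)
  obtain i' a k where z: "z = ((i', a), k)" by (cases z; cases "fst z") auto
  let ?R = "devirt_right :: (('n \<times> 'p) \<times> 'n) list \<Rightarrow> ('p, 'q, 'n) env"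
  let ?e = "gl_unit (Alpha a) (Proper k)"
  let ?E = "gl_unit (Proper i) (Proper j)"
  have "a \<noteq> g" using Cons.prems by (auto simp: z)
  then have "gl_unit (Proper i) (Alpha g) * ?R (z # l) * gl_unit (Alpha g) (Proper j) =
    (if k = i then gl_unit (Alpha a) (Alpha g) * ?R l * gl_unit (Alpha g) (Proper j) else 0)
    - ?e * (gl_unit (Proper i) (Alpha g) * ?R l * gl_unit (Alpha g) (Proper j))" (is "?L = ?M - _")
    by (simp add: z devirt_right_Cons mult.assoc[symmetric] gl_unit_odd_collapse left_diff_distrib)
  also have "irr_cong \<dots> ((if k = i then (- 1) ^ length l * (gl_unit (Alpha a) (Proper j) * ?R l) else 0)
    - ?e * ((- 1) ^ length l * (?R l * ?E - replace_col i j ?R l)))"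
    using Cons devirt_even_cong[of g l a j] by (intro irr_cong_diff irr_cong_mult_left) auto
  also have "(if k = i then (- 1) ^ length l * (gl_unit (Alpha a) (Proper j) * ?R l) else 0)
    - ?e * ((- 1) ^ length l * (?R l * ?E - replace_col i j ?R l))
    = (- 1) ^ length (z # l) * (?R (z # l) * ?E - replace_col i j ?R (z # l))"
    by (cases "even (length l)") (auto simp: z devirt_right_Cons replace_col_mult_left algebra_simps)
  finally show ?case .
qed

lemma devirt_left_eq: "devirt_left l = prod_list (map (\<lambda>(i, a). gl_unit (Proper i) (Alpha a)) (map fst l))"
  by (simp add: devirt_left_def comp_def split_def)

lemma devirt_left_cong: "map fst l = map fst l' \<Longrightarrow> devirt_left l = devirt_left l'"
  by (simp only: devirt_left_eq)

lemma choose_2_Suc: "Suc n choose 2 = n + (n choose 2)"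
  by (simp add: numeral_2_eq_2)

text \<open>\<open>devirt_step\<close> and \<open>normal_snoc\<close> are the same recursion up to
  the sign of passing the \<open>n\<close> odd letters of the right half; these signs accumulate to
  the binomial coefficient.\<close>

lemma devirt_cong_normal:
  assumes "distinct (map (snd \<circ> fst) l)"
  shows "irr_cong (devirt_left l * devirt_right l)
    ((- 1) ^ (length l choose 2) * normal (map (map_prod (Proper \<circ> fst) id) l) :: ('p, 'q, 'n) env)"
  using assms
proof (induction "length l" arbitrary: l)
  case 0
  then show ?case by (simp add: devirt_left_def devirt_right_def binomial_eq_0)
next
  case (Suc n)
  then obtain l' z where l: "l = l' @ [z]" "length l' = n" by (metis length_Suc_conv_rev)
  obtain i g j where z: "z = ((i, g), j)" by (cases z; cases "fst z") auto
  have g: "g \<notin> snd ` fst ` set l'" and dist: "distinct (map (snd \<circ> fst) l')"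
    using Suc.prems by (simp_all add: l z image_comp)
  let ?R = "devirt_right :: (('n \<times> 'p) \<times> 'n) list \<Rightarrow> ('p, 'q, 'n) env"
  let ?L = "devirt_left :: (('n \<times> 'p) \<times> 'n) list \<Rightarrow> ('p, 'q, 'n) env"
  let ?E = "gl_unit (Proper i) (Proper j)"
  let ?N = "\<lambda>l :: (('n \<times> 'p) \<times> 'n) list. normal (map (map_prod (Proper \<circ> fst) id) l) :: ('p, 'q, 'n) env"
  let ?s = "(- 1) ^ (n choose 2) :: ('p, 'q, 'n) env"
  \<comment> \<open>The induction hypothesis is also applied to lists whose last components have
    been altered by \<open>replace_col\<close>, hence for every list with the same first
    components.\<close>
  have IH: "irr_cong (?L l'' * ?R l'') (?s * ?N l'')" if "map fst l'' = map fst l'" for l''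
  proof -
    have "map (snd \<circ> fst) l'' = map (snd \<circ> fst) l'" using that by (metis map_map)
    then show ?thesis
      using Suc.hyps(1)[of l''] l(2) dist map_eq_imp_length_eq[OF that] by simp
  qed
  have "?L l * ?R l = ?L l' * (gl_unit (Proper i) (Alpha g) * ?R l' * gl_unit (Alpha g) (Proper j))"
    by (simp add: l z devirt_left_def devirt_right_def mult.assoc)
  also have "irr_cong \<dots> (?L l' * ((- 1) ^ length l' * (?R l' * ?E - replace_col i j ?R l')))"
    by (intro irr_cong_mult_left devirt_step g)
  also have "?L l' * ((- 1) ^ length l' * (?R l' * ?E - replace_col i j ?R l'))
    = (- 1) ^ n * (?L l' * ?R l' * ?E - ?L l' * replace_col i j ?R l')"
    unfolding l(2) mult.assoc[symmetric] sign_commute[of n "?L l'", symmetric] by (simp add: mult.assoc right_diff_distrib)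
  also have "?L l' * replace_col i j ?R l' = replace_col i j (\<lambda>l. ?L l * ?R l) l'"
    unfolding replace_col_mult_left[symmetric] by (rule replace_col_cong) (metis devirt_left_cong)
  also have "irr_cong ((- 1) ^ n * (?L l' * ?R l' * ?E - replace_col i j (\<lambda>l. ?L l * ?R l) l'))
     ((- 1) ^ n * (?s * ?N l' * ?E - replace_col i j (\<lambda>l. ?s * ?N l) l'))"
    by (intro irr_cong_mult_left irr_cong_diff irr_cong_mult_Proper IH replace_col_rel[where R = irr_cong] irr_cong_add) simp_all
  also have "(- 1) ^ n * (?s * ?N l' * ?E - replace_col i j (\<lambda>l. ?s * ?N l) l') =
    (- 1) ^ (length l choose 2) * ?N l"
    unfolding replace_col_mult_left replace_col_map
    by (simp add: l z normal_snoc choose_2_Suc power_add mult.assoc right_diff_distrib)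
  finally show ?case .
qed

lemma column_capelli_eq_normal:
  fixes \<alpha> :: "nat \<Rightarrow> 'p"
  assumes "inj_on \<alpha> {1..h}"
  shows "(column_capelli \<alpha> h i j :: ('p, 'q, 'n) env) =
    (- 1) ^ (h choose 2) * normal (map (\<lambda>s. (Proper (i s), j s)) [1..<Suc h])"
proof -
  define l where "l = map (\<lambda>s. ((i s, \<alpha> s), j s)) [1..<Suc h]"
  have "distinct (map \<alpha> [1..<Suc h])"
    using assms by (simp add: distinct_map atLeastLessThanSuc_atLeastAtMost del: upt_Suc)
  then have "distinct (map (snd \<circ> fst) l)"
    by (simp add: l_def comp_def del: upt_Suc)
  from devirt_cong_normal[OF this]
  have cong: "irr_cong (devirt_left l * devirt_right l) ((- 1) ^ (h choose 2) * normal (map (\<lambda>s. (Proper (i s), j s)) [1..<Suc h]) :: ('p, 'q, 'n) env)"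
    by (simp add: l_def comp_def del: upt_Suc)
  have "(- 1 :: ('p, 'q, 'n) env) ^ m \<in> U_gl" for m
    by (cases "even m") (simp_all add: U_gl_1 U_gl_uminus)
  then show ?thesis
    unfolding column_capelli_def
    by (intro virt_proj_eqI U_gl.mult normal_in_U_gl)
      (use cong in \<open>simp_all add: irr_cong_def l_def devirt_left_def devirt_right_def comp_def del: upt_Suc\<close>)
qed

section \<open>The trace of a quantum immanant\<close>

lemma replace_col_eq_sum:
  "replace_col i j F w = (\<Sum>s<length w. if snd (w ! s) = i then F (w[s := (fst (w ! s), j)]) else 0)"
  by (induction w arbitrary: F) (simp_all add: sum.lessThan_Suc_shift del: sum.lessThan_Suc cong: if_cong)

definition normal_seq :: "nat \<Rightarrow> (nat \<Rightarrow> 'n) \<Rightarrow> (nat \<Rightarrow> 'n) \<Rightarrow> ('p, 'q, 'n) env" where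
  "normal_seq h I J = normal (map (\<lambda>s. (Proper (I s), J s)) [1..<Suc h])"

lemma normal_seq_0 [simp]: "normal_seq 0 I J = 1"
  by (simp add: normal_seq_def)

lemma normal_seq_cong:
  assumes "\<And>s. s \<in> {1..h} \<Longrightarrow> I s = I' s" "\<And>s. s \<in> {1..h} \<Longrightarrow> J s = J' s"
  shows "normal_seq h I J = normal_seq h I' J'"
  unfolding normal_seq_def
  by (intro arg_cong[where f = normal] map_cong refl) (use assms in auto)

lemma normal_seq_permute:
  assumes "\<tau> permutes {1..h}"
  shows "normal_seq h (I \<circ> \<tau>) (J \<circ> \<tau>) = normal_seq h I J"
  unfolding normal_seq_def
proof (rule normal_mset)
  let ?f = "\<lambda>s. (Proper (I s), J s)"
  have "mset (map (\<lambda>s. (Proper ((I \<circ> \<tau>) s), (J \<circ> \<tau>) s)) [1..<Suc h]) = image_mset (?f \<circ> \<tau>) (mset_set {1..h})"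
    by (simp only: mset_map mset_upt atLeastLessThanSuc_atLeastAtMost comp_def)
  also have "\<dots> = image_mset ?f (image_mset \<tau> (mset_set {1..h}))"
    by (simp add: multiset.map_comp)
  also have "image_mset \<tau> (mset_set {1..h}) = mset_set {1..h}"
    using assms by (simp add: image_mset_mset_set permutes_inj_on permutes_image)
  finally show "mset (map (\<lambda>s. (Proper ((I \<circ> \<tau>) s), (J \<circ> \<tau>) s)) [1..<Suc h]) = mset (map ?f [1..<Suc h])"
    by (simp only: mset_map mset_upt atLeastLessThanSuc_atLeastAtMost)
qed auto

text \<open>Expressing each contraction as a transposition of positions in \<open>J\<close> brings
  out the Jucys--Murphy element.\<close>

lemma normal_seq_Suc:
  "(normal_seq (Suc k) I J :: ('p, 'q, 'n) env) = normal_seq k I J * gl_unit (Proper (I (Suc k))) (Proper (J (Suc k)))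
     - (\<Sum>s\<in>{1..<Suc k}. if J s = I (Suc k) then normal_seq k I (J \<circ> swap s (Suc k)) else 0)"
proof -
  let ?w = "map (\<lambda>s. (Proper (I s) :: ('p, 'q, 'n) symb, J s)) [1..<Suc k]"
  have "normal_seq (Suc k) I J = (normal (?w @ [(Proper (I (Suc k)), J (Suc k))]) :: ('p, 'q, 'n) env)"
    by (simp add: normal_seq_def)
  also have "\<dots> = normal ?w * gl_unit (Proper (I (Suc k))) (Proper (J (Suc k))) - replace_col (I (Suc k)) (J (Suc k)) normal ?w"
    by (rule normal_snoc)
  also have "replace_col (I (Suc k)) (J (Suc k)) normal ?w =
    (\<Sum>s<k. if J (Suc s) = I (Suc k) then normal_seq k I (J \<circ> swap (Suc s) (Suc k)) else 0)"
    unfolding replace_col_eq_sum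
  proof (rule sum.cong)
    fix s assume s: "s \<in> {..<k}"
    have nth: "?w ! s = (Proper (I (Suc s)), J (Suc s))"
      using s by (simp del: upt_Suc)
    \<comment> \<open>Position \<open>Suc k\<close> lies beyond the first \<open>k\<close> entries,
      so within them the transposition merely overwrites one entry by
      \<open>J (Suc k)\<close>.\<close>
    have upd: "?w[s := (fst (?w ! s), J (Suc k))] = map (\<lambda>t. (Proper (I t), (J \<circ> swap (Suc s) (Suc k)) t)) [1..<Suc k]"
      using s by (intro nth_equalityI) (auto simp: nth_list_update Transposition.transpose_def simp del: upt_Suc)
    show "(if snd (?w ! s) = I (Suc k) then normal (?w[s := (fst (?w ! s), J (Suc k))]) else 0) =
        (if J (Suc s) = I (Suc k) then normal_seq k I (J \<circ> swap (Suc s) (Suc k)) else 0)"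
      by (simp only: upd[unfolded nth fst_conv] nth fst_conv snd_conv normal_seq_def)
  qed simp
  also have "\<dots> = (\<Sum>s\<in>{1..<Suc k}. if J s = I (Suc k) then normal_seq k I (J \<circ> swap s (Suc k)) else 0)"
    by (rule sum.reindex_bij_witness[of _ "\<lambda>s. s - 1" Suc]) auto
  finally show ?thesis by (simp only: normal_seq_def)
qed

text \<open>Interpolates between an entry of the shifted tensor product at \<open>k = 0\<close> and
  an entry of the normally ordered matrix at \<open>k = h\<close>.\<close>

definition mixed_seq :: "nat \<Rightarrow> (nat \<Rightarrow> complex) \<Rightarrow> nat \<Rightarrow> (nat \<Rightarrow> 'n) \<Rightarrow> (nat \<Rightarrow> 'n) \<Rightarrow> ('p, 'q, 'n) env" where
  "mixed_seq h c k I J = normal_seq k I J * prod_list (map (\<lambda>s. shifted_E (c s) (I s) (J s)) [Suc k..<Suc h])"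

text \<open>
  The fusion step: \<open>E - X\<^sub>k\<close>, with \<open>X\<^sub>k\<close> the Jucys--Murphy element, becomes \<open>E - c\<^sub>k\<close> in front of an
  eigenvector of \<open>X\<^sub>k\<close>.
\<close>

lemma mixed_seq_step:
  assumes "k < h"
    and jm: "\<And>\<tau>. \<tau> permutes {1..h} \<Longrightarrow> (\<Sum>r\<in>{1..<Suc k}. \<psi> (swap r (Suc k) \<circ> \<tau>)) = c (Suc k) * \<psi> \<tau>"
  shows "(\<Sum>\<tau> | \<tau> permutes {1..h}. scalar (\<psi> \<tau>) * mixed_seq h c (Suc k) I (K \<circ> inv \<tau>)) =
         (\<Sum>\<tau> | \<tau> permutes {1..h}. scalar (\<psi> \<tau>) * (mixed_seq h c k I (K \<circ> inv \<tau>) :: ('p, 'q, 'n) env))"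
proof -
  let ?S = "{\<tau>. \<tau> permutes {1..h}}"
  define T :: "(nat \<Rightarrow> 'n) \<Rightarrow> ('p, 'q, 'n) env"
    where "T J = prod_list (map (\<lambda>s. shifted_E (c s) (I s) (J s)) [Suc (Suc k)..<Suc h])" for J
  define X :: "(nat \<Rightarrow> 'n) \<Rightarrow> ('p, 'q, 'n) env"
    where "X J = (if J (Suc k) = I (Suc k) then normal_seq k I J * T J else 0)" for J
  have T_cong: "T (J \<circ> swap r (Suc k)) = T J" if "r \<in> {1..<Suc k}" for J r
    unfolding T_def
    by (intro arg_cong[where f = prod_list] map_cong refl)
      (use that in \<open>auto simp: Transposition.transpose_def\<close>)
  have S: "mixed_seq h c (Suc k) I J = normal_seq k I J * gl_unit (Proper (I (Suc k))) (Proper (J (Suc k))) * T J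
      - (\<Sum>r\<in>{1..<Suc k}. X (J \<circ> swap r (Suc k)))" for J
  proof -
    have "(\<Sum>s\<in>{1..<Suc k}. if J s = I (Suc k) then normal_seq k I (J \<circ> swap s (Suc k)) else 0) * T J
       = (\<Sum>r\<in>{1..<Suc k}. X (J \<circ> swap r (Suc k)))"
      unfolding sum_distrib_right X_def by (intro sum.cong refl) (simp add: T_cong)
    then show ?thesis
      unfolding mixed_seq_def normal_seq_Suc T_def[symmetric] left_diff_distrib by simp
  qed
  have M: "mixed_seq h c k I J = normal_seq k I J * gl_unit (Proper (I (Suc k))) (Proper (J (Suc k))) * T J - scalar (c (Suc k)) * X J" for J
  proof -
    have "[Suc k..<Suc h] = Suc k # [Suc (Suc k)..<Suc h]"
      using assms(1) by (simp add: upt_conv_Cons del: upt_Suc)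
    then have "mixed_seq h c k I J = normal_seq k I J * (shifted_E (c (Suc k)) (I (Suc k)) (J (Suc k)) * T J)"
      by (simp add: mixed_seq_def T_def del: upt_Suc)
    moreover have "normal_seq k I J * (scalar (c (Suc k)) * T J) = scalar (c (Suc k)) * (normal_seq k I J * T J)"
      by (simp add: mult.assoc[symmetric] scalar_commute)
    ultimately show ?thesis
      by (auto simp: shifted_E_def X_def left_diff_distrib right_diff_distrib mult.assoc)
  qed
  have "(\<Sum>\<tau>\<in>?S. scalar (\<psi> \<tau>) * (\<Sum>r\<in>{1..<Suc k}. X (K \<circ> inv \<tau> \<circ> swap r (Suc k))))
    = (\<Sum>r\<in>{1..<Suc k}. \<Sum>\<tau>\<in>?S. scalar (\<psi> \<tau>) * X (K \<circ> inv \<tau> \<circ> swap r (Suc k)))"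
    unfolding sum_distrib_left by (rule sum.swap)
  \<comment> \<open>Reindexing by the transposition moves it from the index sequence to the
    coefficient \<psi>, where \<open>jm\<close> applies.\<close>
  also have "\<dots> = (\<Sum>r\<in>{1..<Suc k}. \<Sum>\<tau>\<in>?S. scalar (\<psi> (swap r (Suc k) \<circ> \<tau>)) * X (K \<circ> inv \<tau>))"
  proof (rule sum.cong[OF refl])
    fix r assume r: "r \<in> {1..<Suc k}"
    let ?t = "swap r (Suc k)"
    have t: "?t permutes {1..h}"
      using r assms(1) by (intro permutes_swap_id) auto
    have "(\<Sum>\<tau>\<in>?S. scalar (\<psi> \<tau>) * X (K \<circ> inv \<tau> \<circ> ?t)) = (\<Sum>\<tau>\<in>?S. scalar (\<psi> (?t \<circ> \<tau>)) * X (K \<circ> inv (?t \<circ> \<tau>) \<circ> ?t))"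
      by (rule setum_permutations_compose_left[OF t])
    also have "\<dots> = (\<Sum>\<tau>\<in>?S. scalar (\<psi> (?t \<circ> \<tau>)) * X (K \<circ> inv \<tau>))"
    proof (rule sum.cong[OF refl])
      fix \<tau> assume "\<tau> \<in> ?S"
      then have "inv (?t \<circ> \<tau>) \<circ> ?t = inv \<tau>"
        by (simp add: o_inv_distrib permutes_bij[OF t] permutes_bij comp_assoc)
      then show "scalar (\<psi> (?t \<circ> \<tau>)) * X (K \<circ> inv (?t \<circ> \<tau>) \<circ> ?t) = scalar (\<psi> (?t \<circ> \<tau>)) * X (K \<circ> inv \<tau>)"
        by (simp add: comp_assoc)
    qed
    finally show "(\<Sum>\<tau>\<in>?S. scalar (\<psi> \<tau>) * X (K \<circ> inv \<tau> \<circ> ?t)) = (\<Sum>\<tau>\<in>?S. scalar (\<psi> (?t \<circ> \<tau>)) * X (K \<circ> inv \<tau>))" .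
  qed
  also have "\<dots> = (\<Sum>\<tau>\<in>?S. scalar (\<Sum>r\<in>{1..<Suc k}. \<psi> (swap r (Suc k) \<circ> \<tau>)) * X (K \<circ> inv \<tau>))"
    unfolding scalar_sum sum_distrib_right by (rule sum.swap)
  also have "\<dots> = (\<Sum>\<tau>\<in>?S. scalar (\<psi> \<tau>) * (scalar (c (Suc k)) * X (K \<circ> inv \<tau>)))"
    by (intro sum.cong refl) (simp only: mem_Collect_eq jm scalar_mult mult.assoc mult.commute[of "c (Suc k)"])
  finally show ?thesis
    unfolding S M right_diff_distrib sum_subtractf by (simp add: comp_assoc)
qed

section \<open>Traces over index sequences\<close>

lemma finite_multi_index: "finite (multi_index h :: (nat \<Rightarrow> 'n::finite) set)"
  unfolding multi_index_def by (intro finite_PiE) auto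

lemma multi_index_permute:
  assumes "I \<in> multi_index h" "\<tau> permutes {1..h}"
  shows "I \<circ> \<tau> \<in> multi_index h"
  using assms unfolding multi_index_def PiE_def extensional_def by (auto simp: permutes_not_in)

lemma sum_multi_index_permute:
  fixes f :: "(nat \<Rightarrow> 'n) \<Rightarrow> 'r::comm_monoid_add"
  assumes "\<tau> permutes {1..h}"
  shows "(\<Sum>I\<in>multi_index h. f (I \<circ> \<tau>)) = (\<Sum>I\<in>multi_index h. f I)"
proof (rule sum.reindex_bij_witness[of _ "\<lambda>I. I \<circ> inv \<tau>" "\<lambda>I. I \<circ> \<tau>"])
  have "\<tau> \<circ> inv \<tau> = id" "inv \<tau> \<circ> \<tau> = id"
    using permutes_inv_o[OF assms] by auto
  then show "I \<circ> inv \<tau> \<circ> \<tau> = I" "I \<circ> \<tau> \<circ> inv \<tau> = I" for I :: "nat \<Rightarrow> 'n"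
    by (simp_all add: comp_assoc)
  show "I \<circ> \<tau> \<in> multi_index h" if "I \<in> multi_index h" for I :: "nat \<Rightarrow> 'n"
    by (rule multi_index_permute[OF that assms])
  show "I \<circ> inv \<tau> \<in> multi_index h" if "I \<in> multi_index h" for I :: "nat \<Rightarrow> 'n"
    by (rule multi_index_permute[OF that permutes_inv[OF assms]])
qed simp

definition normal_trace :: "nat \<Rightarrow> (nat \<Rightarrow> nat) \<Rightarrow> ('p, 'q, 'n::finite) env" where
  "normal_trace h \<sigma> = (\<Sum>I\<in>multi_index h. normal_seq h I (I \<circ> \<sigma>))"

text \<open>The factors of a normally ordered product may be permuted, so renumbering the positions
  in both index sequences has no effect.\<close>

lemma normal_trace_conj:
  assumes "\<tau> permutes {1..h}"
  shows "(normal_trace h (\<tau> \<circ> \<sigma> \<circ> inv \<tau>) :: ('p, 'q, 'n::finite) env) = normal_trace h \<sigma>"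
proof -
  have "(normal_trace h \<sigma> :: ('p, 'q, 'n) env) = (\<Sum>I\<in>multi_index h. normal_seq h (I \<circ> \<tau>) (I \<circ> \<tau> \<circ> \<sigma>))"
    unfolding normal_trace_def by (rule sum_multi_index_permute[OF assms, symmetric])
  also have "\<dots> = (\<Sum>I\<in>multi_index h. normal_seq h I (I \<circ> (\<tau> \<circ> \<sigma> \<circ> inv \<tau>)))"
  proof (rule sum.cong[OF refl])
    fix I :: "nat \<Rightarrow> 'n"
    have "I \<circ> (\<tau> \<circ> \<sigma> \<circ> inv \<tau>) \<circ> \<tau> = I \<circ> \<tau> \<circ> \<sigma>"
      using permutes_inv_o(2)[OF assms] by (simp add: comp_assoc)
    then show "(normal_seq h (I \<circ> \<tau>) (I \<circ> \<tau> \<circ> \<sigma>) :: ('p, 'q, 'n) env) = normal_seq h I (I \<circ> (\<tau> \<circ> \<sigma> \<circ> inv \<tau>))"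
      using normal_seq_permute[OF assms, of I "I \<circ> (\<tau> \<circ> \<sigma> \<circ> inv \<tau>)"] by simp
  qed
  finally show ?thesis by (simp add: normal_trace_def)
qed

lemma sum_tensor_E_perm_matrix:
  fixes I K :: "nat \<Rightarrow> 'n::finite"
  assumes jm: "\<And>k \<tau>. k \<in> {1..h} \<Longrightarrow> \<tau> permutes {1..h} \<Longrightarrow>
      (\<Sum>r\<in>{1..<k}. \<psi> (swap r k \<circ> \<tau>)) = c k * \<psi> \<tau>"
    and K: "K \<in> multi_index h"
  shows "(\<Sum>J\<in>multi_index h. tensor_E h c I J * scalar (tensor_perm_matrix h \<psi> J K)) =
    (\<Sum>\<tau> | \<tau> permutes {1..h}. scalar (\<psi> \<tau>) * (normal_seq h I (K \<circ> inv \<tau>) :: ('p, 'q, 'n) env))"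
proof -
  let ?S = "{\<tau>. \<tau> permutes {1..h}}"
  have "(\<Sum>J\<in>multi_index h. tensor_E h c I J * scalar (tensor_perm_matrix h \<psi> J K)) =
    (\<Sum>J\<in>multi_index h. \<Sum>\<tau>\<in>?S. if J = K \<circ> inv \<tau> then scalar (\<psi> \<tau>) * tensor_E h c I J else (0 :: ('p, 'q, 'n) env))"
    unfolding tensor_perm_matrix_def scalar_sum sum_distrib_left
    by (intro sum.cong refl) (auto simp: scalar_commute)
  also have "\<dots> = (\<Sum>\<tau>\<in>?S. \<Sum>J\<in>multi_index h. if J = K \<circ> inv \<tau> then scalar (\<psi> \<tau>) * tensor_E h c I J else 0)"
    by (rule sum.swap)
  also have "\<dots> = (\<Sum>\<tau>\<in>?S. scalar (\<psi> \<tau>) * tensor_E h c I (K \<circ> inv \<tau>))"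
    using multi_index_permute[OF K permutes_inv]
    by (intro sum.cong refl) (simp add: finite_multi_index)
  also have "\<dots> = (\<Sum>\<tau>\<in>?S. scalar (\<psi> \<tau>) * mixed_seq h c 0 I (K \<circ> inv \<tau>))"
    by (simp add: mixed_seq_def tensor_E_def)
  also have "\<dots> = (\<Sum>\<tau>\<in>?S. scalar (\<psi> \<tau>) * mixed_seq h c h I (K \<circ> inv \<tau>))"
  proof (rule inc_induct[of 0 h "\<lambda>k. (\<Sum>\<tau>\<in>?S. scalar (\<psi> \<tau>) * mixed_seq h c k I (K \<circ> inv \<tau>)) =
      (\<Sum>\<tau>\<in>?S. scalar (\<psi> \<tau>) * (mixed_seq h c h I (K \<circ> inv \<tau>) :: ('p, 'q, 'n) env))"])
    fix k assume "k < h" and IH: "(\<Sum>\<tau>\<in>?S. scalar (\<psi> \<tau>) * mixed_seq h c (Suc k) I (K \<circ> inv \<tau>)) =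
      (\<Sum>\<tau>\<in>?S. scalar (\<psi> \<tau>) * (mixed_seq h c h I (K \<circ> inv \<tau>) :: ('p, 'q, 'n) env))"
    have "(\<Sum>\<tau>\<in>?S. scalar (\<psi> \<tau>) * mixed_seq h c (Suc k) I (K \<circ> inv \<tau>)) =
      (\<Sum>\<tau>\<in>?S. scalar (\<psi> \<tau>) * (mixed_seq h c k I (K \<circ> inv \<tau>) :: ('p, 'q, 'n) env))"
      by (rule mixed_seq_step[OF \<open>k < h\<close>, where \<psi> = \<psi> and c = c]) (rule jm, use \<open>k < h\<close> in auto)
    with IH show "(\<Sum>\<tau>\<in>?S. scalar (\<psi> \<tau>) * mixed_seq h c k I (K \<circ> inv \<tau>)) =
      (\<Sum>\<tau>\<in>?S. scalar (\<psi> \<tau>) * (mixed_seq h c h I (K \<circ> inv \<tau>) :: ('p, 'q, 'n) env))"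
      by simp
  qed simp_all
  finally show ?thesis by (simp add: mixed_seq_def)
qed

section \<open>Hook products\<close>

text \<open>Row and column groups as the permutations preserving a label, over an arbitrary set of
  positions, so that cells can be removed without renumbering.\<close>

definition stab :: "('a \<Rightarrow> nat) \<Rightarrow> 'a set \<Rightarrow> ('a \<Rightarrow> 'a) set" where
  "stab f A = {\<sigma>. \<sigma> permutes A \<and> (\<forall>x\<in>A. f (\<sigma> x) = f x)}"

lemma stab_permutes: "\<sigma> \<in> stab f A \<Longrightarrow> \<sigma> permutes A"
  by (simp add: stab_def)

lemma stab_apply: "\<sigma> \<in> stab f A \<Longrightarrow> f (\<sigma> x) = f x"
  by (cases "x \<in> A") (auto simp: stab_def permutes_not_in)

lemma stabI: "\<sigma> permutes A \<Longrightarrow> (\<And>x. x \<in> A \<Longrightarrow> f (\<sigma> x) = f x) \<Longrightarrow> \<sigma> \<in> stab f A"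
  by (simp add: stab_def)

lemma finite_stab [simp]: "finite A \<Longrightarrow> finite (stab f A)"
  by (rule finite_subset[of _ "{\<sigma>. \<sigma> permutes A}"]) (auto simp: stab_def finite_permutations)

lemma id_in_stab: "id \<in> stab f A"
  by (simp add: stab_def permutes_id)

lemma stab_comp: "\<sigma> \<in> stab f A \<Longrightarrow> \<tau> \<in> stab f A \<Longrightarrow> \<sigma> \<circ> \<tau> \<in> stab f A"
  by (intro stabI) (auto simp: stab_apply intro: permutes_compose stab_permutes)

lemma stab_inv: "\<sigma> \<in> stab f A \<Longrightarrow> inv \<sigma> \<in> stab f A"
  by (intro stabI) (metis stab_apply stab_permutes permutes_inv permutes_inverses(1))+

lemma stab_mono: "\<sigma> \<in> stab f A \<Longrightarrow> A \<subseteq> B \<Longrightarrow> \<sigma> \<in> stab f B"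
  by (intro stabI) (auto simp: stab_apply intro: permutes_subset stab_permutes)

lemma transpose_in_stab: "x \<in> A \<Longrightarrow> y \<in> A \<Longrightarrow> f x = f y \<Longrightarrow> swap x y \<in> stab f A"
  by (intro stabI) (auto simp: Transposition.transpose_def intro: permutes_swap_id)

section \<open>Sums over Young subgroups\<close>

lemma sum_stab_comp_left:
  assumes "\<tau> \<in> stab f A"
  shows "(\<Sum>\<sigma>\<in>stab f A. F (\<tau> \<circ> \<sigma>)) = (\<Sum>\<sigma>\<in>stab f A. F \<sigma>)"
proof (rule sum.reindex_bij_witness[of _ "\<lambda>\<sigma>. inv \<tau> \<circ> \<sigma>" "\<lambda>\<sigma>. \<tau> \<circ> \<sigma>"])
  note t = permutes_inv_o[OF stab_permutes[OF assms]]
  show "inv \<tau> \<circ> (\<tau> \<circ> \<sigma>) = \<sigma>" "\<tau> \<circ> (inv \<tau> \<circ> \<sigma>) = \<sigma>" for \<sigma>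
    using t by (simp_all flip: comp_assoc)
qed (use assms in \<open>auto intro: stab_comp stab_inv\<close>)

lemma sum_stab_comp_right:
  assumes "\<tau> \<in> stab f A"
  shows "(\<Sum>\<sigma>\<in>stab f A. F (\<sigma> \<circ> \<tau>)) = (\<Sum>\<sigma>\<in>stab f A. F \<sigma>)"
proof (rule sum.reindex_bij_witness[of _ "\<lambda>\<sigma>. \<sigma> \<circ> inv \<tau>" "\<lambda>\<sigma>. \<sigma> \<circ> \<tau>"])
  note t = permutes_inv_o[OF stab_permutes[OF assms]]
  show "\<sigma> \<circ> \<tau> \<circ> inv \<tau> = \<sigma>" "\<sigma> \<circ> inv \<tau> \<circ> \<tau> = \<sigma>" for \<sigma> :: "'a \<Rightarrow> 'a"
    using t by (simp_all add: comp_assoc)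
qed (use assms in \<open>auto intro: stab_comp stab_inv\<close>)

lemma sum_stab_inv: "(\<Sum>\<sigma>\<in>stab f A. F (inv \<sigma>)) = (\<Sum>\<sigma>\<in>stab f A. F \<sigma>)"
  by (rule sum.reindex_bij_witness[of _ inv inv])
    (auto intro: stab_inv dest: stab_permutes simp: permutes_inv_inv)

text \<open>Coset decomposition by the image of \<open>z\<close>: composing \<sigma> with
  \<open>swap z (\<sigma> z)\<close> on the left gives a permutation that fixes
  \<open>z\<close>.\<close>

lemma sum_stab_insert_left:
  assumes "z \<notin> A"
  shows "(\<Sum>\<sigma>\<in>stab f (insert z A). F \<sigma>) =
    (\<Sum>y\<in>{y \<in> insert z A. f y = f z}. \<Sum>\<sigma>\<in>stab f A. F (swap z y \<circ> \<sigma>))"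
  unfolding sum.cartesian_product
proof (rule sum.reindex_bij_witness[of _ "\<lambda>(y, \<sigma>). swap z y \<circ> \<sigma>" "\<lambda>\<sigma>. (\<sigma> z, swap z (\<sigma> z) \<circ> \<sigma>)"])
  fix \<sigma> assume \<sigma>: "\<sigma> \<in> stab f (insert z A)"
  have in_A: "\<sigma> z \<in> insert z A"
    using permutes_in_image[OF stab_permutes[OF \<sigma>], of z] by simp
  have "swap z (\<sigma> z) \<circ> \<sigma> \<in> stab f (insert z A)"
    using in_A by (intro stab_comp[OF _ \<sigma>] transpose_in_stab) (auto simp: stab_apply[OF \<sigma>])
  then have "swap z (\<sigma> z) \<circ> \<sigma> permutes A" "\<forall>x\<in>A. f ((swap z (\<sigma> z) \<circ> \<sigma>) x) = f x"
    by (auto simp: stab_def intro: permutes_superset)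
  then show "(\<sigma> z, swap z (\<sigma> z) \<circ> \<sigma>) \<in> {y \<in> insert z A. f y = f z} \<times> stab f A"
    using in_A stab_apply[OF \<sigma>, of z] by (simp add: stab_def)
next
  fix b assume b: "b \<in> {y \<in> insert z A. f y = f z} \<times> stab f A"
  then obtain y \<sigma> where b_eq: "b = (y, \<sigma>)" and y: "y \<in> insert z A" "f y = f z" and \<sigma>: "\<sigma> \<in> stab f A"
    by auto
  have z: "\<sigma> z = z" using stab_permutes[OF \<sigma>] assms by (rule permutes_not_in)
  show "(\<lambda>\<sigma>. (\<sigma> z, swap z (\<sigma> z) \<circ> \<sigma>)) ((\<lambda>(y, \<sigma>). swap z y \<circ> \<sigma>) b) = b"
    by (auto simp: b_eq z comp_assoc[symmetric])
  show "(\<lambda>(y, \<sigma>). swap z y \<circ> \<sigma>) b \<in> stab f (insert z A)"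
    using y stab_mono[OF \<sigma>, of "insert z A"] by (auto simp: b_eq intro!: stab_comp transpose_in_stab)
qed (auto simp: comp_assoc[symmetric])

lemma sum_stab_insert_right:
  assumes "z \<notin> A"
  shows "(\<Sum>\<sigma>\<in>stab f (insert z A). F \<sigma>) =
    (\<Sum>y\<in>{y \<in> insert z A. f y = f z}. \<Sum>\<sigma>\<in>stab f A. F (\<sigma> \<circ> swap z y))"
proof -
  have "(\<Sum>\<sigma>\<in>stab f (insert z A). F \<sigma>) = (\<Sum>\<sigma>\<in>stab f (insert z A). F (inv \<sigma>))"
    by (rule sum_stab_inv[symmetric])
  also have "\<dots> = (\<Sum>y\<in>{y \<in> insert z A. f y = f z}. \<Sum>\<sigma>\<in>stab f A. F (inv (swap z y \<circ> \<sigma>)))"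
    by (rule sum_stab_insert_left[OF assms])
  also have "\<dots> = (\<Sum>y\<in>{y \<in> insert z A. f y = f z}. \<Sum>\<sigma>\<in>stab f A. F (inv \<sigma> \<circ> swap z y))"
    by (intro sum.cong refl) (simp add: o_inv_distrib permutes_bij[OF stab_permutes])
  also have "\<dots> = (\<Sum>y\<in>{y \<in> insert z A. f y = f z}. \<Sum>\<sigma>\<in>stab f A. F (\<sigma> \<circ> swap z y))"
    by (intro sum.cong refl sum_stab_inv)
  finally show ?thesis .
qed

lemma stab_permutation: "finite A \<Longrightarrow> \<sigma> \<in> stab f A \<Longrightarrow> permutation \<sigma>"
  using permutation_permutes stab_permutes by blast

lemma sign_stab_comp: "finite A \<Longrightarrow> \<sigma> \<in> stab f A \<Longrightarrow> \<tau> \<in> stab f A \<Longrightarrow> sign (\<sigma> \<circ> \<tau>) = sign \<sigma> * sign \<tau>"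
  by (intro sign_compose) (auto intro: stab_permutation)

lemma sign_stab_inv: "finite A \<Longrightarrow> \<sigma> \<in> stab f A \<Longrightarrow> sign (inv \<sigma>) = sign \<sigma>"
  by (intro sign_inverse) (auto intro: stab_permutation)

lemma sign_stab_transpose:
  "finite A \<Longrightarrow> \<sigma> \<in> stab f A \<Longrightarrow> x \<noteq> y \<Longrightarrow> sign (\<sigma> \<circ> swap x y) = - sign \<sigma>"
  by (subst sign_compose) (auto intro: stab_permutation permutation_swap_id simp: sign_swap_id)

text \<open>
  The matrix entry of \<open>g\<close> on words in the letters \<open>N\<close>, with the positions in \<open>Q\<close> labelled by \<open>e\<close> before
  and by \<open>t\<close> after, and the trace taken over the positions in \<open>A - Q\<close>.
\<close>

definition words :: "'a set \<Rightarrow> ('a \<Rightarrow> nat) \<Rightarrow> nat set \<Rightarrow> 'a set \<Rightarrow> ('a \<Rightarrow> 'a) \<Rightarrow> ('a \<Rightarrow> nat) \<Rightarrow> ('a \<Rightarrow> nat) set" where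
  "words Q e N A g t = {L \<in> A \<rightarrow>\<^sub>E N. \<forall>x\<in>A. if x \<in> Q then L x = e x \<and> L (g x) = t x else L (g x) = L x}"

text \<open>The partial trace of the identity: the letter at a fixed traced position is
  free.\<close>

lemma card_words_fixed:
  assumes "finite A" "finite N" "z \<notin> A" "z \<notin> Q" "g permutes A"
  shows "card (words Q e N (insert z A) g t) = card N * card (words Q e N A g t)"
proof -
  have gA: "g x \<in> A" if "x \<in> A" for x using that assms(5) by (simp add: permutes_in_image)
  have gz: "g z = z" using assms(3,5) by (simp add: permutes_not_in)
  have ne: "x \<noteq> z" "g x \<noteq> z" if "x \<in> A" for x using that gA assms(3) by auto
  have "bij_betw (\<lambda>(l, L). L(z := l)) (N \<times> words Q e N A g t) (words Q e N (insert z A) g t)"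
  proof (rule bij_betw_byWitness[where f' = "\<lambda>L. (L z, restrict L A)"])
    show "\<forall>a\<in>N \<times> words Q e N A g t. (\<lambda>L. (L z, restrict L A)) ((\<lambda>(l, L). L(z := l)) a) = a"
      using assms(3) by (auto simp: words_def restrict_def fun_eq_iff PiE_def extensional_def)
    show "\<forall>L\<in>words Q e N (insert z A) g t. (\<lambda>(l, L). L(z := l)) (L z, restrict L A) = L"
      by (auto simp: words_def restrict_def fun_eq_iff PiE_def extensional_def)
    show "(\<lambda>(l, L). L(z := l)) ` (N \<times> words Q e N A g t) \<subseteq> words Q e N (insert z A) g t"
    proof
      fix L' assume "L' \<in> (\<lambda>(l, L). L(z := l)) ` (N \<times> words Q e N A g t)"
      then obtain l L where "L' = L(z := l)" "l \<in> N" "L \<in> words Q e N A g t" by auto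
      then show "L' \<in> words Q e N (insert z A) g t"
        using assms(3,4) gz ne by (auto simp: words_def PiE_def extensional_def Pi_def)
    qed
    show "(\<lambda>L. (L z, restrict L A)) ` words Q e N (insert z A) g t \<subseteq> N \<times> words Q e N A g t"
      using gA by (force simp: words_def PiE_def Pi_def)
  qed
  then show ?thesis
    by (metis bij_betw_same_card card_cartesian_product)
qed

text \<open>The partial trace of a transposition is the identity: the condition at \<open>z\<close>
  forces its letter to be that at \<open>g1 y\<close>, so \<open>z\<close> can be cut out of its
  cycle.\<close>

lemma card_words_merge:
  assumes "z \<notin> A" "z \<notin> Q" "g1 permutes A" "g2 permutes A" "y \<in> A"
  shows "card (words Q e N (insert z A) (g1 \<circ> swap z y \<circ> g2) t) = card (words Q e N A (g1 \<circ> g2) t)"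
proof -
  let ?g = "g1 \<circ> swap z y \<circ> g2"
  have gA: "g1 x \<in> A" "g2 x \<in> A" if "x \<in> A" for x using that assms(3,4) by (simp_all add: permutes_in_image)
  have gz: "g1 z = z" "g2 z = z" using assms(1,3,4) by (simp_all add: permutes_not_in)
  have ne: "x \<noteq> z" "g1 x \<noteq> z" "g2 x \<noteq> z" if "x \<in> A" for x using that gA assms(1) by auto
  have g: "?g z = g1 y" "\<And>x. x \<in> A \<Longrightarrow> ?g x = (if g2 x = y then z else g1 (g2 x))"
    using gz ne by (auto simp: Transposition.transpose_def)
  have "bij_betw (\<lambda>L. restrict L A) (words Q e N (insert z A) ?g t) (words Q e N A (g1 \<circ> g2) t)"
  proof (rule bij_betw_byWitness[where f' = "\<lambda>L. L(z := L (g1 y))"])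
    show "\<forall>L\<in>words Q e N (insert z A) ?g t. (restrict L A)(z := restrict L A (g1 y)) = L"
      using assms(2,5) gA by (auto simp: words_def gz restrict_def fun_eq_iff PiE_def extensional_def)
    show "\<forall>L\<in>words Q e N A (g1 \<circ> g2) t. restrict (L(z := L (g1 y))) A = L"
      using assms(1) by (auto simp: words_def restrict_def fun_eq_iff PiE_def extensional_def)
    show "(\<lambda>L. restrict L A) ` words Q e N (insert z A) ?g t \<subseteq> words Q e N A (g1 \<circ> g2) t"
    proof
      fix L' assume "L' \<in> (\<lambda>L. restrict L A) ` words Q e N (insert z A) ?g t"
      then obtain L where L: "L' = restrict L A" "L \<in> words Q e N (insert z A) ?g t" by auto
      have "L (g1 y) = L z" using L(2) assms(2) by (auto simp: words_def gz)
      then have "L (?g x) = L (g1 (g2 x))" if "x \<in> A" for x using that by (simp only: g split: if_split) auto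
      then show "L' \<in> words Q e N A (g1 \<circ> g2) t"
        using L gA by (force simp: words_def PiE_def Pi_def)
    qed
    show "(\<lambda>L. L(z := L (g1 y))) ` words Q e N A (g1 \<circ> g2) t \<subseteq> words Q e N (insert z A) ?g t"
    proof
      fix L' assume "L' \<in> (\<lambda>L. L(z := L (g1 y))) ` words Q e N A (g1 \<circ> g2) t"
      then obtain L where L: "L' = L(z := L (g1 y))" "L \<in> words Q e N A (g1 \<circ> g2) t" by auto
      have "L' (?g x) = L (g1 (g2 x))" if "x \<in> A" for x
        using that ne gA by (simp only: g L(1) split: if_split) auto
      moreover have "L' (?g z) = L' z" using ne assms(5) by (simp add: L(1) gz)
      moreover have "L' \<in> insert z A \<rightarrow>\<^sub>E N"
        using L gA assms(5) by (auto simp: words_def PiE_def extensional_def Pi_def)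
      ultimately show "L' \<in> words Q e N (insert z A) ?g t"
        using L assms(1,2) ne by (auto simp: words_def)
    qed
  qed
  then show ?thesis by (rule bij_betw_same_card)
qed

text \<open>The coefficient of the identity in \<open>(ab)\<^sup>2\<close>, for \<open>ab\<close> the Young symmetrizer of the diagram on the positions \<open>A\<close> with
  row map \<open>r\<close> and column map \<open>c\<close>.\<close>

definition symmetrizer_square :: "('a \<Rightarrow> nat) \<Rightarrow> ('a \<Rightarrow> nat) \<Rightarrow> 'a set \<Rightarrow> int" where
  "symmetrizer_square r c A = (\<Sum>p\<in>stab r A. \<Sum>q\<in>stab c A. \<Sum>q'\<in>stab c A.
     if \<forall>x\<in>A. r (q (p x)) = r (q' x) then sign q * sign q' else 0)"

definition hook_card :: "('a \<Rightarrow> nat) \<Rightarrow> ('a \<Rightarrow> nat) \<Rightarrow> 'a set \<Rightarrow> 'a \<Rightarrow> nat" where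
  "hook_card r c A x = card {y \<in> A. (r y = r x \<and> c x \<le> c y) \<or> (c y = c x \<and> r x \<le> r y)}"

text \<open>Positions are kept apart from their coordinates. Deleting the first column then only
  lowers \<open>c\<close> by one, and the permutations of the remaining positions stay the same
  functions.\<close>

locale young_diagram =
  fixes A :: "'a set" and r c :: "'a \<Rightarrow> nat"
  assumes finite_cells: "finite A"
    and inj_cells: "x \<in> A \<Longrightarrow> y \<in> A \<Longrightarrow> r x = r y \<Longrightarrow> c x = c y \<Longrightarrow> x = y"
    and pos_cells: "x \<in> A \<Longrightarrow> 1 \<le> r x \<and> 1 \<le> c x"
    and lower_cells: "x \<in> A \<Longrightarrow> 1 \<le> i \<Longrightarrow> i \<le> r x \<Longrightarrow> 1 \<le> j \<Longrightarrow> j \<le> c x \<Longrightarrow> \<exists>y\<in>A. r y = i \<and> c y = j"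
begin

definition K :: "'a set" where "K = {x \<in> A. c x = 1}"
definition Q :: "'a set" where "Q = {x \<in> A. c x > 1}"
text \<open>The number of rows, used also as the size of the alphabet, so that row numbers can serve
  as letters.\<close>

definition n :: nat where "n = card K"

lemma K_Q: "A = K \<union> Q" "K \<inter> Q = {}" "finite K" "finite Q"
  using pos_cells finite_cells by (force simp: K_def Q_def)+

lemma r_bij_K: "bij_betw r K {1..n}"
proof -
  have inj: "inj_on r K"
    by (rule inj_onI) (auto simp: K_def intro: inj_cells)
  have "r ` K = {1..n}"
  proof -
    have down: "i \<in> r ` K" if m: "m \<in> r ` K" "1 \<le> i" "i \<le> m" for i m
    proof -
      obtain x where "x \<in> A" "c x = 1" "r x = m" using m(1) unfolding K_def by blast
      then obtain y where "y \<in> A" "r y = i" "c y = 1" using lower_cells[of x i 1] m by auto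
      then show ?thesis by (auto simp: K_def)
    qed
    have pos: "1 \<le> m" if "m \<in> r ` K" for m
      using that pos_cells by (auto simp: K_def)
    show ?thesis
    proof (cases "K = {}")
      case False
      define M where "M = Max (r ` K)"
      have M: "M \<in> r ` K" "\<And>m. m \<in> r ` K \<Longrightarrow> m \<le> M"
        using False K_Q(3) by (auto simp: M_def)
      have "r ` K = {1..M}"
      proof (intro equalityI subsetI)
        show "i \<in> r ` K" if "i \<in> {1..M}" for i
          using down[OF M(1)] that by auto
        show "i \<in> {1..M}" if "i \<in> r ` K" for i
          using pos[OF that] M(2)[OF that] by simp
      qed
      moreover have "card (r ` K) = n" using card_image[OF inj] by (simp add: n_def)
      ultimately show ?thesis by simp
    qed (simp add: n_def)
  qed
  with inj show ?thesis by (simp add: bij_betw_def)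
qed

definition k :: "nat \<Rightarrow> 'a" where "k = the_inv_into K r"

lemma k_in: "i \<in> {1..n} \<Longrightarrow> k i \<in> K" "i \<in> {1..n} \<Longrightarrow> r (k i) = i"
  using r_bij_K the_inv_into_into[of r K i K] f_the_inv_into_f[of r K i]
  by (auto simp: k_def bij_betw_def)

lemma k_r: "x \<in> K \<Longrightarrow> k (r x) = x"
  using r_bij_K by (auto simp: k_def bij_betw_def the_inv_into_f_f)

lemma k_c: "i \<in> {1..n} \<Longrightarrow> c (k i) = 1" "i \<in> {1..n} \<Longrightarrow> k i \<in> A" "i \<in> {1..n} \<Longrightarrow> k i \<notin> Q"
  using k_in(1)[of i] by (auto simp: K_def Q_def)

lemma r_Q: "x \<in> Q \<Longrightarrow> r x \<in> {1..n}"
proof -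
  assume "x \<in> Q"
  then have "x \<in> A" "1 \<le> r x" using pos_cells by (auto simp: Q_def)
  then obtain y where "y \<in> A" "r y = r x" "c y = 1"
    using lower_cells[of x "r x" 1] pos_cells by auto
  then have "y \<in> K" by (simp add: K_def)
  then show ?thesis using bij_betwE[OF r_bij_K] \<open>r y = r x\<close> by auto
qed

definition part :: "nat \<Rightarrow> 'a set" where "part m = Q \<union> k ` {1..m}"

lemma part_0: "part 0 = Q"
  by (simp add: part_def)

lemma part_n: "part n = A"
proof -
  have "k ` {1..n} = K"
  proof (intro equalityI subsetI)
    show "x \<in> K" if "x \<in> k ` {1..n}" for x using that k_in(1) by blast
    show "x \<in> k ` {1..n}" if "x \<in> K" for x
      using k_r[OF that] bij_betwE[OF r_bij_K] that by (intro image_eqI[of x k "r x"]) simp_all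
  qed
  then show ?thesis using K_Q by (auto simp: part_def)
qed

lemma part_Suc: "part (Suc m) = insert (k (Suc m)) (part m)"
  by (auto simp: part_def atLeastAtMostSuc_conv)

lemma finite_part: "finite (part m)"
  using K_Q by (simp add: part_def)

lemma k_notin_part: "Suc m \<le> n \<Longrightarrow> k (Suc m) \<notin> part m"
proof
  assume m: "Suc m \<le> n" "k (Suc m) \<in> part m"
  then obtain i where "i \<in> {1..m}" "k (Suc m) = k i"
    using k_c(3)[of "Suc m"] by (auto simp: part_def)
  then show False
    using k_in(2)[of "Suc m"] k_in(2)[of i] m by auto
qed

abbreviation weight :: "nat \<Rightarrow> ('a \<Rightarrow> 'a) \<Rightarrow> ('a \<Rightarrow> 'a) \<Rightarrow> int" where
  "weight m g q' \<equiv> int (card (words Q r {1..n} (part m) g (r \<circ> q')))"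

text \<open>
  The coefficient of the row word of \<open>Q\<close> in the antisymmetrized \<open>a b\<close> for the partial diagram \<open>part m\<close>, traced over the
  letters \<open>{1..n}\<close> in the first \<open>m\<close> cells of the first column.
\<close>

definition partial_sum :: "nat \<Rightarrow> int" where
  "partial_sum m = (\<Sum>q'\<in>stab c Q. sign q' * (\<Sum>p\<in>stab r (part m). \<Sum>q\<in>stab c (part m). sign q * weight m (q \<circ> p) q'))"

text \<open>
  Moving \<open>y\<close> up into the longer row \<open>s\<close> makes two cells of one column symmetric (through \<open>w\<close>), hence the sum 0.
\<close>

lemma garnir_vanish:
  assumes m: "m \<le> n" "s \<in> {1..m}" and y: "y \<in> Q" "s < r y"
  shows "(\<Sum>p\<in>stab r (part m). \<Sum>q\<in>stab c (part m). sign q * weight m (q \<circ> swap (k s) y \<circ> p) q') = 0"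
    (is "?Z = 0")
proof -
  have s: "s \<in> {1..n}" using m by auto
  have "y \<in> A" using y by (simp add: Q_def)
  then obtain w where w: "w \<in> A" "r w = s" "c w = c y"
    using lower_cells[of y s "c y"] y s pos_cells by auto
  have wQ: "w \<in> Q" using w y by (simp add: Q_def)
  have ks: "k s \<in> part m" using m by (auto simp: part_def)
  have in_part: "w \<in> part m" "y \<in> part m" using wQ y by (auto simp: part_def)
  have ne: "w \<noteq> y" "k s \<noteq> y" "k s \<noteq> w" using w y k_c(3)[OF s] wQ by auto
  have t1: "swap (k s) w \<in> stab r (part m)"
    using ks in_part w k_in(2)[OF s] by (intro transpose_in_stab) auto
  have t2: "swap w y \<in> stab c (part m)"
    using in_part w by (intro transpose_in_stab) auto
  \<comment> \<open>The row transposition of \<open>k s\<close> and \<open>w\<close> is absorbed by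
    the sum over \<open>p\<close>. This identity turns it into the column transposition of
    \<open>w\<close> and \<open>y\<close>, which the sum over \<open>q\<close> absorbs with sign
    -1.\<close>
  have braid: "swap (k s) y \<circ> swap (k s) w
      = swap w y \<circ> swap (k s) y"
    using ne by (auto simp: Transposition.transpose_def fun_eq_iff)
  define V where "V p q = sign q * weight m (q \<circ> swap (k s) y \<circ> p) q'" for p q
  have V: "V (swap (k s) w \<circ> p) q = - V p (q \<circ> swap w y)" if q: "q \<in> stab c (part m)" for p q
  proof -
    have "q \<circ> swap (k s) y \<circ> (swap (k s) w \<circ> p) =
      (q \<circ> swap w y) \<circ> swap (k s) y \<circ> p"
      using braid by (metis comp_assoc)
    then show ?thesis
      by (simp add: V_def sign_stab_transpose[OF finite_part q ne(1)])
  qed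
  have "?Z = (\<Sum>p\<in>stab r (part m). \<Sum>q\<in>stab c (part m). V p q)"
    by (simp add: V_def)
  also have "\<dots> = (\<Sum>p\<in>stab r (part m). \<Sum>q\<in>stab c (part m). V (swap (k s) w \<circ> p) q)"
    by (rule sum_stab_comp_left[OF t1, symmetric])
  also have "\<dots> = - (\<Sum>p\<in>stab r (part m). \<Sum>q\<in>stab c (part m). V p (q \<circ> swap w y))"
    by (simp add: V sum_negf)
  also have "\<dots> = - (\<Sum>p\<in>stab r (part m). \<Sum>q\<in>stab c (part m). V p q)"
    by (intro arg_cong[where f = uminus] sum.cong refl sum_stab_comp_right[OF t2])
  also have "\<dots> = - ?Z"
    by (simp add: V_def)
  finally show ?thesis by simp
qed

text \<open>The partial trace over the letter in the new position \<open>k (m + 1)\<close>.\<close>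

lemma partial_sum_Suc:
  assumes m: "Suc m \<le> n"
  shows "partial_sum (Suc m) = (int n + int (card {x \<in> Q. r x = Suc m}) - int m) * partial_sum m"
proof -
  define z where "z = k (Suc m)"
  define B where "B = part m"
  define Y where "Y = {y \<in> Q. r y = Suc m}"
  define X where "X = k ` {1..m}"
  have zB: "z \<notin> B" using k_notin_part[OF m] by (simp add: z_def B_def)
  have zQ: "z \<notin> Q" using k_c(3)[of "Suc m"] m by (simp add: z_def)
  have rz: "r z = Suc m" and cz: "c z = 1" using k_in(2)[of "Suc m"] k_c(1)[of "Suc m"] m by (simp_all add: z_def)
  have part: "part (Suc m) = insert z B" by (simp add: part_Suc z_def B_def)
  have finB: "finite B" by (simp add: B_def finite_part)
  have rX: "r x \<in> {1..m}" "c x = 1" "x \<in> B" if "x \<in> X" for x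
    using that m k_in(2) k_c(1) by (auto simp: X_def B_def part_def)
  have rows: "{y \<in> insert z B. r y = r z} = insert z Y"
    using rX by (force simp: rz Y_def B_def part_def X_def)
  have cols: "{x \<in> insert z B. c x = c z} = insert z X"
    using k_c(1) m by (auto simp: cz X_def B_def part_def Q_def)
  have zY: "z \<notin> Y" "z \<notin> X" "finite Y" "finite X" "Y \<subseteq> B"
    using zB zQ K_Q finB by (auto simp: Y_def X_def B_def part_def)
  have card_X: "card X = m"
  proof -
    have "inj_on k {1..m}" using k_in(2) m by (intro inj_onI) (metis atLeastAtMost_iff le_trans Suc_leD)
    then show ?thesis by (simp add: X_def card_image)
  qed
  define G where "G q' = (\<Sum>p\<in>stab r B. \<Sum>q\<in>stab c B. sign q * weight m (q \<circ> p) q')" for q'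
  \<comment> \<open>\<open>y\<close> and \<open>x\<close> represent the cosets for the row and the
    column of the new cell \<open>z\<close>. The pair \<open>z, z\<close> yields the factor
    \<open>n\<close>, a transposition in the row alone +1, one in the column alone -1, and the mixed
    pairs yield 0.\<close>
  define F where "F q' y x = (\<Sum>p\<in>stab r B. \<Sum>q\<in>stab c B. sign (q \<circ> swap z x) *
    weight (Suc m) ((q \<circ> swap z x) \<circ> (swap z y \<circ> p)) q')" for q' y x
  have zz: "F q' z z = int n * G q'" for q'
    unfolding F_def G_def sum_distrib_left
  proof (intro sum.cong refl)
    fix p q assume pq: "p \<in> stab r B" "q \<in> stab c B"
    then have "q \<circ> p permutes B" by (intro permutes_compose stab_permutes)
    then have "weight (Suc m) (q \<circ> p) q' = int n * weight m (q \<circ> p) q'"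
      using card_words_fixed[OF finB _ zB zQ, of "{1..n}" "q \<circ> p" r "r \<circ> q'"] by (simp add: part B_def)
    then show "sign (q \<circ> swap z z) * weight (Suc m) (q \<circ> swap z z \<circ> (swap z z \<circ> p)) q'
        = int n * (sign q * weight m (q \<circ> p) q')"
      by simp
  qed
  have yz: "F q' y z = G q'" if y: "y \<in> Y" for q' y
    unfolding F_def G_def
  proof (intro sum.cong refl)
    fix p q assume pq: "p \<in> stab r B" "q \<in> stab c B"
    have "weight (Suc m) (q \<circ> swap z y \<circ> p) q' = weight m (q \<circ> p) q'"
      using card_words_merge[OF zB zQ stab_permutes[OF pq(2)] stab_permutes[OF pq(1)], of y r "{1..n}" "r \<circ> q'"] y zY by (auto simp: part B_def)
    then show "sign (q \<circ> swap z z) * weight (Suc m) (q \<circ> swap z z \<circ> (swap z y \<circ> p)) q'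
        = sign q * weight m (q \<circ> p) q'"
      by (simp add: comp_assoc)
  qed
  have zx: "F q' z x = - G q'" if x: "x \<in> X" for q' x
    unfolding F_def G_def sum_negf[symmetric]
  proof (intro sum.cong refl)
    fix p q assume pq: "p \<in> stab r B" "q \<in> stab c B"
    have "weight (Suc m) (q \<circ> swap z x \<circ> p) q' = weight m (q \<circ> p) q'"
      using card_words_merge[OF zB zQ stab_permutes[OF pq(2)] stab_permutes[OF pq(1)], of x r "{1..n}" "r \<circ> q'"] rX[OF x] by (auto simp: part B_def)
    moreover have "z \<noteq> x" using x zY by auto
    ultimately show "sign (q \<circ> swap z x) * weight (Suc m) (q \<circ> swap z x \<circ> (swap z z \<circ> p)) q'
        = - (sign q * weight m (q \<circ> p) q')"
      by (simp add: sign_stab_transpose[OF finB pq(2)])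
  qed
  have yx: "F q' y x = 0" if y: "y \<in> Y" and x: "x \<in> X" for q' y x
  proof -
    obtain s where s: "s \<in> {1..m}" "x = k s" using x by (auto simp: X_def)
    have ne: "z \<noteq> x" "z \<noteq> y" "x \<noteq> y" using x y zY rX[OF x] by (auto simp: Y_def)
    have B: "x \<in> B" "y \<in> B" using rX[OF x] y zY by auto
    \<comment> \<open>After this rewriting \<open>z\<close> occurs in a single transposition, so
      \<open>card_words_merge\<close> eliminates it. The remaining \<open>swap x y\<close> leads
      from the first column into a lower row, the situation of \<open>garnir_vanish\<close>.\<close>
    have braid: "swap z x \<circ> swap z y = swap z y \<circ> swap x y"
      using ne by (auto simp: Transposition.transpose_def fun_eq_iff)
    have "F q' y x = - (\<Sum>p\<in>stab r B. \<Sum>q\<in>stab c B. sign q * weight m (q \<circ> swap x y \<circ> p) q')"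
      unfolding F_def sum_negf[symmetric]
    proof (intro sum.cong refl)
      fix p q assume pq: "p \<in> stab r B" "q \<in> stab c B"
      have "(q \<circ> swap z x) \<circ> (swap z y \<circ> p) = q \<circ> swap z y \<circ> (swap x y \<circ> p)"
        using braid by (metis comp_assoc)
      moreover have "swap x y \<circ> p permutes B"
        using B by (intro permutes_compose[OF stab_permutes[OF pq(1)]] permutes_swap_id)
      ultimately have "weight (Suc m) ((q \<circ> swap z x) \<circ> (swap z y \<circ> p)) q' = weight m (q \<circ> (swap x y \<circ> p)) q'"
        using card_words_merge[OF zB zQ stab_permutes[OF pq(2)] _ B(2), of "swap x y \<circ> p" r "{1..n}" "r \<circ> q'"] by (simp add: part B_def)
      then show "sign (q \<circ> swap z x) * weight (Suc m) ((q \<circ> swap z x) \<circ> (swap z y \<circ> p)) q'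
        = - (sign q * weight m (q \<circ> swap x y \<circ> p) q')"
        by (simp add: sign_stab_transpose[OF finB pq(2) ne(1)] comp_assoc)
    qed
    also have "\<dots> = 0"
      using garnir_vanish[of m s y q'] m s y by (auto simp: B_def Y_def)
    finally show ?thesis .
  qed
  have "(\<Sum>p\<in>stab r (part (Suc m)). \<Sum>q\<in>stab c (part (Suc m)). sign q * weight (Suc m) (q \<circ> p) q')
     = (int n + int (card Y) - int m) * G q'" for q'
  proof -
    have "(\<Sum>p\<in>stab r (part (Suc m)). \<Sum>q\<in>stab c (part (Suc m)). sign q * weight (Suc m) (q \<circ> p) q')
      = (\<Sum>y\<in>insert z Y. \<Sum>p\<in>stab r B. \<Sum>x\<in>insert z X. \<Sum>q\<in>stab c B. sign (q \<circ> swap z x) *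
          weight (Suc m) ((q \<circ> swap z x) \<circ> (swap z y \<circ> p)) q')"
      unfolding part sum_stab_insert_left[OF zB, where f = r] sum_stab_insert_right[OF zB, where f = c] rows cols ..
    also have "\<dots> = (\<Sum>y\<in>insert z Y. \<Sum>x\<in>insert z X. F q' y x)"
      unfolding F_def by (rule sum.cong[OF refl], rule sum.swap)
    also have "\<dots> = F q' z z + (\<Sum>x\<in>X. F q' z x) + (\<Sum>y\<in>Y. F q' y z + (\<Sum>x\<in>X. F q' y x))"
      using zY by (simp add: sum.distrib)
    also have "\<dots> = (int n + int (card Y) - int m) * G q'"
      using zz[of q'] by (simp add: yz zx yx card_X algebra_simps)
    finally show ?thesis .
  qed
  then show ?thesis
    unfolding partial_sum_def G_def B_def Y_def by (simp add: sum_distrib_left mult.left_commute)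
qed

text \<open>Without traced positions the only admissible word is the row word, and the count becomes
  the condition in \<open>symmetrizer_square\<close>.\<close>

lemma partial_sum_0: "partial_sum 0 = symmetrizer_square r c Q"
proof -
  have "weight 0 (q \<circ> p) q' = (if \<forall>x\<in>Q. r (q (p x)) = r (q' x) then 1 else 0)"
    if "p \<in> stab r Q" "q \<in> stab c Q" for p q q'
  proof -
    have pQ: "q (p x) \<in> Q" if "x \<in> Q" for x
      using that \<open>p \<in> stab r Q\<close> \<open>q \<in> stab c Q\<close> by (simp add: permutes_in_image[OF stab_permutes])
    have "words Q r {1..n} Q (q \<circ> p) (r \<circ> q') = (if \<forall>x\<in>Q. r (q (p x)) = r (q' x) then {restrict r Q} else {})"
    proof -
      have "L = restrict r Q" if "L \<in> words Q r {1..n} Q (q \<circ> p) (r \<circ> q')" for L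
        using that by (auto simp: words_def PiE_def extensional_def fun_eq_iff)
      moreover have "restrict r Q \<in> words Q r {1..n} Q (q \<circ> p) (r \<circ> q') \<longleftrightarrow> (\<forall>x\<in>Q. r (q (p x)) = r (q' x))"
        using r_Q pQ by (auto simp: words_def)
      ultimately show ?thesis by auto
    qed
    then show ?thesis by (simp add: part_0)
  qed
  then have "partial_sum 0 = (\<Sum>q'\<in>stab c Q. sign q' * (\<Sum>p\<in>stab r Q. \<Sum>q\<in>stab c Q. sign q * (if \<forall>x\<in>Q. r (q (p x)) = r (q' x) then 1 else 0)))"
    unfolding partial_sum_def by (simp add: part_0)
  also have "\<dots> = (\<Sum>q'\<in>stab c Q. \<Sum>p\<in>stab r Q. \<Sum>q\<in>stab c Q. if \<forall>x\<in>Q. r (q (p x)) = r (q' x) then sign q * sign q' else 0)"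
    unfolding sum_distrib_left by (intro sum.cong refl) simp
  also have "\<dots> = symmetrizer_square r c Q"
    unfolding symmetrizer_square_def by (subst sum.swap) (rule sum.cong[OF refl], rule sum.swap)
  finally show ?thesis .
qed

section \<open>The trace over the whole first column\<close>

lemma perm_K_in_stab: "\<pi> permutes K \<Longrightarrow> \<pi> \<in> stab c A"
proof (rule stabI)
  assume \<pi>: "\<pi> permutes K"
  show "\<pi> permutes A" using permutes_subset[OF \<pi>] K_Q by auto
  show "c (\<pi> x) = c x" if "x \<in> A" for x
    using permutes_in_image[OF \<pi>, of x] permutes_not_in[OF \<pi>, of x] by (cases "x \<in> K") (auto simp: K_def)
qed

text \<open>The column group is the direct product of the symmetric group of the first column and
  the column group of the rest.\<close>

lemma sum_stab_columns:
  "(\<Sum>\<sigma>\<in>stab c A. F \<sigma>) = (\<Sum>\<pi> | \<pi> permutes K. \<Sum>\<sigma>\<in>stab c Q. F (\<pi> \<circ> \<sigma>))"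
  unfolding sum.cartesian_product
proof (rule sum.reindex_bij_witness[of _ "\<lambda>(\<pi>, \<sigma>). \<pi> \<circ> \<sigma>"
      "\<lambda>\<sigma>. (\<lambda>x. if x \<in> K then \<sigma> x else x, \<lambda>x. if x \<in> Q then \<sigma> x else x)"])
  fix \<sigma> assume \<sigma>: "\<sigma> \<in> stab c A"
  note p = stab_permutes[OF \<sigma>]
  have img: "\<sigma> ` B = B" if "B = K \<or> B = Q" for B
  proof -
    have "\<sigma> ` B \<subseteq> B"
      using that stab_apply[OF \<sigma>] permutes_in_image[OF p] by (auto simp: K_def Q_def)
    moreover have "finite B" using that K_Q by auto
    ultimately show ?thesis
      by (metis card_image card_subset_eq permutes_inj_on[OF p])
  qed
  have perm: "(\<lambda>x. if x \<in> B then \<sigma> x else x) permutes B" if "B = K \<or> B = Q" for B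
  proof (rule bij_imp_permutes)
    have "bij_betw \<sigma> B B" using img[OF that] permutes_inj_on[OF p] by (simp add: bij_betw_def)
    then show "bij_betw (\<lambda>x. if x \<in> B then \<sigma> x else x) B B"
      by (rule bij_betw_cong[THEN iffD1, rotated]) simp
  qed simp
  show "(\<lambda>x. if x \<in> K then \<sigma> x else x, \<lambda>x. if x \<in> Q then \<sigma> x else x) \<in> {\<pi>. \<pi> permutes K} \<times> stab c Q"
    using perm[of K] stabI[OF perm[of Q], of c] stab_apply[OF \<sigma>] by simp
  have eq: "(\<lambda>x. if x \<in> K then \<sigma> x else x) \<circ> (\<lambda>x. if x \<in> Q then \<sigma> x else x) = \<sigma>"
  proof
    fix x
    show "((\<lambda>x. if x \<in> K then \<sigma> x else x) \<circ> (\<lambda>x. if x \<in> Q then \<sigma> x else x)) x = \<sigma> x"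
      using img[of Q] K_Q permutes_not_in[OF p, of x] by (cases "x \<in> Q") (auto simp: image_iff)
  qed
  then show "(\<lambda>(\<pi>, \<sigma>). \<pi> \<circ> \<sigma>) (\<lambda>x. if x \<in> K then \<sigma> x else x, \<lambda>x. if x \<in> Q then \<sigma> x else x) = \<sigma>"
    by simp
  then show "(case (\<lambda>x. if x \<in> K then \<sigma> x else x, \<lambda>x. if x \<in> Q then \<sigma> x else x) of (\<pi>, \<sigma>) \<Rightarrow> F (\<pi> \<circ> \<sigma>)) = F \<sigma>"
    by simp
next
  fix b assume "b \<in> {\<pi>. \<pi> permutes K} \<times> stab c Q"
  then obtain \<pi> \<sigma> where b: "b = (\<pi>, \<sigma>)" and \<pi>: "\<pi> permutes K" and \<sigma>: "\<sigma> \<in> stab c Q" by auto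
  have disj: "x \<notin> Q" if "x \<in> K" for x using that K_Q(2) by auto
  have fix1: "\<pi> x = x" if "x \<in> Q" for x using that K_Q permutes_not_in[OF \<pi>] by auto
  have fix2: "\<sigma> x = x" if "x \<notin> Q" for x using that permutes_not_in[OF stab_permutes[OF \<sigma>]] by auto
  have in_Q: "\<sigma> x \<in> Q" if "x \<in> Q" for x using that by (simp add: permutes_in_image[OF stab_permutes[OF \<sigma>]])
  show "(\<lambda>\<sigma>. (\<lambda>x. if x \<in> K then \<sigma> x else x, \<lambda>x. if x \<in> Q then \<sigma> x else x)) ((\<lambda>(\<pi>, \<sigma>). \<pi> \<circ> \<sigma>) b) = b"
    using fix1 fix2 in_Q disj permutes_not_in[OF \<pi>] by (auto simp: b fun_eq_iff)
  have "\<pi> \<in> stab c A"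
    by (rule perm_K_in_stab[OF \<pi>])
  moreover have "\<sigma> \<in> stab c A" using K_Q by (intro stab_mono[OF \<sigma>]) auto
  ultimately show "(\<lambda>(\<pi>, \<sigma>). \<pi> \<circ> \<sigma>) b \<in> stab c A"
    by (simp add: b stab_comp)
qed

text \<open>Only words that are injective on the first column survive the antisymmetrization.\<close>

lemma partial_sum_n: "partial_sum n = symmetrizer_square r c A"
proof -
  define W where "W = {L \<in> A \<rightarrow>\<^sub>E {1..n}. \<forall>x\<in>Q. L x = r x}"
  define ok where "ok L g q' \<longleftrightarrow> (\<forall>x\<in>A. L (g x) = (if x \<in> Q then r (q' x) else L x))" for L :: "'a \<Rightarrow> nat" and g q'
  have finW: "finite W"
    by (rule finite_subset[OF _ finite_PiE[OF finite_cells, of "\<lambda>_. {1..n}"]]) (auto simp: W_def)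
  have weight: "weight n g q' = (\<Sum>L\<in>W. if ok L g q' then 1 else 0)" for g q'
  proof -
    have "words Q r {1..n} A g (r \<circ> q') = {L \<in> W. ok L g q'}"
      using K_Q by (auto simp: words_def W_def ok_def)
    then show ?thesis using finW by (simp add: part_n sum.If_cases Int_def)
  qed
  have "partial_sum n = (\<Sum>q'\<in>stab c Q. \<Sum>p\<in>stab r A. \<Sum>q\<in>stab c A. \<Sum>L\<in>W. if ok L (q \<circ> p) q' then sign q * sign q' else 0)"
    unfolding partial_sum_def weight unfolding part_n sum_distrib_left by (intro sum.cong refl) auto
  also have "\<dots> = (\<Sum>q'\<in>stab c Q. \<Sum>p\<in>stab r A. \<Sum>L\<in>W. \<Sum>q\<in>stab c A. if ok L (q \<circ> p) q' then sign q * sign q' else 0)"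
    by (rule sum.cong[OF refl], rule sum.cong[OF refl], rule sum.swap)
  also have "\<dots> = (\<Sum>q'\<in>stab c Q. \<Sum>p\<in>stab r A. \<Sum>\<pi> | \<pi> permutes K. \<Sum>q\<in>stab c A.
      if \<forall>x\<in>A. r (q (p x)) = r (\<pi> (q' x)) then sign q * sign (\<pi> \<circ> q') else 0)"
  proof (intro sum.cong refl)
    fix q' p assume q': "q' \<in> stab c Q" and p: "p \<in> stab r A"
    define V where "V L = (\<Sum>q\<in>stab c A. if ok L (q \<circ> p) q' then sign q * sign q' else 0)" for L
    have vanish: "V L = 0" if L: "L \<in> W" "\<not> inj_on L K" for L
    proof -
      obtain x y where xy: "x \<in> K" "y \<in> K" "x \<noteq> y" "L x = L y" using L(2) by (auto simp: inj_on_def)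
      let ?t = "swap x y"
      have t: "?t \<in> stab c A" using xy by (intro transpose_in_stab) (auto simp: K_def)
      have "L (?t z) = L z" for z using xy by (auto simp: Transposition.transpose_def)
      then have ok: "ok L ((?t \<circ> q) \<circ> p) q' = ok L (q \<circ> p) q'" for q by (simp add: ok_def)
      have "V L = (\<Sum>q\<in>stab c A. if ok L ((?t \<circ> q) \<circ> p) q' then sign (?t \<circ> q) * sign q' else 0)"
        unfolding V_def by (rule sum_stab_comp_left[OF t, symmetric])
      also have "\<dots> = (\<Sum>q\<in>stab c A. - (if ok L (q \<circ> p) q' then sign q * sign q' else 0))"
        unfolding ok using xy by (intro sum.cong refl) (simp add: sign_stab_comp[OF finite_cells t] sign_swap_id)
      finally show ?thesis by (simp add: V_def sum_negf)
    qed
    have "(\<Sum>L\<in>W. V L) = (\<Sum>L\<in>{L \<in> W. inj_on L K}. V L)"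
      using finW vanish by (intro sum.mono_neutral_right) auto
    \<comment> \<open>The alphabet has exactly as many letters as the first column has cells, so a
      word injective there is the row word composed with a permutation of that column.\<close>
    also have "\<dots> = (\<Sum>\<pi> | \<pi> permutes K. V (restrict (r \<circ> \<pi>) A))"
    proof (rule sum.reindex_bij_witness[of _ "\<lambda>\<pi>. restrict (r \<circ> \<pi>) A" "\<lambda>L x. if x \<in> K then k (L x) else x"])
      fix L assume "L \<in> {L \<in> W. inj_on L K}"
      then have L: "L \<in> A \<rightarrow>\<^sub>E {1..n}" "\<And>x. x \<in> Q \<Longrightarrow> L x = r x" "inj_on L K" by (auto simp: W_def)
      have LK: "L x \<in> {1..n}" if "x \<in> K" for x using L(1) that K_Q by (auto simp: PiE_def)
      show "restrict (r \<circ> (\<lambda>x. if x \<in> K then k (L x) else x)) A = L"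
      proof
        fix x show "restrict (r \<circ> (\<lambda>x. if x \<in> K then k (L x) else x)) A x = L x"
          using L LK k_in(2) K_Q by (cases "x \<in> A") (auto simp: PiE_def extensional_def)
      qed
      then show "V (restrict (r \<circ> (\<lambda>x. if x \<in> K then k (L x) else x)) A) = V L" by simp
      have "inj_on (\<lambda>x. k (L x)) K"
      proof (rule inj_onI)
        fix x y assume "x \<in> K" "y \<in> K" "k (L x) = k (L y)"
        then have "L x = L y" using LK k_in(2) by metis
        then show "x = y" using L(3) \<open>x \<in> K\<close> \<open>y \<in> K\<close> by (auto dest: inj_onD)
      qed
      moreover have "(\<lambda>x. k (L x)) ` K \<subseteq> K" using LK k_in(1) by auto
      ultimately have "bij_betw (\<lambda>x. k (L x)) K K"
        using K_Q by (metis bij_betw_def card_image card_subset_eq)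
      then have "bij_betw (\<lambda>x. if x \<in> K then k (L x) else x) K K"
        by (rule bij_betw_cong[THEN iffD1, rotated]) simp
      then show "(\<lambda>x. if x \<in> K then k (L x) else x) \<in> {\<pi>. \<pi> permutes K}"
        by (auto intro: bij_imp_permutes)
    next
      fix \<pi> assume "\<pi> \<in> {\<pi>. \<pi> permutes K}"
      then have \<pi>: "\<pi> permutes K" by simp
      have in_K: "\<pi> x \<in> K" if "x \<in> K" for x using that by (simp add: permutes_in_image[OF \<pi>])
      have fix1: "\<pi> x = x" if "x \<notin> K" for x using that permutes_not_in[OF \<pi>] by auto
      show "(\<lambda>x. if x \<in> K then k (restrict (r \<circ> \<pi>) A x) else x) = \<pi>"
        using in_K fix1 k_r K_Q by (auto simp: fun_eq_iff)
      have "inj_on (restrict (r \<circ> \<pi>) A) K"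
      proof (rule inj_onI)
        fix x y assume xy: "x \<in> K" "y \<in> K" "restrict (r \<circ> \<pi>) A x = restrict (r \<circ> \<pi>) A y"
        moreover have "x \<in> A" "y \<in> A" using xy K_Q(1) by blast+
        ultimately have "r (\<pi> x) = r (\<pi> y)" by simp
        then have "\<pi> x = \<pi> y" using in_K xy k_r by metis
        then show "x = y" using permutes_inj[OF \<pi>] by (auto dest: injD)
      qed
      moreover have "restrict (r \<circ> \<pi>) A \<in> W"
      proof -
        have "r (\<pi> x) \<in> {1..n}" if "x \<in> A" for x
          using that r_Q in_K fix1 bij_betwE[OF r_bij_K] K_Q by (cases "x \<in> K") auto
        moreover have "x \<notin> K \<and> x \<in> A" if "x \<in> Q" for x using that K_Q(1,2) by blast
        ultimately show ?thesis using fix1 by (auto simp: W_def)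
      qed
      ultimately show "restrict (r \<circ> \<pi>) A \<in> {L \<in> W. inj_on L K}" by simp
    qed
    also have "\<dots> = (\<Sum>\<pi> | \<pi> permutes K. \<Sum>q\<in>stab c A. if \<forall>x\<in>A. r (q (p x)) = r (\<pi> (q' x)) then sign q * sign (\<pi> \<circ> q') else 0)"
    proof (intro sum.cong refl)
      fix \<pi> assume "\<pi> \<in> {\<pi>. \<pi> permutes K}"
      then have \<pi>: "\<pi> permutes K" and \<pi>c: "\<pi> \<in> stab c A" by (auto intro: perm_K_in_stab)
      have q'A: "q' \<in> stab c A" using K_Q by (intro stab_mono[OF q']) auto
      have fix1: "\<pi> x = x" if "x \<notin> K" for x using that permutes_not_in[OF \<pi>] by auto
      have q'Q: "q' x \<in> Q" if "x \<in> Q" for x using that by (simp add: permutes_in_image[OF stab_permutes[OF q']])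
      have q'K: "q' x = x" if "x \<notin> Q" for x using that permutes_not_in[OF stab_permutes[OF q']] by auto
      have gA: "q (p x) \<in> A" if "x \<in> A" "q \<in> stab c A" for x q
        using that p by (simp add: permutes_in_image[OF stab_permutes])
      have rhs: "r (\<pi> (q' x)) = (if x \<in> Q then r (q' x) else r (\<pi> x))" for x
      proof (cases "x \<in> Q")
        case True
        then have "q' x \<notin> K" using q'Q K_Q(2) by blast
        then show ?thesis using True fix1 by simp
      qed (simp add: q'K)
      have ok: "ok (restrict (r \<circ> \<pi>) A) (q \<circ> p) q' \<longleftrightarrow> (\<forall>x\<in>A. r ((\<pi> \<circ> q) (p x)) = r (\<pi> (q' x)))" if "q \<in> stab c A" for q
        unfolding ok_def rhs by (intro ball_cong refl) (use gA that in auto)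
      have s: "sign q * sign q' = sign (\<pi> \<circ> q) * sign (\<pi> \<circ> q')" if "q \<in> stab c A" for q
      proof -
        have "sign \<pi> * sign \<pi> = 1" by (cases "evenperm \<pi>") (auto simp: sign_def)
        then have "sign q * sign q' = (sign \<pi> * sign \<pi>) * (sign q * sign q')" by simp
        then show ?thesis
          unfolding sign_stab_comp[OF finite_cells \<pi>c that] sign_stab_comp[OF finite_cells \<pi>c q'A] by (simp only: mult.assoc mult.commute mult.left_commute)
      qed
      \<comment> \<open>Replacing \<open>q\<close> by \<open>\<pi> \<circ> q\<close> absorbs \<pi>
        into the column group. The sign of \<pi> passes to \<open>q'\<close>, and the products
        \<open>\<pi> \<circ> q'\<close> exhaust the column group of \<open>A\<close>.\<close>
      have "V (restrict (r \<circ> \<pi>) A) = (\<Sum>q\<in>stab c A. if \<forall>x\<in>A. r ((\<pi> \<circ> q) (p x)) = r (\<pi> (q' x)) then sign (\<pi> \<circ> q) * sign (\<pi> \<circ> q') else 0)"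
        unfolding V_def by (intro sum.cong refl) (simp only: ok s)
      also have "\<dots> = (\<Sum>q\<in>stab c A. if \<forall>x\<in>A. r (q (p x)) = r (\<pi> (q' x)) then sign q * sign (\<pi> \<circ> q') else 0)"
        by (rule sum_stab_comp_left[OF \<pi>c])
      finally show "V (restrict (r \<circ> \<pi>) A) = \<dots>" .
    qed
    finally show "(\<Sum>L\<in>W. \<Sum>q\<in>stab c A. if ok L (q \<circ> p) q' then sign q * sign q' else 0) = \<dots>"
      by (simp only: V_def)
  qed
  also have "\<dots> = (\<Sum>p\<in>stab r A. \<Sum>\<pi> | \<pi> permutes K. \<Sum>q'\<in>stab c Q. \<Sum>q\<in>stab c A.
      if \<forall>x\<in>A. r (q (p x)) = r (\<pi> (q' x)) then sign q * sign (\<pi> \<circ> q') else 0)"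
    by (subst sum.swap) (rule sum.cong[OF refl], rule sum.swap)
  also have "\<dots> = (\<Sum>p\<in>stab r A. \<Sum>q'\<in>stab c A. \<Sum>q\<in>stab c A. if \<forall>x\<in>A. r (q (p x)) = r (q' x) then sign q * sign q' else 0)"
    by (rule sum.cong[OF refl], subst (2) sum_stab_columns) (simp only: comp_apply)
  also have "\<dots> = symmetrizer_square r c A"
    unfolding symmetrizer_square_def by (rule sum.cong[OF refl], rule sum.swap)
  finally show ?thesis .
qed

text \<open>The factors of \<open>partial_sum_Suc\<close> are hook lengths: for the cell in row
  \<open>m + 1\<close> the number of cells of \<open>Q\<close> in that row is the arm, and
  \<open>n - m\<close> is the leg together with the cell itself.\<close>

lemma symmetrizer_square_step:
  "symmetrizer_square r c A = (\<Prod>x\<in>K. int (hook_card r c A x)) * symmetrizer_square r c Q"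
proof -
  have "partial_sum m = (\<Prod>i<m. int n + int (card {x \<in> Q. r x = Suc i}) - int i) * symmetrizer_square r c Q" if "m \<le> n" for m
    using that by (induction m) (simp_all add: partial_sum_0 partial_sum_Suc mult_ac)
  then have "symmetrizer_square r c A = (\<Prod>i<n. int n + int (card {x \<in> Q. r x = Suc i}) - int i) * symmetrizer_square r c Q"
    using partial_sum_n by simp
  also have "(\<Prod>i<n. int n + int (card {x \<in> Q. r x = Suc i}) - int i) = (\<Prod>x\<in>K. int (hook_card r c A x))"
  proof (rule prod.reindex_bij_witness[of _ "\<lambda>x. r x - 1" "\<lambda>i. k (Suc i)"])
    fix i assume i: "i \<in> {..<n}"
    then have Si: "Suc i \<in> {1..n}" by auto
    show "k (Suc i) \<in> K" "r (k (Suc i)) - 1 = i" using k_in[OF Si] by simp_all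
    have ki: "k (Suc i) \<in> K" "r (k (Suc i)) = Suc i" "c (k (Suc i)) = 1"
      using k_in[OF Si] k_c(1)[OF Si] by simp_all
    have "{y \<in> A. (r y = r (k (Suc i)) \<and> c (k (Suc i)) \<le> c y) \<or> (c y = c (k (Suc i)) \<and> r (k (Suc i)) \<le> r y)}
      = {x \<in> Q. r x = Suc i} \<union> {x \<in> K. Suc i \<le> r x}" (is "?H = ?Q \<union> ?K")
      unfolding ki using pos_cells by (force simp: K_def Q_def)
    moreover have "card ?K = n - i"
    proof -
      have "r ` ?K = {Suc i..n}"
      proof (intro equalityI subsetI)
        show "m \<in> {Suc i..n}" if "m \<in> r ` ?K" for m
          using that bij_betwE[OF r_bij_K] by auto
        show "m \<in> r ` ?K" if "m \<in> {Suc i..n}" for m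
          using that k_in[of m] by (intro image_eqI[of m r "k m"]) auto
      qed
      moreover have "inj_on r ?K"
        by (rule inj_on_subset[OF bij_betw_imp_inj_on[OF r_bij_K]]) auto
      ultimately have "bij_betw r ?K {Suc i..n}" by (simp add: bij_betw_def)
      then show ?thesis by (simp add: bij_betw_same_card)
    qed
    moreover have "?Q \<inter> ?K = {}" using K_Q by auto
    ultimately have "hook_card r c A (k (Suc i)) = card ?Q + (n - i)"
      unfolding hook_card_def using K_Q by (simp add: card_Un_disjoint)
    then show "int (hook_card r c A (k (Suc i))) = int n + int (card {x \<in> Q. r x = Suc i}) - int i"
      using i by simp
  next
    fix x assume x: "x \<in> K"
    then have "r x \<in> {1..n}" using bij_betwE[OF r_bij_K] by auto
    then show "r x - 1 \<in> {..<n}" "k (Suc (r x - 1)) = x" using k_r[OF x] by auto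
  qed
  finally show ?thesis .
qed

end

lemma young_diagram_shift:
  assumes "young_diagram A r c"
  shows "young_diagram {x \<in> A. c x > 1} r (\<lambda>x. c x - 1)"
proof -
  interpret young_diagram A r c by fact
  show ?thesis
  proof
    fix x i j assume x: "x \<in> {x \<in> A. 1 < c x}" "1 \<le> i" "i \<le> r x" "1 \<le> j" "j \<le> c x - 1"
    then have "Suc j \<le> c x" by auto
    then obtain y where "y \<in> A" "r y = i" "c y = Suc j" using lower_cells[of x i "Suc j"] x by auto
    then show "\<exists>y\<in>{x \<in> A. 1 < c x}. r y = i \<and> c y - 1 = j" using x by (intro bexI[of _ y]) auto
  next
    fix x y assume "x \<in> {x \<in> A. 1 < c x}" "y \<in> {x \<in> A. 1 < c x}" "r x = r y" "c x - 1 = c y - 1"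
    then show "x = y" by (intro inj_cells) auto
  qed (use finite_cells pos_cells in force)+
qed

lemma symmetrizer_square_eq_hooks:
  assumes "young_diagram A r c"
  shows "symmetrizer_square r c A = (\<Prod>x\<in>A. int (hook_card r c A x))"
  using assms
proof (induction "card A" arbitrary: A c rule: less_induct)
  case less
  interpret young_diagram A r c by fact
  show ?case
  proof (cases "A = {}")
    case True
    then show ?thesis by (simp add: symmetrizer_square_def stab_def)
  next
    case False
    then obtain x where x: "x \<in> A" by auto
    then obtain y where "y \<in> A" "c y = 1" using lower_cells[of x "r x" 1] pos_cells by auto
    then have "y \<notin> Q" by (simp add: Q_def)
    then have "card Q < card A"
      using finite_cells \<open>y \<in> A\<close> K_Q(1) by (intro psubset_card_mono) auto
    let ?c = "\<lambda>x. c x - 1"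
    have IH: "symmetrizer_square r ?c Q = (\<Prod>x\<in>Q. int (hook_card r ?c Q x))"
      using less.hyps[OF \<open>card Q < card A\<close>] young_diagram_shift[OF less.prems] by (simp add: Q_def)
    have pos: "c x > 1" if "x \<in> Q" for x using that by (simp add: Q_def)
    have "stab ?c Q = stab c Q"
    proof -
      have "(\<forall>x\<in>Q. c (\<sigma> x) - 1 = c x - 1) \<longleftrightarrow> (\<forall>x\<in>Q. c (\<sigma> x) = c x)" if "\<sigma> permutes Q" for \<sigma>
      proof (intro ball_cong refl)
        fix x assume "x \<in> Q"
        then have "c x > 1" "c (\<sigma> x) > 1" using pos permutes_in_image[OF that] by auto
        then show "c (\<sigma> x) - 1 = c x - 1 \<longleftrightarrow> c (\<sigma> x) = c x" by auto
      qed
      then show ?thesis by (auto simp: stab_def)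
    qed
    then have "symmetrizer_square r c Q = symmetrizer_square r ?c Q"
      by (simp add: symmetrizer_square_def)
    also have "\<dots> = (\<Prod>x\<in>Q. int (hook_card r c A x))"
      unfolding IH
    proof (intro prod.cong refl arg_cong[where f = int])
      fix x assume "x \<in> Q"
      \<comment> \<open>The hook of a cell outside the first column does not meet that
        column.\<close>
      then have "{y \<in> Q. (r y = r x \<and> c x - 1 \<le> c y - 1) \<or> (c y - 1 = c x - 1 \<and> r x \<le> r y)} =
        {y \<in> A. (r y = r x \<and> c x \<le> c y) \<or> (c y = c x \<and> r x \<le> r y)}"
        by (auto simp: Q_def)
      then show "hook_card r ?c Q x = hook_card r c A x" by (simp add: hook_card_def)
    qed
    moreover have "(\<Prod>x\<in>K \<union> Q. int (hook_card r c A x)) = (\<Prod>x\<in>K. int (hook_card r c A x)) * (\<Prod>x\<in>Q. int (hook_card r c A x))"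
      using K_Q by (intro prod.union_disjoint) auto
    ultimately show ?thesis
      using symmetrizer_square_step unfolding K_Q(1)[symmetric] by simp
  qed
qed

section \<open>Young symmetrizers\<close>

lemma sum_ge_sum_interval:
  fixes X :: "nat set"
  assumes "finite X" "0 \<notin> X"
  shows "\<Sum>{1..card X} \<le> \<Sum>X \<and> (\<Sum>X = \<Sum>{1..card X} \<longrightarrow> X = {1..card X})"
  using assms
proof (induction "card X" arbitrary: X)
  case (Suc m)
  define M where "M = Max X"
  have ne: "X \<noteq> {}" using Suc.hyps(2) by auto
  have M: "M \<in> X" "\<And>x. x \<in> X \<Longrightarrow> x \<le> M" using Max_in[OF Suc.prems(1) ne] Suc.prems(1) by (auto simp: M_def)
  have "X \<subseteq> {1..M}" using M(2) Suc.prems(2) by (auto simp: Suc_le_eq intro: gr0I)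
  then have 1: "Suc m \<le> M" using card_mono[of "{1..M}" X] Suc.hyps(2) by simp
  have "card (X - {M}) = m" using M(1) Suc by simp
  then have 2: "\<Sum>{1..m} \<le> \<Sum>(X - {M})" "\<Sum>(X - {M}) = \<Sum>{1..m} \<Longrightarrow> X - {M} = {1..m}"
    using Suc.hyps(1)[of "X - {M}"] Suc.prems by auto
  have 3: "\<Sum>X = M + \<Sum>(X - {M})" using M(1) Suc.prems(1) by (simp add: sum.remove)
  have 4: "\<Sum>{1..card X} = \<Sum>{1..m} + Suc m"
    unfolding Suc.hyps(2)[symmetric] by (simp add: atLeastAtMostSuc_conv)
  have "X = {1..card X}" if "\<Sum>X = \<Sum>{1..card X}"
  proof -
    have "M = Suc m" "\<Sum>(X - {M}) = \<Sum>{1..m}" using that 1 2(1) 3 4 by linarith+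
    then have "X = insert (Suc m) {1..m}" using 2(2) M(1) by blast
    then show ?thesis unfolding Suc.hyps(2)[symmetric] by (simp add: atLeastAtMostSuc_conv)
  qed
  then show ?case using 1 2(1) 3 4 by simp
qed simp

context young_diagram
begin

lemma row_image:
  assumes "x \<in> A"
  shows "c ` {y \<in> A. r y = r x} = {1..card {y \<in> A. r y = r x}}"
proof -
  let ?R = "{y \<in> A. r y = r x}"
  have inj: "inj_on c ?R" by (rule inj_onI) (auto intro: inj_cells)
  have fin: "finite (c ` ?R)" "c ` ?R \<noteq> {}" using finite_cells assms by auto
  define M where "M = Max (c ` ?R)"
  have M: "M \<in> c ` ?R" "\<And>j. j \<in> c ` ?R \<Longrightarrow> j \<le> M" using Max_in[OF fin] fin by (auto simp: M_def)
  obtain z where z: "z \<in> A" "r z = r x" "c z = M" using M(1) by auto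
  have "c ` ?R = {1..M}"
  proof (intro equalityI subsetI)
    fix j assume "j \<in> {1..M}"
    then obtain y where "y \<in> A" "r y = r x" "c y = j" using lower_cells[of z "r x" j] z pos_cells assms by auto
    then show "j \<in> c ` ?R" by auto
  qed (use M(2) pos_cells in auto)
  then show ?thesis using card_image[OF inj] by simp
qed

text \<open>
  Each row has distinct entries under \<open>c \<circ> inv \<tau>\<close>, so their sum is at least that of the column indices of the
  row; the sums over the whole diagram agree, hence every row takes exactly its own column indices.
\<close>

lemma row_column_factorization:
  assumes \<tau>: "\<tau> permutes A"
    and sep: "\<And>x y. x \<in> A \<Longrightarrow> y \<in> A \<Longrightarrow> r x = r y \<Longrightarrow> c (inv \<tau> x) = c (inv \<tau> y) \<Longrightarrow> x = y"
  obtains p q where "p \<in> stab r A" "q \<in> stab c A" "\<tau> = p \<circ> q"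
proof -
  define f where "f x = c (inv \<tau> x)" for x
  define R where "R i = {y \<in> A. r y = i}" for i
  have inv_in: "inv \<tau> x \<in> A" if "x \<in> A" for x using that permutes_in_image[OF permutes_inv[OF \<tau>]] by simp
  have finR: "finite (R i)" for i using finite_cells by (simp add: R_def)
  have inj: "inj_on f (R i)" "inj_on c (R i)" for i
    by (auto intro!: inj_onI simp: R_def f_def intro: sep inj_cells)
  have cR: "c ` R i = {1..card (R i)}" if "i \<in> r ` A" for i
    using row_image that by (auto simp: R_def)
  have sum_c: "\<Sum>(c ` R i) = sum c (R i)" "\<Sum>(f ` R i) = sum f (R i)" for i
    using sum.reindex[OF inj(2)] sum.reindex[OF inj(1)] by simp_all
  have zero: "0 \<notin> f ` R i" for i using pos_cells inv_in by (force simp: R_def f_def)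
  have card_f: "card (f ` R i) = card (R i)" for i by (rule card_image[OF inj(1)])
  have le: "sum c (R i) \<le> sum f (R i)" if "i \<in> r ` A" for i
    using sum_ge_sum_interval[OF finite_imageI[OF finR] zero, of i] cR[OF that] sum_c[of i] card_f[of i] by simp
  have groups: "sum g A = (\<Sum>i\<in>r ` A. sum g (R i))" for g :: "'a \<Rightarrow> nat"
    unfolding R_def by (rule sum.image_gen[OF finite_cells])
  have total: "sum f A = sum c A"
    unfolding f_def by (rule sum.permute[OF permutes_inv[OF \<tau>], of c, unfolded comp_def, symmetric])
  have eq: "sum f (R i) = sum c (R i)" if i: "i \<in> r ` A" for i
  proof (rule ccontr)
    assume "sum f (R i) \<noteq> sum c (R i)"
    then have "sum c (R i) < sum f (R i)" using le[OF i] by simp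
    then have "(\<Sum>i\<in>r ` A. sum c (R i)) < (\<Sum>i\<in>r ` A. sum f (R i))"
      using le i finite_cells by (intro sum_strict_mono_ex1) auto
    then show False using total groups[of c] groups[of f] by simp
  qed
  have fR: "f ` R i = c ` R i" if "i \<in> r ` A" for i
    using sum_ge_sum_interval[OF finite_imageI[OF finR] zero, of i] cR[OF that] sum_c[of i] card_f[of i] eq[OF that] by simp
  have "\<exists>y. y \<in> A \<and> r y = r x \<and> c y = f x" if "x \<in> A" for x
  proof -
    have "f x \<in> c ` R (r x)" using fR[of "r x"] that by (auto simp: R_def)
    then show ?thesis by (auto simp: R_def)
  qed
  \<comment> \<open>The permutation moves \<open>x\<close> within its row to the column
    \<open>c (inv \<tau> x)\<close>, so that its composition with \<tau> preserves columns.\<close>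
  then obtain \<rho>0 where \<rho>0: "\<And>x. x \<in> A \<Longrightarrow> \<rho>0 x \<in> A \<and> r (\<rho>0 x) = r x \<and> c (\<rho>0 x) = f x" by metis
  define \<rho> where "\<rho> x = (if x \<in> A then \<rho>0 x else x)" for x
  have \<rho>: "\<rho> x \<in> A" "r (\<rho> x) = r x" "c (\<rho> x) = f x" if "x \<in> A" for x using that \<rho>0 by (simp_all add: \<rho>_def)
  have "inj_on \<rho> A"
  proof (rule inj_onI)
    fix x y assume xy: "x \<in> A" "y \<in> A" "\<rho> x = \<rho> y"
    then show "x = y" using sep[of x y] \<rho>[of x] \<rho>[of y] by (simp add: f_def)
  qed
  moreover have "\<rho> ` A = A"
    using \<open>inj_on \<rho> A\<close> finite_cells \<rho>(1) by (metis card_image card_subset_eq image_subsetI)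
  ultimately have "\<rho> permutes A" by (intro bij_imp_permutes) (auto simp: bij_betw_def \<rho>_def)
  then have \<rho>r: "\<rho> \<in> stab r A" using \<rho> by (intro stabI) auto
  have "\<rho> \<circ> \<tau> \<in> stab c A"
  proof (rule stabI)
    show "\<rho> \<circ> \<tau> permutes A" by (rule permutes_compose[OF \<tau> \<open>\<rho> permutes A\<close>])
    show "c ((\<rho> \<circ> \<tau>) x) = c x" if "x \<in> A" for x
      using \<rho>(3)[of "\<tau> x"] that permutes_in_image[OF \<tau>] by (simp add: f_def permutes_inverses(2)[OF \<tau>])
  qed
  moreover have "inv \<rho> \<in> stab r A" by (rule stab_inv[OF \<rho>r])
  moreover have "\<tau> = inv \<rho> \<circ> (\<rho> \<circ> \<tau>)"
    using permutes_inv_o(2)[OF \<open>\<rho> permutes A\<close>] by (simp flip: comp_assoc)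
  ultimately show thesis using that by blast
qed

lemma stab_Int: "\<sigma> \<in> stab r A \<Longrightarrow> \<sigma> \<in> stab c A \<Longrightarrow> \<sigma> = id"
proof
  fix x assume \<sigma>: "\<sigma> \<in> stab r A" "\<sigma> \<in> stab c A"
  show "\<sigma> x = id x"
  proof (cases "x \<in> A")
    case True
    then have "\<sigma> x \<in> A" by (simp add: permutes_in_image[OF stab_permutes[OF \<sigma>(1)]])
    then show ?thesis using inj_cells[of "\<sigma> x" x] True stab_apply[OF \<sigma>(1)] stab_apply[OF \<sigma>(2)] by simp
  next
    case False
    then show ?thesis using permutes_not_in[OF stab_permutes[OF \<sigma>(1)]] by simp
  qed
qed

end

section \<open>Convolution in the group algebra\<close>

lemma galg_mult_assoc: "galg_mult h (galg_mult h x y) z = galg_mult h x (galg_mult h y z)"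
proof
  fix \<sigma>
  let ?S = "{\<tau>. \<tau> permutes {1..h}}"
  have "galg_mult h (galg_mult h x y) z \<sigma> = (\<Sum>\<tau>\<in>?S. \<Sum>\<rho>\<in>?S. x \<rho> * (y (inv \<rho> \<circ> \<tau>) * z (inv \<tau> \<circ> \<sigma>)))"
    by (simp add: galg_mult_def sum_distrib_right mult.assoc)
  also have "\<dots> = (\<Sum>\<rho>\<in>?S. \<Sum>\<tau>\<in>?S. x \<rho> * (y (inv \<rho> \<circ> \<tau>) * z (inv \<tau> \<circ> \<sigma>)))"
    by (rule sum.swap)
  also have "\<dots> = (\<Sum>\<rho>\<in>?S. \<Sum>\<tau>\<in>?S. x \<rho> * (y \<tau> * z (inv \<tau> \<circ> (inv \<rho> \<circ> \<sigma>))))"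
  proof (rule sum.cong[OF refl])
    fix \<rho> assume "\<rho> \<in> ?S"
    then have \<rho>: "\<rho> permutes {1..h}" by simp
    have "(\<Sum>\<tau>\<in>?S. x \<rho> * (y (inv \<rho> \<circ> \<tau>) * z (inv \<tau> \<circ> \<sigma>))) = (\<Sum>\<tau>\<in>?S. x \<rho> * (y (inv \<rho> \<circ> (\<rho> \<circ> \<tau>)) * z (inv (\<rho> \<circ> \<tau>) \<circ> \<sigma>)))"
      by (rule setum_permutations_compose_left[OF \<rho>])
    also have "\<dots> = (\<Sum>\<tau>\<in>?S. x \<rho> * (y \<tau> * z (inv \<tau> \<circ> (inv \<rho> \<circ> \<sigma>))))"
      using permutes_inv_o(2)[OF \<rho>]
      by (intro sum.cong refl) (simp add: o_inv_distrib permutes_bij[OF \<rho>] permutes_bij comp_assoc[symmetric])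
    finally show "(\<Sum>\<tau>\<in>?S. x \<rho> * (y (inv \<rho> \<circ> \<tau>) * z (inv \<tau> \<circ> \<sigma>))) = \<dots>" .
  qed
  also have "\<dots> = galg_mult h x (galg_mult h y z) \<sigma>"
    by (simp add: galg_mult_def sum_distrib_left)
  finally show "galg_mult h (galg_mult h x y) z \<sigma> = galg_mult h x (galg_mult h y z) \<sigma>" .
qed

lemma perm_act_mult:
  assumes "\<rho> permutes {1..h}"
  shows "perm_act \<rho> (galg_mult h x y) = galg_mult h (perm_act \<rho> x) y"
proof
  fix \<sigma>
  let ?S = "{\<tau>. \<tau> permutes {1..h}}"
  have "galg_mult h (perm_act \<rho> x) y \<sigma> = (\<Sum>\<tau>\<in>?S. x (inv \<rho> \<circ> (\<rho> \<circ> \<tau>)) * y (inv (\<rho> \<circ> \<tau>) \<circ> \<sigma>))"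
    unfolding galg_mult_def perm_act_def by (rule setum_permutations_compose_left[OF assms])
  also have "\<dots> = perm_act \<rho> (galg_mult h x y) \<sigma>"
    unfolding galg_mult_def perm_act_def using permutes_inv_o(2)[OF assms]
    by (intro sum.cong refl) (simp add: o_inv_distrib permutes_bij[OF assms] permutes_bij comp_assoc[symmetric])
  finally show "perm_act \<rho> (galg_mult h x y) \<sigma> = galg_mult h (perm_act \<rho> x) y \<sigma>" ..
qed

lemma perm_act_comp:
  assumes "\<rho> permutes S" "\<tau> permutes S"
  shows "perm_act (\<rho> \<circ> \<tau>) x = perm_act \<rho> (perm_act \<tau> x)"
  using assms by (simp add: perm_act_def o_inv_distrib permutes_bij comp_assoc)

lemma galg_mult_eq_sum: "galg_mult h x y = (\<Sum>\<tau> | \<tau> permutes {1..h}. galg_scale (x \<tau>) (perm_act \<tau> y))"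
proof -
  have "(\<Sum>\<tau>\<in>T. F \<tau>) \<sigma> = (\<Sum>\<tau>\<in>T. F \<tau> \<sigma>)" for T :: "(nat \<Rightarrow> nat) set" and F :: "_ \<Rightarrow> galg" and \<sigma>
    by (induction T rule: infinite_finite_induct) simp_all
  then show ?thesis by (intro ext) (simp add: galg_mult_def galg_scale_def perm_act_def)
qed

lemma sum_galg_apply: "(\<Sum>\<tau>\<in>T. F \<tau>) \<sigma> = (\<Sum>\<tau>\<in>T. F \<tau> \<sigma>)" for F :: "'t \<Rightarrow> galg"
  by (induction T rule: infinite_finite_induct) simp_all

lemma galg_mult_scale_left: "galg_mult h (galg_scale d x) y = galg_scale d (galg_mult h x y)"
  by (rule ext) (simp add: galg_mult_def galg_scale_def sum_distrib_left mult.assoc)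

lemma galg_mult_scale_right: "galg_mult h x (galg_scale d y) = galg_scale d (galg_mult h x y)"
  by (rule ext) (simp add: galg_mult_def galg_scale_def sum_distrib_left mult.left_commute)

lemma galg_mult_add_left: "galg_mult h (x + y) z = galg_mult h x z + galg_mult h y z"
  by (rule ext) (simp add: galg_mult_def sum.distrib distrib_right)

lemma galg_mult_sum_left: "galg_mult h (\<Sum>i\<in>T. F i) z = (\<Sum>i\<in>T. galg_mult h (F i) z)"
  by (rule ext) (simp add: galg_mult_def sum_galg_apply sum_distrib_right, rule sum.swap)

declare One_nat_def [simp del]

locale young_positions = young_diagram "{1..h}" r c for h :: nat and r c :: "nat \<Rightarrow> nat"
begin

abbreviation S :: "(nat \<Rightarrow> nat) set" where "S \<equiv> {\<tau>. \<tau> permutes {1..h}}"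
abbreviation rows :: "(nat \<Rightarrow> nat) set" where "rows \<equiv> stab r {1..h}"
abbreviation cols :: "(nat \<Rightarrow> nat) set" where "cols \<equiv> stab c {1..h}"

definition row_sum :: galg where "row_sum \<sigma> = (if \<sigma> \<in> rows then 1 else 0)"
definition col_sum :: galg where "col_sum \<sigma> = (if \<sigma> \<in> cols then of_int (sign \<sigma>) else 0)"
definition symmetrizer :: galg where "symmetrizer = galg_mult h row_sum col_sum"
definition ideal :: "galg set" where "ideal = {galg_mult h x symmetrizer | x. x \<in> group_alg h}"

lemma row_sum_mult: "galg_mult h row_sum y \<sigma> = (\<Sum>p\<in>rows. y (inv p \<circ> \<sigma>))"
proof -
  have "galg_mult h row_sum y \<sigma> = (\<Sum>p\<in>S. if p \<in> rows then y (inv p \<circ> \<sigma>) else 0)"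
    unfolding galg_mult_def row_sum_def by (intro sum.cong) auto
  also have "\<dots> = (\<Sum>p\<in>S \<inter> rows. y (inv p \<circ> \<sigma>))"
    by (subst sum.inter_restrict) (auto simp: finite_permutations)
  also have "S \<inter> rows = rows" by (auto intro: stab_permutes)
  finally show ?thesis .
qed

lemma symmetrizer_apply: "symmetrizer \<sigma> = (\<Sum>p\<in>rows. col_sum (inv p \<circ> \<sigma>))"
  by (simp add: symmetrizer_def row_sum_mult)

lemma sign_stab: "\<sigma> \<in> cols \<Longrightarrow> \<tau> \<in> cols \<Longrightarrow> sign (\<sigma> \<circ> \<tau>) = sign \<sigma> * sign \<tau>"
  by (rule sign_stab_comp) auto

lemma bij_stab: "\<sigma> \<in> stab f B \<Longrightarrow> bij \<sigma>"
  by (rule permutes_bij[OF stab_permutes])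

lemma sign_cols_inv: "q \<in> cols \<Longrightarrow> sign (inv q) = sign q"
  by (rule sign_stab_inv) auto

lemma col_sum_comp:
  assumes q: "q \<in> cols"
  shows "col_sum (q \<circ> \<sigma>) = of_int (sign q) * col_sum \<sigma>"
proof -
  have "\<sigma> = inv q \<circ> (q \<circ> \<sigma>)"
    using permutes_inv_o(2)[OF stab_permutes[OF q]] by (simp flip: comp_assoc)
  then have "q \<circ> \<sigma> \<in> cols \<longleftrightarrow> \<sigma> \<in> cols"
    using stab_comp[OF q] stab_comp[OF stab_inv[OF q], of "q \<circ> \<sigma>"] by metis
  then show ?thesis by (simp add: col_sum_def sign_stab[OF q])
qed

lemma col_sum_inv: "\<sigma> permutes {1..h} \<Longrightarrow> col_sum (inv \<sigma>) = col_sum \<sigma>"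
  using stab_inv[of \<sigma> c "{1..h}"] stab_inv[of "inv \<sigma>" c "{1..h}"]
  by (auto simp: col_sum_def permutes_inv_inv sign_cols_inv)

text \<open>Von Neumann's lemma: \<open>a \<tau> b\<close> is a multiple of \<open>ab\<close>.\<close>

lemma row_perm_col:
  assumes \<tau>: "\<tau> permutes {1..h}"
  shows "\<exists>d. \<forall>\<sigma>. (\<Sum>p\<in>rows. col_sum (inv \<tau> \<circ> (inv p \<circ> \<sigma>))) = d * symmetrizer \<sigma>"
proof (cases "\<forall>x\<in>{1..h}. \<forall>y\<in>{1..h}. r x = r y \<longrightarrow> c (inv \<tau> x) = c (inv \<tau> y) \<longrightarrow> x = y")
  case True
  then obtain p0 q0 where p0: "p0 \<in> rows" and q0: "q0 \<in> cols" and \<tau>_eq: "\<tau> = p0 \<circ> q0"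
    using row_column_factorization[OF \<tau>] by metis
  have "(\<Sum>p\<in>rows. col_sum (inv \<tau> \<circ> (inv p \<circ> \<sigma>))) = of_int (sign q0) * symmetrizer \<sigma>" for \<sigma>
  proof -
    have "(\<Sum>p\<in>rows. col_sum (inv \<tau> \<circ> (inv p \<circ> \<sigma>))) = (\<Sum>p\<in>rows. col_sum (inv q0 \<circ> (inv (p \<circ> p0) \<circ> \<sigma>)))"
      unfolding \<tau>_eq
      by (intro sum.cong refl)
        (simp add: o_inv_distrib permutes_bij[OF stab_permutes[OF p0]] permutes_bij[OF stab_permutes[OF q0]] bij_stab comp_assoc)
    also have "\<dots> = (\<Sum>p\<in>rows. col_sum (inv q0 \<circ> (inv p \<circ> \<sigma>)))"
      by (rule sum_stab_comp_right[OF p0])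
    also have "\<dots> = of_int (sign q0) * symmetrizer \<sigma>"
      unfolding symmetrizer_apply sum_distrib_left
      by (intro sum.cong refl) (simp add: col_sum_comp[OF stab_inv[OF q0]] sign_cols_inv[OF q0])
    finally show ?thesis .
  qed
  then show ?thesis by blast
next
  case False
  then obtain x y where xy: "x \<in> {1..h}" "y \<in> {1..h}" "r x = r y" "c (inv \<tau> x) = c (inv \<tau> y)" "x \<noteq> y" by blast
  define t where "t = swap x y"
  define u where "u = swap (inv \<tau> x) (inv \<tau> y)"
  have t: "t \<in> rows" unfolding t_def using xy by (intro transpose_in_stab) auto
  have in_h: "inv \<tau> x \<in> {1..h}" "inv \<tau> y \<in> {1..h}"
    using xy permutes_in_image[OF permutes_inv[OF \<tau>]] by simp_all
  have u: "u \<in> cols" unfolding u_def using in_h xy by (intro transpose_in_stab) auto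
  have inv_ne: "inv \<tau> x \<noteq> inv \<tau> y" using xy(5) permutes_inverses(1)[OF \<tau>] by metis
  have sign_u: "sign u = - 1" unfolding u_def using inv_ne by (simp add: sign_swap_id)
  \<comment> \<open>Two positions of one row come from one column under \<tau>. The row sum absorbs
    \<open>t\<close> unchanged while the column sum changes sign under \<open>u\<close>, so the
    element equals its own negative.\<close>
  have tu: "t \<circ> \<tau> = \<tau> \<circ> u"
  proof
    fix z
    have "\<tau> z = w \<longleftrightarrow> z = inv \<tau> w" for w
      using permutes_inverses[OF \<tau>] by metis
    then show "(t \<circ> \<tau>) z = (\<tau> \<circ> u) z"
      by (auto simp: t_def u_def Transposition.transpose_def permutes_inverses[OF \<tau>])
  qed
  have inv_t: "inv \<tau> \<circ> inv t = inv u \<circ> inv \<tau>"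
  proof -
    have "inv (t \<circ> \<tau>) = inv \<tau> \<circ> inv t" "inv (\<tau> \<circ> u) = inv u \<circ> inv \<tau>"
      by (simp_all add: o_inv_distrib permutes_bij[OF \<tau>] permutes_bij[OF stab_permutes[OF t]] permutes_bij[OF stab_permutes[OF u]])
    then show ?thesis using tu by simp
  qed
  have "(\<Sum>p\<in>rows. col_sum (inv \<tau> \<circ> (inv p \<circ> \<sigma>))) = 0" (is "?D = 0") for \<sigma>
  proof -
    have "?D = (\<Sum>p\<in>rows. col_sum (inv \<tau> \<circ> (inv (p \<circ> t) \<circ> \<sigma>)))"
      by (rule sum_stab_comp_right[OF t, symmetric])
    also have "\<dots> = (\<Sum>p\<in>rows. col_sum (inv u \<circ> (inv \<tau> \<circ> (inv p \<circ> \<sigma>))))"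
    proof (intro sum.cong refl)
      fix p assume p: "p \<in> rows"
      have "inv \<tau> \<circ> (inv (p \<circ> t) \<circ> \<sigma>) = (inv \<tau> \<circ> inv t) \<circ> (inv p \<circ> \<sigma>)"
        by (simp add: o_inv_distrib permutes_bij[OF stab_permutes[OF t]] permutes_bij[OF stab_permutes[OF p]] comp_assoc)
      then show "col_sum (inv \<tau> \<circ> (inv (p \<circ> t) \<circ> \<sigma>)) = col_sum (inv u \<circ> (inv \<tau> \<circ> (inv p \<circ> \<sigma>)))"
        by (simp add: inv_t comp_assoc)
    qed
    also have "\<dots> = - ?D"
      by (simp add: col_sum_comp[OF stab_inv[OF u]] sign_cols_inv[OF u] sign_u sum_negf)
    finally show ?thesis by simp
  qed
  then show ?thesis by (intro exI[of _ 0]) simp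
qed

lemma row_mult_col: "\<exists>d. galg_mult h row_sum (galg_mult h x col_sum) = galg_scale d symmetrizer"
proof -
  obtain d where d: "\<And>\<tau> \<sigma>. \<tau> permutes {1..h} \<Longrightarrow> (\<Sum>p\<in>rows. col_sum (inv \<tau> \<circ> (inv p \<circ> \<sigma>))) = d \<tau> * symmetrizer \<sigma>"
    using row_perm_col by metis
  have "galg_mult h row_sum (galg_mult h x col_sum) \<sigma> = (\<Sum>\<tau>\<in>S. x \<tau> * d \<tau>) * symmetrizer \<sigma>" for \<sigma>
  proof -
    have "galg_mult h row_sum (galg_mult h x col_sum) \<sigma> = (\<Sum>p\<in>rows. \<Sum>\<tau>\<in>S. x \<tau> * col_sum (inv \<tau> \<circ> (inv p \<circ> \<sigma>)))"
      unfolding row_sum_mult by (simp add: galg_mult_def)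
    also have "\<dots> = (\<Sum>\<tau>\<in>S. \<Sum>p\<in>rows. x \<tau> * col_sum (inv \<tau> \<circ> (inv p \<circ> \<sigma>)))"
      by (rule sum.swap)
    also have "\<dots> = (\<Sum>\<tau>\<in>S. x \<tau> * (d \<tau> * symmetrizer \<sigma>))"
      by (intro sum.cong refl) (simp add: sum_distrib_left[symmetric] d)
    finally show ?thesis by (simp add: sum_distrib_right mult.assoc)
  qed
  then show ?thesis by (intro exI[of _ "\<Sum>\<tau>\<in>S. x \<tau> * d \<tau>"]) (simp add: galg_scale_def fun_eq_iff)
qed

lemma symmetrizer_id: "symmetrizer id = 1"
proof -
  have "col_sum (inv p \<circ> id) = (if p = id then 1 else 0)" if p: "p \<in> rows" for p
  proof (cases "inv p \<in> cols")
    case True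
    then have "inv p = id" using stab_Int[OF stab_inv[OF p]] by simp
    then have "p = id" using permutes_inv_inv[OF stab_permutes[OF p]] by simp
    then show ?thesis by (simp add: col_sum_def id_in_stab)
  next
    case False
    then have "p \<noteq> id" using id_in_stab[of c "{1..h}"] by auto
    with False show ?thesis by (simp add: col_sum_def)
  qed
  then have "symmetrizer id = (\<Sum>p\<in>rows. if p = id then 1 else 0)"
    unfolding symmetrizer_apply by (intro sum.cong refl) simp
  also have "\<dots> = 1" by (simp add: id_in_stab)
  finally show ?thesis .
qed

section \<open>The square of the Young symmetrizer\<close>

definition \<kappa> :: complex where "\<kappa> = of_int (symmetrizer_square r c {1..h})"

text \<open>The contributing terms correspond to relations
  \<open>q \<circ> p = p' \<circ> q'\<close>. Given \<open>q'\<close>, the permutation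
  \<open>p'\<close> is determined, and it preserves rows exactly when
  \<open>r \<circ> q \<circ> p\<close> and \<open>r \<circ> q'\<close> agree on the diagram.\<close>

lemma symmetrizer_square_coeff: "galg_mult h symmetrizer symmetrizer id = \<kappa>"
proof -
  have count: "(\<Sum>q'\<in>cols. if \<forall>x\<in>{1..h}. r (q (p x)) = r (q' x) then sign q * sign q' else 0)
      = (\<Sum>p'\<in>rows. if inv p' \<circ> q \<circ> p \<in> cols then sign q * sign (inv p' \<circ> q \<circ> p) else 0)"
    if p: "p \<in> rows" and q: "q \<in> cols" for p q
  proof -
    have bij: "g permutes {1..h}" if "g \<in> rows \<or> g \<in> cols" for g using that stab_permutes by blast
    have "(\<Sum>q'\<in>cols. if \<forall>x\<in>{1..h}. r (q (p x)) = r (q' x) then sign q * sign q' else 0)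
      = (\<Sum>q'\<in>{q'\<in>cols. \<forall>x\<in>{1..h}. r (q (p x)) = r (q' x)}. sign q * sign q')"
      by (simp add: sum.If_cases Int_def)
    also have "\<dots> = (\<Sum>p'\<in>{p'\<in>rows. inv p' \<circ> q \<circ> p \<in> cols}. sign q * sign (inv p' \<circ> q \<circ> p))"
    proof (rule sum.reindex_bij_witness[of _ "\<lambda>p'. inv p' \<circ> q \<circ> p" "\<lambda>q'. q \<circ> p \<circ> inv q'"])
      fix q' assume "q' \<in> {q' \<in> cols. \<forall>x\<in>{1..h}. r (q (p x)) = r (q' x)}"
      then have q': "q' \<in> cols" "\<And>x. x \<in> {1..h} \<Longrightarrow> r (q (p x)) = r (q' x)" by auto
      have inv: "inv (q \<circ> p \<circ> inv q') = q' \<circ> inv p \<circ> inv q"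
        using bij_stab[OF p] bij_stab[OF q] bij_stab[OF q'(1)]
        by (simp add: o_inv_distrib bij_comp bij_imp_bij_inv inv_inv_eq comp_assoc)
      show eq: "inv (q \<circ> p \<circ> inv q') \<circ> q \<circ> p = q'"
        unfolding inv using permutes_inverses(2)[OF bij, of p] permutes_inverses(2)[OF bij, of q] p q by (auto simp: fun_eq_iff)
      have "q \<circ> p \<circ> inv q' \<in> rows"
      proof (rule stabI)
        show "q \<circ> p \<circ> inv q' permutes {1..h}"
          by (intro permutes_compose permutes_inv bij) (use p q q' in auto)
        fix x assume "x \<in> {1..h}"
        then have "inv q' x \<in> {1..h}" using permutes_in_image[OF permutes_inv[OF bij, of q']] q' by auto
        then have "r (q (p (inv q' x))) = r (q' (inv q' x))" by (rule q'(2))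
        then show "r ((q \<circ> p \<circ> inv q') x) = r x"
          using permutes_inverses(1)[OF bij, of q'] q' by simp
      qed
      then show "q \<circ> p \<circ> inv q' \<in> {p' \<in> rows. inv p' \<circ> q \<circ> p \<in> cols}"
        using q' eq by simp
      show "sign q * sign (inv (q \<circ> p \<circ> inv q') \<circ> q \<circ> p) = sign q * sign q'"
        by (simp add: eq)
    next
      fix p' assume "p' \<in> {p' \<in> rows. inv p' \<circ> q \<circ> p \<in> cols}"
      then have p': "p' \<in> rows" "inv p' \<circ> q \<circ> p \<in> cols" by auto
      have inv: "inv (inv p' \<circ> q \<circ> p) = inv p \<circ> inv q \<circ> p'"
        using bij_stab[OF p] bij_stab[OF q] bij_stab[OF p'(1)]
        by (simp add: o_inv_distrib bij_comp bij_imp_bij_inv inv_inv_eq comp_assoc)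
      show "q \<circ> p \<circ> inv (inv p' \<circ> q \<circ> p) = p'"
        unfolding inv using permutes_inverses(1)[OF bij, of p] permutes_inverses(1)[OF bij, of q] p q by (auto simp: fun_eq_iff)
      show "inv p' \<circ> q \<circ> p \<in> {q' \<in> cols. \<forall>x\<in>{1..h}. r (q (p x)) = r (q' x)}"
        using p' stab_apply[OF stab_inv[OF p'(1)]] by auto
    qed
    also have "\<dots> = (\<Sum>p'\<in>rows. if inv p' \<circ> q \<circ> p \<in> cols then sign q * sign (inv p' \<circ> q \<circ> p) else 0)"
      by (simp add: sum.If_cases Int_def)
    finally show ?thesis .
  qed
  have "\<kappa> = (\<Sum>p\<in>rows. \<Sum>q\<in>cols. \<Sum>p'\<in>rows. of_int (sign q) * col_sum (inv p' \<circ> q \<circ> p))"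
    unfolding \<kappa>_def symmetrizer_square_def by (auto simp: count col_sum_def intro!: sum.cong)
  also have "\<dots> = (\<Sum>p\<in>rows. \<Sum>q\<in>cols. of_int (sign q) * symmetrizer (q \<circ> p))"
    by (simp add: symmetrizer_apply sum_distrib_left comp_assoc)
  also have "\<dots> = (\<Sum>p\<in>rows. \<Sum>q\<in>cols. of_int (sign (inv q)) * symmetrizer (inv q \<circ> inv p))"
    unfolding sum_stab_inv[of "\<lambda>q. of_int (sign q) * symmetrizer (q \<circ> inv _)"]
    by (rule sum_stab_inv[symmetric])
  finally have \<kappa>: "\<kappa> = (\<Sum>p\<in>rows. \<Sum>q\<in>cols. of_int (sign (inv q)) * symmetrizer (inv q \<circ> inv p))" .
  have "galg_mult h symmetrizer symmetrizer id = galg_mult h row_sum (galg_mult h col_sum symmetrizer) id"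
    by (simp add: symmetrizer_def galg_mult_assoc)
  also have "\<dots> = (\<Sum>p\<in>rows. \<Sum>q\<in>S. col_sum q * symmetrizer (inv q \<circ> inv p))"
    unfolding row_sum_mult by (simp add: galg_mult_def)
  also have "\<dots> = (\<Sum>p\<in>rows. \<Sum>q\<in>cols. of_int (sign (inv q)) * symmetrizer (inv q \<circ> inv p))"
  proof (rule sum.cong[OF refl])
    fix p
    have "(\<Sum>q\<in>S. col_sum q * symmetrizer (inv q \<circ> inv p)) = (\<Sum>q\<in>cols. col_sum q * symmetrizer (inv q \<circ> inv p))"
      by (rule sum.mono_neutral_right) (auto simp: finite_permutations col_sum_def intro: stab_permutes)
    also have "\<dots> = (\<Sum>q\<in>cols. of_int (sign (inv q)) * symmetrizer (inv q \<circ> inv p))"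
      by (intro sum.cong refl) (simp add: col_sum_def sign_cols_inv)
    finally show "(\<Sum>q\<in>S. col_sum q * symmetrizer (inv q \<circ> inv p)) = \<dots>" .
  qed
  finally show ?thesis using \<kappa> by simp
qed

text \<open>\<open>row_mult_col\<close> makes the square a multiple of the symmetrizer; the factor
  is read off at the identity, where the symmetrizer is 1.\<close>

lemma symmetrizer_mult: "galg_mult h symmetrizer symmetrizer = galg_scale \<kappa> symmetrizer"
proof -
  obtain d where d: "galg_mult h row_sum (galg_mult h (galg_mult h col_sum row_sum) col_sum) = galg_scale d symmetrizer"
    using row_mult_col by blast
  have eq: "galg_mult h symmetrizer symmetrizer = galg_scale d symmetrizer"
    using d by (simp add: symmetrizer_def galg_mult_assoc)
  from fun_cong[OF this, of id] have "\<kappa> = d"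
    by (simp add: symmetrizer_square_coeff galg_scale_def symmetrizer_id)
  then show ?thesis using eq by simp
qed

lemma \<kappa>_eq: "\<kappa> = (\<Prod>x\<in>{1..h}. of_nat (hook_card r c {1..h} x))"
  unfolding \<kappa>_def symmetrizer_square_eq_hooks[OF young_diagram_axioms] by simp

lemma \<kappa>_nonzero: "\<kappa> \<noteq> 0"
proof -
  have "hook_card r c {1..h} x \<noteq> 0" if "x \<in> {1..h}" for x
    unfolding hook_card_def using that by auto
  then show ?thesis unfolding \<kappa>_eq by simp
qed

text \<open>This is \<kappa> times the character of \<open>ideal\<close>, as
  \<open>trace_on_ideal\<close> shows. It is also the scalar by which the sum over all conjugates of
  \<sigma> acts on the ideal.\<close>

definition \<zeta> :: "(nat \<Rightarrow> nat) \<Rightarrow> complex" where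
  "\<zeta> \<sigma> = (\<Sum>g\<in>S. symmetrizer (g \<circ> inv \<sigma> \<circ> inv g))"

text \<open>In effect the character is real. Inversion preserves the row and column sums but
  reverses their order; conjugation by the row permutation restores it.\<close>

lemma symmetrizer_conj_inv:
  assumes "\<sigma> permutes {1..h}"
  shows "(\<Sum>g\<in>S. symmetrizer (g \<circ> inv \<sigma> \<circ> inv g)) = (\<Sum>g\<in>S. symmetrizer (g \<circ> \<sigma> \<circ> inv g))"
proof -
  have "(\<Sum>g\<in>S. symmetrizer (g \<circ> inv \<sigma> \<circ> inv g)) = (\<Sum>p\<in>rows. \<Sum>g\<in>S. col_sum (inv p \<circ> (g \<circ> inv \<sigma> \<circ> inv g)))"
    unfolding symmetrizer_apply by (rule sum.swap)
  also have "\<dots> = (\<Sum>p\<in>rows. \<Sum>g\<in>S. col_sum (inv (inv p) \<circ> (g \<circ> \<sigma> \<circ> inv g)))"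
  proof (rule sum.cong[OF refl])
    fix p assume p: "p \<in> rows"
    have pp: "p permutes {1..h}" by (rule stab_permutes[OF p])
    have "(\<Sum>g\<in>S. col_sum (inv p \<circ> (g \<circ> inv \<sigma> \<circ> inv g))) = (\<Sum>g\<in>S. col_sum (g \<circ> \<sigma> \<circ> inv g \<circ> p))"
    proof (rule sum.cong[OF refl])
      fix g assume "g \<in> S"
      then have g: "g permutes {1..h}" by simp
      have "inv (g \<circ> \<sigma> \<circ> inv g \<circ> p) = inv p \<circ> (g \<circ> inv \<sigma> \<circ> inv g)"
        using permutes_bij[OF g] permutes_bij[OF assms] permutes_bij[OF pp]
        by (simp add: o_inv_distrib bij_comp bij_imp_bij_inv inv_inv_eq comp_assoc)
      moreover have "g \<circ> \<sigma> \<circ> inv g \<circ> p permutes {1..h}"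
        by (intro permutes_compose permutes_inv g assms pp)
      ultimately show "col_sum (inv p \<circ> (g \<circ> inv \<sigma> \<circ> inv g)) = col_sum (g \<circ> \<sigma> \<circ> inv g \<circ> p)"
        using col_sum_inv by metis
    qed
    also have "\<dots> = (\<Sum>g\<in>S. col_sum ((p \<circ> g) \<circ> \<sigma> \<circ> inv (p \<circ> g) \<circ> p))"
      by (rule setum_permutations_compose_left[OF pp])
    also have "\<dots> = (\<Sum>g\<in>S. col_sum (inv (inv p) \<circ> (g \<circ> \<sigma> \<circ> inv g)))"
    proof (rule sum.cong[OF refl])
      fix g assume "g \<in> S"
      then have g: "g permutes {1..h}" by simp
      have "(p \<circ> g) \<circ> \<sigma> \<circ> inv (p \<circ> g) \<circ> p = inv (inv p) \<circ> (g \<circ> \<sigma> \<circ> inv g)"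
        using permutes_bij[OF g] permutes_bij[OF pp] permutes_inv_o(2)[OF pp]
        by (simp add: o_inv_distrib inv_inv_eq comp_assoc)
      then show "col_sum ((p \<circ> g) \<circ> \<sigma> \<circ> inv (p \<circ> g) \<circ> p) = col_sum (inv (inv p) \<circ> (g \<circ> \<sigma> \<circ> inv g))"
        by simp
    qed
    finally show "(\<Sum>g\<in>S. col_sum (inv p \<circ> (g \<circ> inv \<sigma> \<circ> inv g))) = (\<Sum>g\<in>S. col_sum (inv (inv p) \<circ> (g \<circ> \<sigma> \<circ> inv g)))" .
  qed
  also have "\<dots> = (\<Sum>p\<in>rows. \<Sum>g\<in>S. col_sum (inv p \<circ> (g \<circ> \<sigma> \<circ> inv g)))"
    by (rule sum_stab_inv)
  also have "\<dots> = (\<Sum>g\<in>S. symmetrizer (g \<circ> \<sigma> \<circ> inv g))"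
    unfolding symmetrizer_apply by (rule sum.swap)
  finally show ?thesis .
qed

lemma \<zeta>_inv: "\<sigma> permutes {1..h} \<Longrightarrow> \<zeta> (inv \<sigma>) = \<zeta> \<sigma>"
  unfolding \<zeta>_def using symmetrizer_conj_inv[of \<sigma>] by (simp add: permutes_inv_inv)

text \<open>The action of the sum of all conjugates of \<sigma>, counted with multiplicity, which is
  central in the group algebra.\<close>

definition conj_sum :: "(nat \<Rightarrow> nat) \<Rightarrow> galg \<Rightarrow> galg" where
  "conj_sum \<sigma> y = (\<Sum>g\<in>S. perm_act (g \<circ> \<sigma> \<circ> inv g) y)"

lemma conj_sum_mult:
  assumes "\<sigma> permutes {1..h}"
  shows "conj_sum \<sigma> (galg_mult h x y) = galg_mult h (conj_sum \<sigma> x) y"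
  unfolding conj_sum_def galg_mult_sum_left
  by (intro sum.cong refl perm_act_mult permutes_compose permutes_inv assms) auto

lemma conj_sum_central:
  assumes \<sigma>: "\<sigma> permutes {1..h}"
  shows "conj_sum \<sigma> (galg_mult h x y) = galg_mult h x (conj_sum \<sigma> y)"
proof
  fix s
  have inv_conj: "inv (g \<circ> \<sigma> \<circ> inv g) = g \<circ> inv \<sigma> \<circ> inv g" if "g permutes {1..h}" for g
    using permutes_bij[OF that] permutes_bij[OF \<sigma>]
    by (simp add: o_inv_distrib bij_comp bij_imp_bij_inv inv_inv_eq comp_assoc)
  have "conj_sum \<sigma> (galg_mult h x y) s = (\<Sum>g\<in>S. \<Sum>\<rho>\<in>S. x \<rho> * y (inv \<rho> \<circ> (inv (g \<circ> \<sigma> \<circ> inv g) \<circ> s)))"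
    by (simp add: conj_sum_def sum_galg_apply perm_act_def galg_mult_def)
  also have "\<dots> = (\<Sum>\<rho>\<in>S. \<Sum>g\<in>S. x \<rho> * y (inv \<rho> \<circ> (inv (g \<circ> \<sigma> \<circ> inv g) \<circ> s)))"
    by (rule sum.swap)
  also have "\<dots> = (\<Sum>\<rho>\<in>S. \<Sum>g\<in>S. x \<rho> * y (inv (g \<circ> \<sigma> \<circ> inv g) \<circ> (inv \<rho> \<circ> s)))"
  proof (rule sum.cong[OF refl])
    fix \<rho> assume "\<rho> \<in> S"
    then have \<rho>: "\<rho> permutes {1..h}" by simp
    have "(\<Sum>g\<in>S. x \<rho> * y (inv \<rho> \<circ> (inv (g \<circ> \<sigma> \<circ> inv g) \<circ> s)))
      = (\<Sum>g\<in>S. x \<rho> * y (inv \<rho> \<circ> (inv ((\<rho> \<circ> g) \<circ> \<sigma> \<circ> inv (\<rho> \<circ> g)) \<circ> s)))"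
      by (rule setum_permutations_compose_left[OF \<rho>])
    also have "\<dots> = (\<Sum>g\<in>S. x \<rho> * y (inv (g \<circ> \<sigma> \<circ> inv g) \<circ> (inv \<rho> \<circ> s)))"
    proof (rule sum.cong[OF refl])
      fix g assume "g \<in> S"
      then have g: "g permutes {1..h}" by simp
      have "inv \<rho> \<circ> (inv ((\<rho> \<circ> g) \<circ> \<sigma> \<circ> inv (\<rho> \<circ> g)) \<circ> s) = inv (g \<circ> \<sigma> \<circ> inv g) \<circ> (inv \<rho> \<circ> s)"
      proof -
        have "inv ((\<rho> \<circ> g) \<circ> \<sigma> \<circ> inv (\<rho> \<circ> g)) = \<rho> \<circ> (g \<circ> inv \<sigma> \<circ> inv g \<circ> inv \<rho>)"
          unfolding inv_conj[OF permutes_compose[OF g \<rho>]]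
          using permutes_bij[OF g] permutes_bij[OF \<rho>] by (simp add: o_inv_distrib comp_assoc)
        then show ?thesis
          unfolding inv_conj[OF g] using permutes_inv_o(2)[OF \<rho>] by (metis comp_assoc id_comp)
      qed
      then show "x \<rho> * y (inv \<rho> \<circ> (inv ((\<rho> \<circ> g) \<circ> \<sigma> \<circ> inv (\<rho> \<circ> g)) \<circ> s)) = x \<rho> * y (inv (g \<circ> \<sigma> \<circ> inv g) \<circ> (inv \<rho> \<circ> s))"
        by simp
    qed
    finally show "(\<Sum>g\<in>S. x \<rho> * y (inv \<rho> \<circ> (inv (g \<circ> \<sigma> \<circ> inv g) \<circ> s))) = \<dots>" .
  qed
  also have "\<dots> = galg_mult h x (conj_sum \<sigma> y) s"
    by (simp add: conj_sum_def sum_galg_apply perm_act_def galg_mult_def sum_distrib_left)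
  finally show "conj_sum \<sigma> (galg_mult h x y) s = galg_mult h x (conj_sum \<sigma> y) s" .
qed

text \<open>Schur's lemma for the class sum: multiplied by the symmetrizer on the left, the result
  is a multiple of the symmetrizer by \<open>row_mult_col\<close>. By centrality it is also \<kappa>
  times the class sum acting on the symmetrizer. Since \<kappa> is nonzero, the scalar can be read
  off at the identity.\<close>

lemma conj_sum_symmetrizer:
  assumes \<sigma>: "\<sigma> permutes {1..h}"
  shows "conj_sum \<sigma> symmetrizer = galg_scale (\<zeta> \<sigma>) symmetrizer"
proof -
  have "galg_mult h symmetrizer (conj_sum \<sigma> symmetrizer)
      = galg_mult h row_sum (galg_mult h (galg_mult h col_sum (conj_sum \<sigma> row_sum)) col_sum)"
    by (simp add: symmetrizer_def conj_sum_mult[OF \<sigma>] galg_mult_assoc)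
  then obtain d where "galg_mult h symmetrizer (conj_sum \<sigma> symmetrizer) = galg_scale d symmetrizer"
    using row_mult_col by metis
  then have "conj_sum \<sigma> (galg_scale \<kappa> symmetrizer) = galg_scale d symmetrizer"
    by (simp add: conj_sum_central[OF \<sigma>, symmetric] symmetrizer_mult)
  then have d: "\<kappa> * conj_sum \<sigma> symmetrizer s = d * symmetrizer s" for s
    by (auto simp: conj_sum_def sum_galg_apply perm_act_def galg_scale_def fun_eq_iff sum_distrib_left)
  have "conj_sum \<sigma> symmetrizer id = \<zeta> \<sigma>"
    unfolding conj_sum_def sum_galg_apply perm_act_def \<zeta>_def
    by (intro sum.cong refl arg_cong[where f = symmetrizer])
      (simp add: o_inv_distrib permutes_bij[OF \<sigma>] permutes_bij bij_comp bij_imp_bij_inv inv_inv_eq comp_assoc)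
  then have "d = \<kappa> * \<zeta> \<sigma>" using d[of id] by (simp add: symmetrizer_id)
  then show ?thesis using d \<kappa>_nonzero by (simp add: fun_eq_iff galg_scale_def)
qed

lemma conj_sum_ideal:
  assumes "\<sigma> permutes {1..h}" "v \<in> ideal"
  shows "conj_sum \<sigma> v = galg_scale (\<zeta> \<sigma>) v"
  using assms(2) unfolding ideal_def
  by (auto simp: conj_sum_central[OF assms(1)] conj_sum_symmetrizer[OF assms(1)] galg_mult_scale_right)

section \<open>The left ideal as a representation and its character\<close>

lemma idealI: "x \<in> group_alg h \<Longrightarrow> galg_mult h x symmetrizer \<in> ideal"
  by (auto simp: ideal_def)

lemma subspace_ideal: "galg.subspace ideal"
proof (rule galg.subspaceI)
  have "galg_mult h 0 symmetrizer = 0" by (simp add: galg_mult_def fun_eq_iff)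
  moreover have "0 \<in> group_alg h" by (simp add: group_alg_def)
  ultimately show "0 \<in> ideal" using idealI[of 0] by simp
  show "x + y \<in> ideal" if xy: "x \<in> ideal" "y \<in> ideal" for x y
  proof -
    obtain x' y' where "x = galg_mult h x' symmetrizer" "y = galg_mult h y' symmetrizer" "x' \<in> group_alg h" "y' \<in> group_alg h"
      using xy by (auto simp: ideal_def)
    moreover have "x' + y' \<in> group_alg h" using calculation by (simp add: group_alg_def)
    ultimately show ?thesis using idealI[of "x' + y'"] by (simp only: galg_mult_add_left)
  qed
  show "galg_scale d x \<in> ideal" if x: "x \<in> ideal" for d x
  proof -
    obtain x' where "x = galg_mult h x' symmetrizer" "x' \<in> group_alg h"
      using x by (auto simp: ideal_def)
    moreover have "galg_scale d x' \<in> group_alg h" using calculation by (simp add: group_alg_def galg_scale_def)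
    ultimately show ?thesis using idealI[of "galg_scale d x'"] by (simp only: galg_mult_scale_left)
  qed
qed

lemma perm_act_group_alg:
  assumes "\<sigma> permutes {1..h}" "x \<in> group_alg h"
  shows "perm_act \<sigma> x \<in> group_alg h"
  unfolding group_alg_def
proof (intro CollectI allI impI)
  fix \<tau> assume "\<not> \<tau> permutes {1..h}"
  moreover have "\<tau> = \<sigma> \<circ> (inv \<sigma> \<circ> \<tau>)" using permutes_inv_o(1)[OF assms(1)] by (simp flip: comp_assoc)
  ultimately have "\<not> inv \<sigma> \<circ> \<tau> permutes {1..h}" using permutes_compose[OF _ assms(1)] by metis
  then show "perm_act \<sigma> x \<tau> = 0" using assms(2) by (simp add: perm_act_def group_alg_def)
qed

lemma perm_act_ideal: "\<sigma> permutes {1..h} \<Longrightarrow> x \<in> ideal \<Longrightarrow> perm_act \<sigma> x \<in> ideal"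
  unfolding ideal_def using perm_act_mult perm_act_group_alg by blast

lemma symmetrizer_in_ideal: "symmetrizer \<in> ideal"
proof -
  let ?d = "\<lambda>\<sigma>. if \<sigma> = id then 1 else 0 :: complex"
  have "galg_mult h ?d symmetrizer \<sigma> = symmetrizer \<sigma>" for \<sigma>
  proof -
    have "galg_mult h ?d symmetrizer \<sigma> = (\<Sum>\<tau>\<in>S. if \<tau> = id then symmetrizer \<sigma> else 0)"
      unfolding galg_mult_def by (intro sum.cong refl) auto
    then show ?thesis by (simp add: finite_permutations permutes_id)
  qed
  then have "galg_mult h ?d symmetrizer = symmetrizer" by (rule ext)
  moreover have "?d \<in> group_alg h" by (auto simp: group_alg_def permutes_id)
  ultimately show ?thesis using idealI[of ?d] by simp
qed

lemma ideal_mult: "b \<in> ideal \<Longrightarrow> galg_mult h b symmetrizer = galg_scale \<kappa> b"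
  unfolding ideal_def by (auto simp: galg_mult_assoc symmetrizer_mult galg_mult_scale_right)

lemma ideal_group_alg:
  assumes "x \<in> ideal"
  shows "x \<in> group_alg h"
proof -
  obtain y where x: "x = galg_mult h y symmetrizer" using assms by (auto simp: ideal_def)
  have sym: "symmetrizer \<in> group_alg h"
    unfolding group_alg_def
  proof (intro CollectI allI impI)
    fix \<tau> assume "\<not> \<tau> permutes {1..h}"
    have "col_sum (inv p \<circ> \<tau>) = 0" if p: "p \<in> rows" for p
    proof -
      have "\<tau> = p \<circ> (inv p \<circ> \<tau>)" using permutes_inv_o(1)[OF stab_permutes[OF p]] by (simp flip: comp_assoc)
      then have "inv p \<circ> \<tau> \<notin> cols"
        using \<open>\<not> \<tau> permutes {1..h}\<close> permutes_compose[OF _ stab_permutes[OF p]] stab_permutes by metis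
      then show ?thesis by (simp add: col_sum_def)
    qed
    then show "symmetrizer \<tau> = 0" by (simp add: symmetrizer_apply)
  qed
  have "perm_act \<tau> symmetrizer \<sigma> = 0" if "\<tau> permutes {1..h}" "\<not> \<sigma> permutes {1..h}" for \<tau> \<sigma>
    using perm_act_group_alg[OF that(1) sym] that(2) by (simp add: group_alg_def)
  then show ?thesis
    by (auto simp: x galg_mult_eq_sum group_alg_def sum_galg_apply galg_scale_def intro!: sum.neutral)
qed

text \<open>\<open>\<kappa>\<close> times the trace of \<open>\<sigma>\<close> on the left ideal is the trace of \<open>y \<mapsto> \<sigma> y \<cdot> symmetrizer\<close> on the group algebra.\<close>

lemma trace_on_ideal:
  assumes \<sigma>: "\<sigma> permutes {1..h}"
  shows "\<kappa> * trace_on ideal (perm_act \<sigma>) = \<zeta> \<sigma>"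
proof -
  define B where "B = (SOME B. galg.independent B \<and> galg.span B = ideal)"
  obtain B0 where "B0 \<subseteq> ideal" "galg.independent B0" "ideal \<subseteq> galg.span B0"
    using galg.basis_exists[of ideal] by metis
  then have "galg.independent B0 \<and> galg.span B0 = ideal"
    using galg.span_minimal[OF _ subspace_ideal] by blast
  then have B: "galg.independent B" "galg.span B = ideal"
    using someI[of "\<lambda>B. galg.independent B \<and> galg.span B = ideal"] unfolding B_def by blast+
  have B_ideal: "b \<in> ideal" if "b \<in> B" for b using galg.span_base[OF that] B(2) by simp
  define \<delta> :: "(nat \<Rightarrow> nat) \<Rightarrow> galg" where "\<delta> \<tau> = (\<lambda>\<sigma>. if \<sigma> = \<tau> then 1 else 0)" for \<tau>
  \<comment> \<open>This bounds the size of \<open>B\<close>; the sum in \<open>trace_on\<close>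
    over an infinite set would be 0 by convention.\<close>
  have "x \<in> galg.span (\<delta> ` S)" if "x \<in> group_alg h" for x
  proof -
    have "x \<sigma> = (\<Sum>\<tau>\<in>S. galg_scale (x \<tau>) (\<delta> \<tau>)) \<sigma>" for \<sigma>
    proof -
      have "(\<Sum>\<tau>\<in>S. galg_scale (x \<tau>) (\<delta> \<tau>)) \<sigma> = (\<Sum>\<tau>\<in>S. if \<tau> = \<sigma> then x \<sigma> else 0)"
        unfolding sum_galg_apply by (intro sum.cong refl) (auto simp: galg_scale_def \<delta>_def)
      then show ?thesis using that by (simp add: finite_permutations group_alg_def)
    qed
    then have "x = (\<Sum>\<tau>\<in>S. galg_scale (x \<tau>) (\<delta> \<tau>))" by (rule ext)
    moreover have "(\<Sum>\<tau>\<in>S. galg_scale (x \<tau>) (\<delta> \<tau>)) \<in> galg.span (\<delta> ` S)"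
      by (intro galg.span_sum galg.span_scale galg.span_base) auto
    ultimately show ?thesis by simp
  qed
  then have "B \<subseteq> galg.span (\<delta> ` S)" using B_ideal ideal_group_alg by blast
  then have finB: "finite B"
    using galg.independent_span_bound[OF finite_imageI[OF finite_permutations[OF finite_atLeastAtMost]] B(1)] by blast
  define R where "R = galg.representation B"
  define G where "G \<tau> = perm_act (\<sigma> \<circ> \<tau>) symmetrizer" for \<tau>
  have G_ideal: "G \<tau> \<in> ideal" if "\<tau> \<in> S" for \<tau>
    unfolding G_def using that by (intro perm_act_ideal symmetrizer_in_ideal permutes_compose \<sigma>) auto
  have "\<kappa> * R (perm_act \<sigma> b) b = (\<Sum>\<tau>\<in>S. b \<tau> * R (G \<tau>) b)" if b: "b \<in> B" for b
  proof -
    have "galg_scale \<kappa> (perm_act \<sigma> b) = galg_mult h (perm_act \<sigma> b) symmetrizer"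
      using ideal_mult[OF perm_act_ideal[OF \<sigma> B_ideal[OF b]]] by simp
    also have "\<dots> = perm_act \<sigma> (galg_mult h b symmetrizer)" by (rule perm_act_mult[OF \<sigma>, symmetric])
    also have "\<dots> = (\<Sum>\<tau>\<in>S. galg_scale (b \<tau>) (G \<tau>))"
      unfolding galg_mult_eq_sum G_def using \<sigma>
      by (intro ext) (simp add: perm_act_comp[of _ "{1..h}"] sum_galg_apply perm_act_def[of \<sigma>] galg_scale_def)
    finally have eq: "galg_scale \<kappa> (perm_act \<sigma> b) = (\<Sum>\<tau>\<in>S. galg_scale (b \<tau>) (G \<tau>))" .
    have "\<kappa> * R (perm_act \<sigma> b) b = R (galg_scale \<kappa> (perm_act \<sigma> b)) b"
      unfolding R_def using galg.representation_scale[OF B(1)] perm_act_ideal[OF \<sigma> B_ideal[OF b]] B(2) by metis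
    also have "\<dots> = (\<Sum>\<tau>\<in>S. R (galg_scale (b \<tau>) (G \<tau>)) b)"
      unfolding eq R_def using galg.subspace_scale[OF subspace_ideal] G_ideal
      by (subst galg.representation_sum[OF B(1)]) (auto simp: B(2))
    also have "\<dots> = (\<Sum>\<tau>\<in>S. b \<tau> * R (G \<tau>) b)"
      unfolding R_def using galg.representation_scale[OF B(1)] G_ideal B(2) by (intro sum.cong refl) metis
    finally show ?thesis .
  qed
  then have "\<kappa> * trace_on ideal (perm_act \<sigma>) = (\<Sum>b\<in>B. \<Sum>\<tau>\<in>S. b \<tau> * R (G \<tau>) b)"
    unfolding trace_on_def Let_def B_def[symmetric] R_def[symmetric] sum_distrib_left by (intro sum.cong refl)
  also have "\<dots> = (\<Sum>\<tau>\<in>S. \<Sum>b\<in>B. b \<tau> * R (G \<tau>) b)"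
    by (rule sum.swap)
  \<comment> \<open>For each \<tau> the inner sum is the expansion of \<open>G \<tau>\<close> in the
    basis \<open>B\<close>, evaluated at \<tau>. This trades the unknown basis for the basis of
    permutations.\<close>
  also have "\<dots> = (\<Sum>\<tau>\<in>S. G \<tau> \<tau>)"
  proof (rule sum.cong[OF refl])
    fix \<tau> assume "\<tau> \<in> S"
    then have "(\<Sum>b\<in>B. galg_scale (R (G \<tau>) b) b) = G \<tau>"
      unfolding R_def using G_ideal B finB by (intro galg.sum_representation_eq) auto
    from fun_cong[OF this, of \<tau>] show "(\<Sum>b\<in>B. b \<tau> * R (G \<tau>) b) = G \<tau> \<tau>"
      by (simp add: sum_galg_apply galg_scale_def mult.commute)
  qed
  also have "\<dots> = (\<Sum>\<tau>\<in>S. symmetrizer (inv \<tau> \<circ> inv \<sigma> \<circ> \<tau>))"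
    unfolding G_def perm_act_def
    by (intro sum.cong refl arg_cong[where f = symmetrizer]) (simp add: o_inv_distrib permutes_bij[OF \<sigma>] permutes_bij)
  also have "\<dots> = (\<Sum>\<tau>\<in>S. symmetrizer (inv (inv \<tau>) \<circ> inv \<sigma> \<circ> inv \<tau>))"
    by (rule sum_permutations_inverse)
  also have "\<dots> = \<zeta> \<sigma>"
    unfolding \<zeta>_def by (intro sum.cong refl) (auto simp: permutes_inv_inv)
  finally show ?thesis .
qed

end

section \<open>Partitions and compositions\<close>

declare One_nat_def [simp]

section \<open>The diagram of a partition in row reading order\<close>

lemma cells_snoc: "cells (\<mu> @ [m]) = cells \<mu> \<union> (\<lambda>j. (Suc (length \<mu>), j)) ` {1..m}"
  by (auto simp: cells_def nth_append le_Suc_eq split: if_splits)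

lemma row_reading_bij: "bij_betw (row_reading \<mu>) (cells \<mu>) {1..sum_list \<mu>}"
proof (induction \<mu> rule: rev_induct)
  case Nil
  have "cells [] = {}" by (auto simp: cells_def)
  then show ?case by (simp add: bij_betw_def)
next
  case (snoc m \<mu>)
  let ?new = "(\<lambda>j. (Suc (length \<mu>), j)) ` {1..m}"
  have 1: "bij_betw (row_reading (\<mu> @ [m])) (cells \<mu>) {1..sum_list \<mu>}"
    by (rule bij_betw_cong[THEN iffD1, OF _ snoc]) (auto simp: row_reading_def cells_def)
  have 2: "bij_betw (row_reading (\<mu> @ [m])) ?new {Suc (sum_list \<mu>)..sum_list \<mu> + m}"
  proof (rule bij_betw_byWitness[where f' = "\<lambda>x. (Suc (length \<mu>), x - sum_list \<mu>)"])
    show "(\<lambda>x. (Suc (length \<mu>), x - sum_list \<mu>)) ` {Suc (sum_list \<mu>)..sum_list \<mu> + m} \<subseteq> ?new"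
      by (auto simp: image_iff)
  qed (auto simp: row_reading_def)
  have "{1..sum_list (\<mu> @ [m])} = {1..sum_list \<mu>} \<union> {Suc (sum_list \<mu>)..sum_list \<mu> + m}" by auto
  then show ?case
    unfolding cells_snoc using bij_betw_combine[OF 1 2] by auto
qed

definition cell_of :: "nat list \<Rightarrow> nat \<Rightarrow> nat \<times> nat" where
  "cell_of \<mu> = the_inv_into (cells \<mu>) (row_reading \<mu>)"

definition row_of :: "nat list \<Rightarrow> nat \<Rightarrow> nat" where "row_of \<mu> x = fst (cell_of \<mu> x)"
definition column_of :: "nat list \<Rightarrow> nat \<Rightarrow> nat" where "column_of \<mu> x = snd (cell_of \<mu> x)"

lemma cell_of_bij: "bij_betw (cell_of \<mu>) {1..sum_list \<mu>} (cells \<mu>)"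
  unfolding cell_of_def by (rule bij_betw_the_inv_into[OF row_reading_bij])

lemma cell_of_row_reading: "x \<in> cells \<mu> \<Longrightarrow> cell_of \<mu> (row_reading \<mu> x) = x"
  unfolding cell_of_def using row_reading_bij by (simp add: the_inv_into_f_f bij_betw_def)

lemma row_reading_cell_of: "x \<in> {1..sum_list \<mu>} \<Longrightarrow> row_reading \<mu> (cell_of \<mu> x) = x"
  unfolding cell_of_def using row_reading_bij by (simp add: f_the_inv_into_f bij_betw_def)

lemma cell_of_eq: "cell_of \<mu> x = (row_of \<mu> x, column_of \<mu> x)"
  by (simp add: row_of_def column_of_def)

lemma young_positions_partition:
  assumes "partition_of \<mu> h"
  shows "young_positions h (row_of \<mu>) (column_of \<mu>)"
proof -
  have h: "h = sum_list \<mu>" and sorted: "sorted_wrt (\<ge>) \<mu>" using assms by (auto simp: partition_of_def)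
  have cell: "cell_of \<mu> x \<in> cells \<mu>" if "x \<in> {1..h}" for x
    using that bij_betwE[OF cell_of_bij] h by blast
  show ?thesis
  proof
    fix x y assume xy: "x \<in> {1..h}" "y \<in> {1..h}" "row_of \<mu> x = row_of \<mu> y" "column_of \<mu> x = column_of \<mu> y"
    then have "cell_of \<mu> x = cell_of \<mu> y" by (simp add: cell_of_eq)
    then show "x = y" using xy row_reading_cell_of h by metis
  next
    fix x assume "x \<in> {1..h}"
    then show "1 \<le> row_of \<mu> x \<and> 1 \<le> column_of \<mu> x"
      using cell[of x] unfolding cell_of_eq by (auto simp: cells_def)
  next
    fix x i j assume x: "x \<in> {1..h}" "1 \<le> i" "i \<le> row_of \<mu> x" "1 \<le> j" "j \<le> column_of \<mu> x"
    have "(row_of \<mu> x, column_of \<mu> x) \<in> cells \<mu>" using cell[OF x(1)] by (simp add: cell_of_eq)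
    then have *: "row_of \<mu> x \<le> length \<mu>" "column_of \<mu> x \<le> \<mu> ! (row_of \<mu> x - 1)" by (auto simp: cells_def)
    have "\<mu> ! (row_of \<mu> x - 1) \<le> \<mu> ! (i - 1)"
    proof (cases "i = row_of \<mu> x")
      case False
      then show ?thesis using sorted_wrt_nth_less[OF sorted, of "i - 1" "row_of \<mu> x - 1"] x * by auto
    qed simp
    then have ij: "(i, j) \<in> cells \<mu>" using x * by (auto simp: cells_def)
    then show "\<exists>y\<in>{1..h}. row_of \<mu> y = i \<and> column_of \<mu> y = j"
      using bij_betwE[OF row_reading_bij] cell_of_row_reading[OF ij] h
      by (intro bexI[of _ "row_reading \<mu> (i, j)"]) (auto simp: row_of_def column_of_def)
  qed simp
qed

lemma ball_cells:
  "(\<forall>x\<in>cells \<mu>. P x) \<longleftrightarrow> (\<forall>x\<in>{1..sum_list \<mu>}. P (cell_of \<mu> x))"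
  by (simp add: bij_betw_imp_surj_on[OF cell_of_bij, symmetric] del: One_nat_def)

lemma row_group_eq: "row_group \<mu> = stab (row_of \<mu>) {1..sum_list \<mu>}"
proof -
  have "(\<forall>(i, j)\<in>cells \<mu>. \<exists>j'. (i, j') \<in> cells \<mu> \<and> \<sigma> (row_reading \<mu> (i, j)) = row_reading \<mu> (i, j'))
     \<longleftrightarrow> (\<forall>x\<in>{1..sum_list \<mu>}. row_of \<mu> (\<sigma> x) = row_of \<mu> x)" if \<sigma>: "\<sigma> permutes {1..sum_list \<mu>}" for \<sigma>
    unfolding ball_cells
  proof (intro ball_cong refl)
    fix x assume x: "x \<in> {1..sum_list \<mu>}"
    then have \<sigma>x: "\<sigma> x \<in> {1..sum_list \<mu>}" using permutes_in_image[OF \<sigma>] by simp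
    show "(case cell_of \<mu> x of (i, j) \<Rightarrow> \<exists>j'. (i, j') \<in> cells \<mu> \<and> \<sigma> (row_reading \<mu> (i, j)) = row_reading \<mu> (i, j'))
      \<longleftrightarrow> row_of \<mu> (\<sigma> x) = row_of \<mu> x" (is "?L \<longleftrightarrow> ?R")
    proof
      assume ?L
      then obtain j' where j': "(row_of \<mu> x, j') \<in> cells \<mu>" "\<sigma> (row_reading \<mu> (cell_of \<mu> x)) = row_reading \<mu> (row_of \<mu> x, j')"
        unfolding cell_of_eq by auto
      then show ?R using row_reading_cell_of[OF x] cell_of_row_reading[OF j'(1)] by (simp add: row_of_def)
    next
      assume ?R
      moreover have "cell_of \<mu> (\<sigma> x) \<in> cells \<mu>" using bij_betwE[OF cell_of_bij] \<sigma>x by blast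
      ultimately show ?L
        using row_reading_cell_of[OF x] row_reading_cell_of[OF \<sigma>x] unfolding cell_of_eq
        by (intro case_prodI exI[of _ "column_of \<mu> (\<sigma> x)"]) auto
    qed
  qed
  then show ?thesis unfolding row_group_def stab_def by blast
qed

lemma col_group_eq: "col_group \<mu> = stab (column_of \<mu>) {1..sum_list \<mu>}"
proof -
  have "(\<forall>(i, j)\<in>cells \<mu>. \<exists>i'. (i', j) \<in> cells \<mu> \<and> \<sigma> (row_reading \<mu> (i, j)) = row_reading \<mu> (i', j))
     \<longleftrightarrow> (\<forall>x\<in>{1..sum_list \<mu>}. column_of \<mu> (\<sigma> x) = column_of \<mu> x)" if \<sigma>: "\<sigma> permutes {1..sum_list \<mu>}" for \<sigma>
    unfolding ball_cells
  proof (intro ball_cong refl)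
    fix x assume x: "x \<in> {1..sum_list \<mu>}"
    then have \<sigma>x: "\<sigma> x \<in> {1..sum_list \<mu>}" using permutes_in_image[OF \<sigma>] by simp
    show "(case cell_of \<mu> x of (i, j) \<Rightarrow> \<exists>i'. (i', j) \<in> cells \<mu> \<and> \<sigma> (row_reading \<mu> (i, j)) = row_reading \<mu> (i', j))
      \<longleftrightarrow> column_of \<mu> (\<sigma> x) = column_of \<mu> x" (is "?L \<longleftrightarrow> ?R")
    proof
      assume ?L
      then obtain i' where i': "(i', column_of \<mu> x) \<in> cells \<mu>" "\<sigma> (row_reading \<mu> (cell_of \<mu> x)) = row_reading \<mu> (i', column_of \<mu> x)"
        unfolding cell_of_eq by auto
      then show ?R using row_reading_cell_of[OF x] cell_of_row_reading[OF i'(1)] by (simp add: column_of_def)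
    next
      assume ?R
      moreover have "cell_of \<mu> (\<sigma> x) \<in> cells \<mu>" using bij_betwE[OF cell_of_bij] \<sigma>x by blast
      ultimately show ?L
        using row_reading_cell_of[OF x] row_reading_cell_of[OF \<sigma>x] unfolding cell_of_eq
        by (intro case_prodI exI[of _ "row_of \<mu> (\<sigma> x)"]) auto
    qed
  qed
  then show ?thesis unfolding col_group_def stab_def by blast
qed

lemma hook_product_eq:
  "hook_product \<mu> = (\<Prod>x\<in>{1..sum_list \<mu>}. hook_card (row_of \<mu>) (column_of \<mu>) {1..sum_list \<mu>} x)"
proof -
  have "hook_product \<mu> = (\<Prod>x\<in>{1..sum_list \<mu>}. hook_length \<mu> (cell_of \<mu> x))"
    unfolding hook_product_def by (rule prod.reindex_bij_betw[OF cell_of_bij, symmetric])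
  also have "\<dots> = (\<Prod>x\<in>{1..sum_list \<mu>}. hook_card (row_of \<mu>) (column_of \<mu>) {1..sum_list \<mu>} x)"
  proof (rule prod.cong[OF refl])
    fix x assume "x \<in> {1..sum_list \<mu>}"
    let ?T = "{y \<in> {1..sum_list \<mu>}. (row_of \<mu> y = row_of \<mu> x \<and> column_of \<mu> x \<le> column_of \<mu> y)
        \<or> (column_of \<mu> y = column_of \<mu> x \<and> row_of \<mu> x \<le> row_of \<mu> y)}"
    let ?U = "{(i', j') \<in> cells \<mu>. (i' = row_of \<mu> x \<and> column_of \<mu> x \<le> j') \<or> (j' = column_of \<mu> x \<and> row_of \<mu> x \<le> i')}"
    have "?U = cell_of \<mu> ` ?T"
    proof -
      have "?U = {z \<in> cells \<mu>. (fst z = row_of \<mu> x \<and> column_of \<mu> x \<le> snd z) \<or> (snd z = column_of \<mu> x \<and> row_of \<mu> x \<le> fst z)}"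
        by auto
      also have "\<dots> = cell_of \<mu> ` ?T"
        unfolding bij_betw_imp_surj_on[OF cell_of_bij, symmetric] row_of_def column_of_def by blast
      finally show ?thesis .
    qed
    moreover have "inj_on (cell_of \<mu>) ?T"
      by (rule inj_on_subset[OF bij_betw_imp_inj_on[OF cell_of_bij]]) auto
    ultimately have "card ?U = card ?T" by (simp add: card_image)
    then show "hook_length \<mu> (cell_of \<mu> x) = hook_card (row_of \<mu>) (column_of \<mu>) {1..sum_list \<mu>} x"
      by (simp add: hook_length_def hook_card_def cell_of_eq)
  qed
  finally show ?thesis .
qed

section \<open>Conjugate partitions\<close>

lemma foldr_max_eq: "foldr max \<mu> 0 = (if \<mu> = [] then 0 else Max (set \<mu>))" for \<mu> :: "nat list"
  by (induction \<mu>) auto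

text \<open>The parts decrease weakly, so those that are at least \<open>j\<close> form an initial
  segment. Parts are indexed from 0, whence \<open>Suc i\<close>.\<close>

lemma conj_part_count:
  assumes "partition_of \<mu> h" "i < length \<mu>" "j \<ge> 1"
  shows "Suc i \<le> length (filter (\<lambda>r. j \<le> r) \<mu>) \<longleftrightarrow> j \<le> \<mu> ! i"
proof -
  have sorted: "sorted_wrt (\<ge>) \<mu>" using assms by (simp add: partition_of_def)
  have len: "length (filter (\<lambda>r. j \<le> r) \<mu>) = card {k. k < length \<mu> \<and> j \<le> \<mu> ! k}"
    by (rule length_filter_conv_card)
  have mono: "\<mu> ! l \<le> \<mu> ! k" if "k \<le> l" "l < length \<mu>" for k l
    using sorted_wrt_nth_less[OF sorted, of k l] that by (cases "k = l") auto
  show ?thesis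
  proof
    assume "j \<le> \<mu> ! i"
    then have "{..i} \<subseteq> {k. k < length \<mu> \<and> j \<le> \<mu> ! k}"
      using mono assms(2) by (auto intro: order_trans)
    then have "card {..i} \<le> card {k. k < length \<mu> \<and> j \<le> \<mu> ! k}" by (intro card_mono) auto
    then show "Suc i \<le> length (filter (\<lambda>r. j \<le> r) \<mu>)" by (simp add: len)
  next
    assume le: "Suc i \<le> length (filter (\<lambda>r. j \<le> r) \<mu>)"
    show "j \<le> \<mu> ! i"
    proof (rule ccontr)
      assume "\<not> j \<le> \<mu> ! i"
      then have "{k. k < length \<mu> \<and> j \<le> \<mu> ! k} \<subseteq> {..<i}"
        using mono by (force simp: not_le)
      then have "card {k. k < length \<mu> \<and> j \<le> \<mu> ! k} \<le> i"
        using card_mono[of "{..<i}"] by auto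
      then show False using le len by simp
    qed
  qed
qed

lemma sum_list_conj_part: "sum_list (conj_part \<mu>) = sum_list \<mu>"
proof -
  \<comment> \<open>A free bound \<open>M\<close> replaces the largest part, which would change in
    the induction on the list.\<close>
  have count: "sum_list (map (\<lambda>j. length (filter (\<lambda>r. j \<le> r) \<mu>)) [1..<Suc M]) = sum_list \<mu>"
    if "\<And>x. x \<in> set \<mu> \<Longrightarrow> x \<le> M" for M
    using that
  proof (induction \<mu>)
    case (Cons m \<mu>)
    have count: "sum_list (map (\<lambda>j. length (filter (\<lambda>r. j \<le> r) (m # \<mu>))) [1..<Suc M]) =
      (\<Sum>j\<in>{1..M}. of_bool (j \<le> m) + length (filter (\<lambda>r. j \<le> r) \<mu>))"
      by (auto simp: interv_sum_list_conv_sum_set_nat atLeastLessThanSuc_atLeastAtMost intro!: sum.cong simp del: upt_Suc)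
    also have "\<dots> = (\<Sum>j\<in>{1..M}. of_bool (j \<le> m)) + sum_list \<mu>"
      using Cons by (simp add: sum.distrib interv_sum_list_conv_sum_set_nat atLeastLessThanSuc_atLeastAtMost del: upt_Suc)
    also have "(\<Sum>j\<in>{1..M}. of_bool (j \<le> m)) = (m :: nat)"
    proof -
      have "{1..M} \<inter> {j. j \<le> m} = {1..m}" using Cons.prems[of m] by auto
      then show ?thesis by simp
    qed
    finally show ?case by simp
  qed simp
  show ?thesis
    unfolding conj_part_def by (rule count) (auto simp: foldr_max_eq)
qed

text \<open>Since \<open>irr_char\<close> conjugates its label, the immanant labelled
  \<open>conj_part \<mu>\<close> involves the representation of \<mu> itself.\<close>

lemma conj_part_conj_part:
  assumes "partition_of \<mu> h"
  shows "conj_part (conj_part \<mu>) = \<mu>"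
proof (cases "\<mu> = []")
  case True
  then show ?thesis by (simp add: conj_part_def)
next
  case False
  define M where "M = foldr max \<mu> 0"
  define cnt where "cnt j = length (filter (\<lambda>r. j \<le> r) \<mu>)" for j
  have pos: "1 \<le> x" if "x \<in> set \<mu>" for x using assms that by (cases x) (auto simp: partition_of_def)
  have M: "\<And>x. x \<in> set \<mu> \<Longrightarrow> x \<le> M" "M \<in> set \<mu>"
    using False Max_in[of "set \<mu>"] by (auto simp: M_def foldr_max_eq)
  have conj: "conj_part \<mu> = map cnt [1..<Suc M]"
    by (simp add: conj_part_def M_def cnt_def fun_eq_iff del: upt_Suc)
  have cnt1: "cnt 1 = length \<mu>" using pos by (simp add: cnt_def)
  have "foldr max (conj_part \<mu>) 0 = length \<mu>"
  proof -
    have "1 \<le> M" using pos[OF M(2)] .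
    then have mem: "length \<mu> \<in> set (conj_part \<mu>)"
      unfolding conj using cnt1 by (auto simp: image_iff intro!: bexI[of _ 1] simp del: upt_Suc)
    moreover have "x \<le> length \<mu>" if "x \<in> set (conj_part \<mu>)" for x
      using that unfolding conj cnt_def by (auto simp del: upt_Suc)
    ultimately have "Max (set (conj_part \<mu>)) = length \<mu>" by (intro Max_eqI) auto
    then show ?thesis using mem by (auto simp: foldr_max_eq)
  qed
  then have "conj_part (conj_part \<mu>) = map (\<lambda>i. length (filter (\<lambda>r. i \<le> r) (conj_part \<mu>))) [1..<Suc (length \<mu>)]"
    by (subst conj_part_def) simp
  also have "\<dots> = \<mu>"
  proof (rule nth_equalityI)
    fix i assume "i < length (map (\<lambda>i. length (filter (\<lambda>r. i \<le> r) (conj_part \<mu>))) [1..<Suc (length \<mu>)])"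
    then have i: "i < length \<mu>" by (simp del: upt_Suc)
    have "length (filter (\<lambda>r. Suc i \<le> r) (conj_part \<mu>)) = length (filter (\<lambda>j. Suc i \<le> cnt j) [1..<Suc M])"
      by (simp add: conj filter_map comp_def del: upt_Suc)
    also have "filter (\<lambda>j. Suc i \<le> cnt j) [1..<Suc M] = filter (\<lambda>j. j \<le> \<mu> ! i) [1..<Suc M]"
      by (rule filter_cong) (use conj_part_count[OF assms i] in \<open>auto simp: cnt_def simp del: upt_Suc\<close>)
    also have "length \<dots> = card {j \<in> set [1..<Suc M]. j \<le> \<mu> ! i}"
      by (subst distinct_length_filter) (auto simp: Int_def intro!: arg_cong[where f = card] simp del: upt_Suc)
    also have "{j \<in> set [1..<Suc M]. j \<le> \<mu> ! i} = {1..\<mu> ! i}"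
      using M(1)[of "\<mu> ! i"] i by auto
    finally show "map (\<lambda>i. length (filter (\<lambda>r. i \<le> r) (conj_part \<mu>))) [1..<Suc (length \<mu>)] ! i = \<mu> ! i"
      using i by (simp del: upt_Suc)
  qed (simp del: upt_Suc)
  finally show ?thesis .
qed

declare One_nat_def [simp del]

section \<open>Compositions and the orbits of index sequences\<close>

definition composition_mset :: "('n::{finite, linorder} \<Rightarrow> nat) \<Rightarrow> 'n multiset" where
  "composition_mset c = mset (concat (map (\<lambda>p. replicate (c p) p) (sorted_list_of_set UNIV)))"

lemma count_composition_mset: "count (composition_mset c) p = c p"
proof -
  have "count (mset (concat (map (\<lambda>p. replicate (c p) p) ps))) p = (if p \<in> set ps then c p else 0)"
    if "distinct ps" for ps :: "'a list"
    using that by (induction ps) auto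
  from this[of "sorted_list_of_set UNIV"] show ?thesis by (simp add: composition_mset_def)
qed

lemma in_composition_mset: "p \<in># composition_mset c \<longleftrightarrow> c p > 0"
  by (metis count_greater_zero_iff count_composition_mset)

lemma size_composition_mset: "size (composition_mset c) = (\<Sum>p\<in>UNIV. c p)"
proof -
  have "size (composition_mset c) = (\<Sum>p\<in>set_mset (composition_mset c). c p)"
    by (simp add: size_multiset_overloaded_eq count_composition_mset)
  also have "\<dots> = (\<Sum>p\<in>UNIV. c p)"
    by (rule sum.mono_neutral_left) (auto simp: in_composition_mset)
  finally show ?thesis .
qed

lemma composition_mset_seq:
  assumes "c \<in> compositions h"
  shows "image_mset (weakly_increasing_seq c) (mset_set {1..h}) = composition_mset c"
proof -
  let ?l = "concat (map (\<lambda>p. replicate (c p) p) (sorted_list_of_set UNIV))"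
  have len: "length ?l = h"
    using size_composition_mset[of c] assms unfolding composition_mset_def compositions_def size_mset by simp
  have "map (weakly_increasing_seq c) [1..<Suc h] = ?l"
    by (rule nth_equalityI) (simp_all add: len weakly_increasing_seq_def del: upt_Suc)
  then have "mset (map (weakly_increasing_seq c) [1..<Suc h]) = composition_mset c"
    by (simp add: composition_mset_def del: upt_Suc)
  then show ?thesis
    by (simp only: mset_map mset_upt atLeastLessThanSuc_atLeastAtMost)
qed

text \<open>Sequences with prescribed multiplicities are the arrangements of a multiset, counted by
  a multinomial coefficient.\<close>

lemma card_multi_index_fibre:
  fixes c :: "'n::{finite, linorder} \<Rightarrow> nat"
  assumes "c \<in> compositions h"
  shows "card {I \<in> multi_index h. image_mset I (mset_set {1..h}) = composition_mset c} * (\<Prod>p\<in>UNIV. fact (c p)) = fact h"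
proof -
  let ?F = "{I \<in> multi_index h. image_mset I (mset_set {1..h}) = composition_mset c}"
  have mset_eq: "mset (map I [1..<Suc h]) = image_mset I (mset_set {1..h})" for I :: "nat \<Rightarrow> 'n"
    by (simp only: mset_map mset_upt atLeastLessThanSuc_atLeastAtMost)
  have size: "size (composition_mset c) = h"
    using assms by (simp add: size_composition_mset compositions_def)
  have "bij_betw (\<lambda>I. map I [1..<Suc h]) ?F (permutations_of_multiset (composition_mset c))"
  proof (rule bij_betw_byWitness[where f' = "\<lambda>l. restrict (\<lambda>s. l ! (s - 1)) {1..h}"])
    show "\<forall>I\<in>?F. restrict (\<lambda>s. map I [1..<Suc h] ! (s - 1)) {1..h} = I"
      by (auto simp: multi_index_def PiE_def extensional_def fun_eq_iff simp del: upt_Suc)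
    have nth: "map (restrict (\<lambda>s. l ! (s - 1)) {1..h}) [1..<Suc h] = l" if "mset l = composition_mset c" for l
    proof (rule nth_equalityI)
      show "length (map (restrict (\<lambda>s. l ! (s - 1)) {1..h}) [1..<Suc h]) = length l"
        using that size by (simp del: upt_Suc flip: size_mset)
    qed (simp del: upt_Suc)
    then show "\<forall>l\<in>permutations_of_multiset (composition_mset c). map (restrict (\<lambda>s. l ! (s - 1)) {1..h}) [1..<Suc h] = l"
      by (simp add: permutations_of_multiset_def del: upt_Suc)
    show "(\<lambda>I. map I [1..<Suc h]) ` ?F \<subseteq> permutations_of_multiset (composition_mset c)"
      using mset_eq by (auto simp: permutations_of_multiset_def simp del: upt_Suc)
    show "(\<lambda>l. restrict (\<lambda>s. l ! (s - 1)) {1..h}) ` permutations_of_multiset (composition_mset c) \<subseteq> ?F"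
    proof
      fix I assume "I \<in> (\<lambda>l. restrict (\<lambda>s. l ! (s - 1)) {1..h}) ` permutations_of_multiset (composition_mset c)"
      then obtain l where l: "I = restrict (\<lambda>s. l ! (s - 1)) {1..h}" "mset l = composition_mset c"
        by (auto simp: permutations_of_multiset_def)
      then show "I \<in> ?F"
        using mset_eq[of I] nth[OF l(2)] by (simp add: multi_index_def del: upt_Suc)
    qed
  qed
  then have "card ?F = card (permutations_of_multiset (composition_mset c))"
    by (rule bij_betw_same_card)
  moreover have "card (permutations_of_multiset (composition_mset c)) * (\<Prod>p\<in>set_mset (composition_mset c). fact (c p)) = fact h"
    using card_permutations_of_multiset_aux[of "composition_mset c"] by (simp add: count_composition_mset size)
  moreover have "(\<Prod>p\<in>set_mset (composition_mset c). fact (c p)) = (\<Prod>p\<in>UNIV. fact (c p) :: nat)"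
    by (rule prod.mono_neutral_left) (auto simp: in_composition_mset)
  ultimately show ?thesis by simp
qed

lemma scalar_of_nat: "scalar (of_nat m) = of_nat m"
  by (induction m) (simp_all add: scalar_add)

lemma finite_compositions: "finite (compositions h :: ('n::finite \<Rightarrow> nat) set)"
proof (rule finite_subset)
  show "compositions h \<subseteq> (UNIV :: 'n set) \<rightarrow>\<^sub>E {..h}"
  proof
    fix c :: "'n \<Rightarrow> nat" assume "c \<in> compositions h"
    then have "c p \<le> h" for p using member_le_sum[of p UNIV c] by (simp add: compositions_def)
    then show "c \<in> UNIV \<rightarrow>\<^sub>E {..h}" by (auto simp: PiE_def extensional_def)
  qed
qed (auto intro: finite_PiE)

text \<open>Compositions label the orbits of index sequences under permutation of positions, and
  \<open>G\<close> is constant on orbits. The assumption \<open>cong\<close> bridges a gap: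
  \<open>weakly_increasing_seq c\<close> represents its orbit on \<open>{1..h}\<close> but need not
  be extensional like the members of \<open>multi_index h\<close>.\<close>

lemma sum_compositions:
  fixes G :: "(nat \<Rightarrow> 'n::{finite, linorder}) \<Rightarrow> ('p, 'q, 'n) env"
  assumes perm: "\<And>I \<tau>. \<tau> permutes {1..h} \<Longrightarrow> G (I \<circ> \<tau>) = G I"
    and cong: "\<And>I J. (\<And>s. s \<in> {1..h} \<Longrightarrow> I s = J s) \<Longrightarrow> G I = G J"
  shows "(\<Sum>c\<in>compositions h. scalar (1 / (\<Prod>p\<in>UNIV. fact (c p))) * G (weakly_increasing_seq c))
    = scalar (1 / fact h) * (\<Sum>I\<in>multi_index h. G I)"
proof -
  define F where "F c = {I \<in> multi_index h. image_mset I (mset_set {1..h}) = composition_mset c}" for c :: "'n \<Rightarrow> nat"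
  define cont where "cont I p = count (image_mset I (mset_set {1..h})) p" for I :: "nat \<Rightarrow> 'n" and p
  have F_eq: "F c = {I \<in> multi_index h. cont I = c}" for c
    unfolding F_def cont_def by (auto simp: multiset_eq_iff count_composition_mset fun_eq_iff)
  have "cont ` multi_index h \<subseteq> compositions h"
  proof
    fix c assume "c \<in> cont ` multi_index h"
    then obtain I where I: "I \<in> F c" unfolding F_eq by auto
    then have "composition_mset c = image_mset I (mset_set {1..h})" by (simp add: F_def)
    then have "size (composition_mset c) = h" by simp
    then show "c \<in> compositions h" by (simp add: size_composition_mset compositions_def)
  qed
  then have "(\<Sum>I\<in>multi_index h. G I) = (\<Sum>c\<in>compositions h. \<Sum>I\<in>F c. G I)"
    unfolding F_eq by (rule sum.group[OF finite_multi_index finite_compositions, symmetric])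
  also have "\<dots> = (\<Sum>c\<in>compositions h. scalar (of_nat (card (F c))) * G (weakly_increasing_seq c))"
  proof (rule sum.cong[OF refl])
    fix c :: "'n \<Rightarrow> nat" assume c: "c \<in> compositions h"
    have "G I = G (weakly_increasing_seq c)" if I: "I \<in> F c" for I
    proof -
      have "image_mset I (mset_set {1..h}) = image_mset (weakly_increasing_seq c) (mset_set {1..h})"
        using I composition_mset_seq[OF c] by (simp add: F_def)
      then obtain \<tau> where \<tau>: "\<tau> permutes {1..h}" "\<forall>s\<in>{1..h}. I s = weakly_increasing_seq c (\<tau> s)"
        using image_mset_eq_implies_permutes[of "{1..h}" I "weakly_increasing_seq c"] by auto
      have "G I = G (weakly_increasing_seq c \<circ> \<tau>)" by (rule cong) (use \<tau>(2) in auto)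
      then show ?thesis using perm[OF \<tau>(1)] by simp
    qed
    then show "(\<Sum>I\<in>F c. G I) = scalar (of_nat (card (F c))) * G (weakly_increasing_seq c)"
      by (simp add: scalar_of_nat)
  qed
  finally have fibres: "(\<Sum>I\<in>multi_index h. G I) = (\<Sum>c\<in>compositions h. scalar (of_nat (card (F c))) * G (weakly_increasing_seq c))" .
  have "scalar (1 / fact h) * (\<Sum>I\<in>multi_index h. G I) =
    (\<Sum>c\<in>compositions h. scalar (1 / fact h * of_nat (card (F c))) * G (weakly_increasing_seq c))"
    unfolding fibres sum_distrib_left scalar_mult mult.assoc ..
  also have "\<dots> = (\<Sum>c\<in>compositions h. scalar (1 / (\<Prod>p\<in>UNIV. fact (c p))) * G (weakly_increasing_seq c))"
  proof (rule sum.cong[OF refl])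
    fix c :: "'n \<Rightarrow> nat" assume c: "c \<in> compositions h"
    have "of_nat (card (F c) * (\<Prod>p\<in>UNIV. fact (c p))) = (of_nat (fact h) :: complex)"
      using card_multi_index_fibre[OF c] by (simp add: F_def)
    then have "1 / fact h * of_nat (card (F c)) = (1 / (\<Prod>p\<in>UNIV. fact (c p)) :: complex)"
      by (simp add: field_simps)
    then show "scalar (1 / fact h * of_nat (card (F c))) * G (weakly_increasing_seq c)
       = scalar (1 / (\<Prod>p\<in>UNIV. fact (c p))) * G (weakly_increasing_seq c)" by simp
  qed
  finally show ?thesis ..
qed

section \<open>Class functions and matrix coefficients\<close>

lemma sum_permutations_conj:
  assumes g: "g permutes S"
  shows "(\<Sum>\<sigma> | \<sigma> permutes S. f (g \<circ> \<sigma> \<circ> inv g)) = (\<Sum>\<sigma> | \<sigma> permutes S. f \<sigma>)"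
proof -
  have "(\<Sum>\<sigma> | \<sigma> permutes S. f \<sigma>) = (\<Sum>\<sigma> | \<sigma> permutes S. f (\<sigma> \<circ> inv g))"
    by (rule sum_permutations_compose_right[OF permutes_inv[OF g]])
  also have "\<dots> = (\<Sum>\<sigma> | \<sigma> permutes S. f (g \<circ> \<sigma> \<circ> inv g))"
    by (rule setum_permutations_compose_left[OF g])
  finally show ?thesis ..
qed

context young_positions
begin

lemma \<zeta>_conj:
  assumes \<sigma>: "\<sigma> permutes {1..h}" and \<tau>: "\<tau> permutes {1..h}"
  shows "\<zeta> (\<tau> \<circ> \<sigma> \<circ> inv \<tau>) = \<zeta> \<sigma>"
proof -
  have "\<zeta> \<sigma> = (\<Sum>g\<in>S. symmetrizer ((g \<circ> \<tau>) \<circ> inv \<sigma> \<circ> inv (g \<circ> \<tau>)))"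
    unfolding \<zeta>_def by (rule sum_permutations_compose_right[OF \<tau>])
  also have "\<dots> = \<zeta> (\<tau> \<circ> \<sigma> \<circ> inv \<tau>)"
    unfolding \<zeta>_def
    by (intro sum.cong refl arg_cong[where f = symmetrizer])
      (simp add: o_inv_distrib permutes_bij[OF \<tau>] permutes_bij[OF \<sigma>] permutes_bij bij_comp bij_imp_bij_inv inv_inv_eq comp_assoc)
  finally show ?thesis ..
qed

lemma ip_add:
  assumes "invariant_inner_product h ideal ip" "x \<in> ideal" "y \<in> ideal" "z \<in> ideal"
  shows "ip (x + y) z = ip x z + ip y z"
  using assms unfolding invariant_inner_product_def by blast

lemma ip_scale:
  assumes "invariant_inner_product h ideal ip" "x \<in> ideal" "y \<in> ideal"
  shows "ip (galg_scale d x) y = d * ip x y"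
  using assms unfolding invariant_inner_product_def by blast

lemma ip_sum:
  assumes ip: "invariant_inner_product h ideal ip" and v: "v \<in> ideal"
    and "finite B" "\<And>i. i \<in> B \<Longrightarrow> F i \<in> ideal"
  shows "ip (\<Sum>i\<in>B. F i) v = (\<Sum>i\<in>B. ip (F i) v)"
  using assms(3,4)
proof induction
  case empty
  have "galg_scale 0 v = (\<Sum>i\<in>{}. F i)" by (simp add: galg_scale_def zero_fun_def)
  then show ?case using ip_scale[OF ip v v, of 0] by (simp only: sum.empty mult_zero_left)
next
  case (insert i B)
  have "sum F B \<in> ideal" using insert by (intro galg.subspace_sum[OF subspace_ideal]) auto
  then have "ip (F i + sum F B) v = ip (F i) v + ip (sum F B) v"
    using insert.prems by (intro ip_add[OF ip _ _ v]) auto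
  moreover have "ip (sum F B) v = (\<Sum>i\<in>B. ip (F i) v)"
    by (rule insert.IH, rule insert.prems) simp
  ultimately show ?case by (simp only: sum.insert[OF insert.hyps])
qed

text \<open>Schur averaging: the matrix coefficient of \<open>v\<close> and the character have the same pairing with a class function.\<close>

lemma sum_matrix_coeff_normal_trace:
  assumes ip: "invariant_inner_product h ideal ip" and v: "v \<in> ideal" "ip v v = 1"
  shows "(\<Sum>\<sigma>\<in>S. scalar (ip (perm_act \<sigma> v) v) * normal_trace h \<sigma>)
    = scalar (1 / fact h) * (\<Sum>\<sigma>\<in>S. scalar (\<zeta> \<sigma>) * (normal_trace h \<sigma> :: ('p, 'q, 'n::finite) env))"
proof -
  let ?f = "\<lambda>\<sigma>. scalar (ip (perm_act \<sigma> v) v) * (normal_trace h \<sigma> :: ('p, 'q, 'n) env)"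
  \<comment> \<open>These are \<open>h!\<close> equal copies of the sum, one for each conjugating
    \<open>g\<close>. As \<open>normal_trace\<close> is a class function, the conjugations end up on
    the matrix coefficient alone.\<close>
  have "of_nat (fact h) * (\<Sum>\<sigma>\<in>S. ?f \<sigma>) = (\<Sum>g\<in>S. \<Sum>\<sigma>\<in>S. ?f \<sigma>)"
    by (simp add: card_permutations[of "{1..h}" h])
  also have "\<dots> = (\<Sum>g\<in>S. \<Sum>\<sigma>\<in>S. ?f (g \<circ> \<sigma> \<circ> inv g))"
    by (intro sum.cong refl sum_permutations_conj[symmetric]) auto
  also have "\<dots> = (\<Sum>\<sigma>\<in>S. \<Sum>g\<in>S. ?f (g \<circ> \<sigma> \<circ> inv g))"
    by (rule sum.swap)
  also have "\<dots> = (\<Sum>\<sigma>\<in>S. scalar (\<zeta> \<sigma>) * normal_trace h \<sigma>)"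
  proof (rule sum.cong[OF refl])
    fix \<sigma> assume "\<sigma> \<in> S"
    then have \<sigma>: "\<sigma> permutes {1..h}" by simp
    have "(\<Sum>g\<in>S. ?f (g \<circ> \<sigma> \<circ> inv g)) = scalar (\<Sum>g\<in>S. ip (perm_act (g \<circ> \<sigma> \<circ> inv g) v) v) * normal_trace h \<sigma>"
      unfolding scalar_sum sum_distrib_right by (intro sum.cong refl) (simp add: normal_trace_conj)
    also have "(\<Sum>g\<in>S. ip (perm_act (g \<circ> \<sigma> \<circ> inv g) v) v) = ip (conj_sum \<sigma> v) v"
      unfolding conj_sum_def
      by (rule ip_sum[OF ip v(1), symmetric]) (auto intro!: perm_act_ideal permutes_compose permutes_inv \<sigma> v finite_permutations)
    also have "\<dots> = \<zeta> \<sigma>"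
      unfolding conj_sum_ideal[OF \<sigma> v(1)] by (simp add: ip_scale[OF ip v(1) v(1)] v(2))
    finally show "(\<Sum>g\<in>S. ?f (g \<circ> \<sigma> \<circ> inv g)) = scalar (\<zeta> \<sigma>) * normal_trace h \<sigma>" .
  qed
  finally have "scalar (1 / fact h) * (scalar (of_nat (fact h)) * (\<Sum>\<sigma>\<in>S. ?f \<sigma>)) = scalar (1 / fact h) * (\<Sum>\<sigma>\<in>S. scalar (\<zeta> \<sigma>) * normal_trace h \<sigma>)"
    by (simp only: scalar_of_nat)
  moreover have "scalar (1 / fact h) * (scalar (of_nat (fact h)) * x) = x" for x :: "('p, 'q, 'n) env"
    by (simp add: mult.assoc[symmetric] scalar_mult[symmetric])
  ultimately show ?thesis by simp
qed

text \<open>The coefficient of \<tau> in \<Psi> involves \<open>inv \<tau>\<close>, so a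
  transposition on the left of \<tau> acts on \<open>v\<close> directly, where \<open>v\<close> is
  an eigenvector.\<close>

lemma jucys_murphy_coeff:
  assumes ip: "invariant_inner_product h ideal ip" and v: "v \<in> ideal"
    and jm: "(\<Sum>a\<in>{1..<m}. perm_act (swap a m) v) = galg_scale d v"
    and m: "m \<in> {1..h}" and \<tau>: "\<tau> permutes {1..h}"
  shows "(\<Sum>a\<in>{1..<m}. ip (perm_act (inv (swap a m \<circ> \<tau>)) v) v) = d * ip (perm_act (inv \<tau>) v) v"
proof -
  have t: "swap a m permutes {1..h}" if "a \<in> {1..<m}" for a
    using that m by (intro permutes_swap_id) auto
  have eq: "perm_act (inv (swap a m \<circ> \<tau>)) v = perm_act (inv \<tau>) (perm_act (swap a m) v)" if "a \<in> {1..<m}" for a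
    using perm_act_comp[OF permutes_inv[OF \<tau>] t[OF that]] permutes_bij[OF t[OF that]] permutes_bij[OF \<tau>] by (simp add: o_inv_distrib)
  have "(\<Sum>a\<in>{1..<m}. ip (perm_act (inv (swap a m \<circ> \<tau>)) v) v)
    = (\<Sum>a\<in>{1..<m}. ip (perm_act (inv \<tau>) (perm_act (swap a m) v)) v)"
    by (intro sum.cong refl) (simp only: eq)
  also have "\<dots> = ip (\<Sum>a\<in>{1..<m}. perm_act (inv \<tau>) (perm_act (swap a m) v)) v"
    by (rule ip_sum[OF ip v, symmetric]) (auto intro!: perm_act_ideal permutes_inv \<tau> t v)
  also have "(\<Sum>a\<in>{1..<m}. perm_act (inv \<tau>) (perm_act (swap a m) v))
      = perm_act (inv \<tau>) (\<Sum>a\<in>{1..<m}. perm_act (swap a m) v)"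
    by (intro ext) (simp add: sum_galg_apply perm_act_def)
  also have "\<dots> = galg_scale d (perm_act (inv \<tau>) v)"
    unfolding jm by (simp add: perm_act_def galg_scale_def)
  also have "ip \<dots> v = d * ip (perm_act (inv \<tau>) v) v"
    by (rule ip_scale[OF ip perm_act_ideal[OF permutes_inv[OF \<tau>] v] v])
  finally show ?thesis .
qed

end

lemma young_psi_apply:
  assumes "\<tau> permutes {1..h}"
  shows "young_psi h ip v \<tau> = ip (perm_act (inv \<tau>) v) v"
proof -
  have "young_psi h ip v \<tau> = (\<Sum>\<sigma> | \<sigma> permutes {1..h}. if \<sigma> = inv \<tau> then ip (perm_act (inv \<tau>) v) v else 0)"
    unfolding young_psi_def sum_galg_apply galg_scale_def
    by (intro sum.cong refl) (use assms in \<open>auto simp: permutes_inv_inv\<close>)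
  also have "\<dots> = ip (perm_act (inv \<tau>) v) v"
    using permutes_inv[OF assms] by (simp add: finite_permutations)
  finally show ?thesis .
qed

theorem theorem6p2:
  fixes h :: nat
    and \<mu> :: "nat list"
    and T :: "nat \<times> nat \<Rightarrow> nat"
    and ip :: "galg \<Rightarrow> galg \<Rightarrow> complex"
    and v :: galg
    and \<alpha> :: "nat \<Rightarrow> 'p::finite"
  assumes "h \<ge> 1"
    and "partition_of \<mu> h"
    and "standard_tableau \<mu> T"
    and "invariant_inner_product h (irrep \<mu>) ip"
    and "young_vector \<mu> T ip v"
    and "inj_on \<alpha> {1..h}"
  shows "(quantum_immanant \<mu> T ip v :: ('p, 'q::finite, 'n::{finite, linorder}) env) =
    (-1) ^ (h choose 2) *
    (\<Sum>c \<in> compositions h.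
       scalar (of_nat (hook_product \<mu>) / (\<Prod>p\<in>UNIV. fact (c p))) *
       Cimm \<alpha> (conj_part \<mu>) (weakly_increasing_seq c) (weakly_increasing_seq c))"
proof -
  have h: "sum_list \<mu> = h" using assms(2) by (simp add: partition_of_def)
  interpret young_positions h "row_of \<mu>" "column_of \<mu>"
    by (rule young_positions_partition[OF assms(2)])
  have sym: "young_symmetrizer \<mu> = symmetrizer"
    unfolding young_symmetrizer_def symmetrizer_def row_sum_def[abs_def] col_sum_def[abs_def] row_group_eq col_group_eq h ..
  have irrep: "irrep \<mu> = ideal"
    unfolding irrep_def ideal_def sym h ..
  have \<kappa>: "\<kappa> = of_nat (hook_product \<mu>)"
    unfolding \<kappa>_eq hook_product_eq h by simp
  have ip: "invariant_inner_product h ideal ip" and v: "v \<in> ideal" "ip v v = 1"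
    using assms(4,5) by (simp_all add: irrep young_vector_def)
  define \<psi> where "\<psi> = young_psi h ip v"
  have jm: "(\<Sum>a\<in>{1..<m}. \<psi> (swap a m \<circ> \<tau>)) = of_int (content \<mu> T m) * \<psi> \<tau>"
    if m: "m \<in> {1..h}" and \<tau>: "\<tau> permutes {1..h}" for m \<tau>
  proof -
    have "\<psi> (swap a m \<circ> \<tau>) = ip (perm_act (inv (swap a m \<circ> \<tau>)) v) v" if "a \<in> {1..<m}" for a
      unfolding \<psi>_def using that m by (intro young_psi_apply permutes_compose[OF \<tau>] permutes_swap_id) auto
    moreover have "(\<Sum>a\<in>{1..<m}. perm_act (swap a m) v) = galg_scale (of_int (content \<mu> T m)) v"
      using assms(5) m by (simp add: young_vector_def h)
    ultimately show ?thesis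
      using jucys_murphy_coeff[OF ip v(1) _ m \<tau>] young_psi_apply[OF \<tau>] by (simp add: \<psi>_def)
  qed
  define Z :: "('p, 'q, 'n) env" where "Z = (\<Sum>\<sigma>\<in>S. scalar (\<zeta> \<sigma>) * normal_trace h \<sigma>)"
  have "(quantum_immanant \<mu> T ip v :: ('p, 'q, 'n) env) =
    (\<Sum>I\<in>multi_index h. \<Sum>\<tau>\<in>S. scalar (\<psi> \<tau>) * normal_seq h I (I \<circ> inv \<tau>))"
    unfolding quantum_immanant_def E_tableau_def h \<psi>_def[symmetric]
    by (intro sum.cong refl sum_tensor_E_perm_matrix jm)
  also have "\<dots> = (\<Sum>\<tau>\<in>S. \<Sum>I\<in>multi_index h. scalar (\<psi> \<tau>) * normal_seq h I (I \<circ> inv \<tau>))"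
    by (rule sum.swap)
  also have "\<dots> = (\<Sum>\<tau>\<in>S. scalar (ip (perm_act (inv \<tau>) v) v) * normal_trace h (inv \<tau>))"
    by (intro sum.cong refl) (simp add: \<psi>_def young_psi_apply normal_trace_def sum_distrib_left)
  also have "\<dots> = (\<Sum>\<tau>\<in>S. scalar (ip (perm_act \<tau> v) v) * normal_trace h \<tau>)"
    by (rule sum_permutations_inverse[symmetric])
  also have "\<dots> = scalar (1 / fact h) * Z"
    unfolding Z_def by (rule sum_matrix_coeff_normal_trace[where ip = ip and v = v, OF ip v])
  finally have lhs: "(quantum_immanant \<mu> T ip v :: ('p, 'q, 'n) env) = scalar (1 / fact h) * Z" .

  \<comment> \<open>The immanant at the index sequence \<open>I\<close> up to hook product and sign.
    Here \<sigma> permutes the left indices, as in the bitableaux, whereas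
    \<open>normal_trace\<close> permutes the right ones.\<close>
  define G :: "(nat \<Rightarrow> 'n) \<Rightarrow> ('p, 'q, 'n) env"
    where "G I = (\<Sum>\<sigma>\<in>S. scalar (\<zeta> \<sigma>) * normal_seq h (I \<circ> \<sigma>) I)" for I
  \<comment> \<open>The sign in the theorem cancels the sign of the column bitableaux.\<close>
  have sign_sq: "(-1) ^ m * ((-1) ^ m * x) = x" for m and x :: "('p, 'q, 'n) env"
    by (cases "even m") auto
  have Cimm: "scalar (of_nat (hook_product \<mu>)) * Cimm \<alpha> (conj_part \<mu>) I I = (-1) ^ (h choose 2) * G I" for I
  proof -
    have "Cimm \<alpha> (conj_part \<mu>) I I =
      (\<Sum>\<sigma>\<in>S. scalar (trace_on ideal (perm_act \<sigma>)) * ((-1) ^ (h choose 2) * (normal_seq h (I \<circ> \<sigma>) I :: ('p, 'q, 'n) env)))"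
      unfolding Cimm_def sum_list_conj_part h irr_char_def conj_part_conj_part[OF assms(2)] irrep
        column_capelli_eq_normal[OF assms(6)] normal_seq_def ..
    then have "scalar (of_nat (hook_product \<mu>)) * Cimm \<alpha> (conj_part \<mu>) I I =
      (\<Sum>\<sigma>\<in>S. scalar \<kappa> * (scalar (trace_on ideal (perm_act \<sigma>)) * ((-1) ^ (h choose 2) * (normal_seq h (I \<circ> \<sigma>) I :: ('p, 'q, 'n) env))))"
      by (simp only: \<kappa> sum_distrib_left)
    also have "\<dots> = (\<Sum>\<sigma>\<in>S. (-1) ^ (h choose 2) * (scalar (\<zeta> \<sigma>) * normal_seq h (I \<circ> \<sigma>) I))"
    proof (rule sum.cong[OF refl])
      fix \<sigma> assume "\<sigma> \<in> S"
      then have "scalar \<kappa> * (scalar (trace_on ideal (perm_act \<sigma>)) * x) = scalar (\<zeta> \<sigma>) * x" for x :: "('p, 'q, 'n) env"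
        by (simp add: mult.assoc[symmetric] scalar_mult[symmetric] trace_on_ideal)
      then show "scalar \<kappa> * (scalar (trace_on ideal (perm_act \<sigma>)) * ((-1) ^ (h choose 2) * (normal_seq h (I \<circ> \<sigma>) I :: ('p, 'q, 'n) env)))
          = (-1) ^ (h choose 2) * (scalar (\<zeta> \<sigma>) * normal_seq h (I \<circ> \<sigma>) I)"
        by (cases "even (h choose 2)") simp_all
    qed
    finally show ?thesis by (simp only: G_def sum_distrib_left)
  qed
  have "(\<Sum>c\<in>compositions h. scalar (of_nat (hook_product \<mu>) / (\<Prod>p\<in>UNIV. fact (c p))) *
       Cimm \<alpha> (conj_part \<mu>) (weakly_increasing_seq c) (weakly_increasing_seq c))
    = (\<Sum>c\<in>compositions h. scalar (1 / (\<Prod>p\<in>UNIV. fact (c p))) * ((-1) ^ (h choose 2) * G (weakly_increasing_seq c)))"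
    unfolding Cimm[symmetric] by (simp add: mult.assoc[symmetric] scalar_mult[symmetric])
  also have "\<dots> = (-1) ^ (h choose 2) * (\<Sum>c\<in>compositions h. scalar (1 / (\<Prod>p\<in>UNIV. fact (c p))) * G (weakly_increasing_seq c))"
    by (cases "even (h choose 2)") (simp_all add: sum_negf)
  also have "(\<Sum>c\<in>compositions h. scalar (1 / (\<Prod>p\<in>UNIV. fact (c p))) * G (weakly_increasing_seq c))
      = scalar (1 / fact h) * (\<Sum>I\<in>multi_index h. G I)"
  proof (rule sum_compositions)
    fix I :: "nat \<Rightarrow> 'n" and \<tau> assume \<tau>: "\<tau> permutes {1..h}"
    have "G (I \<circ> \<tau>) = (\<Sum>\<sigma>\<in>S. scalar (\<zeta> (\<tau> \<circ> \<sigma> \<circ> inv \<tau>)) * normal_seq h (I \<circ> (\<tau> \<circ> \<sigma> \<circ> inv \<tau>)) I)"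
      unfolding G_def
    proof (rule sum.cong[OF refl])
      fix \<sigma> assume "\<sigma> \<in> S"
      then have \<sigma>: "\<sigma> permutes {1..h}" by simp
      have "I \<circ> (\<tau> \<circ> \<sigma> \<circ> inv \<tau>) \<circ> \<tau> = I \<circ> \<tau> \<circ> \<sigma>"
        using permutes_inv_o(2)[OF \<tau>] by (simp add: comp_assoc)
      note permute = normal_seq_permute[OF \<tau>, of "I \<circ> (\<tau> \<circ> \<sigma> \<circ> inv \<tau>)" I, unfolded this]
      show "scalar (\<zeta> \<sigma>) * normal_seq h (I \<circ> \<tau> \<circ> \<sigma>) (I \<circ> \<tau>)
          = scalar (\<zeta> (\<tau> \<circ> \<sigma> \<circ> inv \<tau>)) * (normal_seq h (I \<circ> (\<tau> \<circ> \<sigma> \<circ> inv \<tau>)) I :: ('p, 'q, 'n) env)"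
        by (simp only: permute \<zeta>_conj[OF \<sigma> \<tau>])
    qed
    also have "\<dots> = G I"
      unfolding G_def by (rule sum_permutations_conj[OF \<tau>])
    finally show "G (I \<circ> \<tau>) = G I" .
  next
    fix I J :: "nat \<Rightarrow> 'n" assume IJ: "\<And>s. s \<in> {1..h} \<Longrightarrow> I s = J s"
    have "(I \<circ> \<sigma>) s = (J \<circ> \<sigma>) s" if "\<sigma> \<in> S" "s \<in> {1..h}" for \<sigma> s
      using IJ[of "\<sigma> s"] permutes_in_image[of \<sigma> "{1..h}" s] that by simp
    then show "G I = G J"
      unfolding G_def by (intro sum.cong refl arg_cong2[where f = "(*)"] normal_seq_cong) (simp_all add: IJ)
  qed
  \<comment> \<open>Passing from left to right indices replaces \<sigma> by its inverse, which
    \<open>\<zeta>_inv\<close> permits.\<close>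
  also have "(\<Sum>I\<in>multi_index h. G I) = Z"
  proof -
    have "(\<Sum>I\<in>multi_index h. G I) = (\<Sum>\<sigma>\<in>S. \<Sum>I\<in>multi_index h. scalar (\<zeta> \<sigma>) * normal_seq h (I \<circ> \<sigma>) I)"
      unfolding G_def by (rule sum.swap)
    also have "\<dots> = (\<Sum>\<sigma>\<in>S. scalar (\<zeta> (inv \<sigma>)) * normal_trace h (inv \<sigma>))"
    proof (rule sum.cong[OF refl])
      fix \<sigma> assume "\<sigma> \<in> S"
      then have \<sigma>: "\<sigma> permutes {1..h}" by simp
      have "normal_seq h (I \<circ> \<sigma>) I = (normal_seq h I (I \<circ> inv \<sigma>) :: ('p, 'q, 'n) env)" for I
        using normal_seq_permute[OF \<sigma>, of I "I \<circ> inv \<sigma>"] permutes_inv_o(2)[OF \<sigma>] by (simp add: comp_assoc)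
      then show "(\<Sum>I\<in>multi_index h. scalar (\<zeta> \<sigma>) * normal_seq h (I \<circ> \<sigma>) I) = scalar (\<zeta> (inv \<sigma>)) * (normal_trace h (inv \<sigma>) :: ('p, 'q, 'n) env)"
        by (simp add: normal_trace_def sum_distrib_left \<zeta>_inv[OF \<sigma>])
    qed
    also have "\<dots> = Z"
      unfolding Z_def by (rule sum_permutations_inverse[symmetric])
    finally show ?thesis .
  qed
  finally show ?thesis
    unfolding lhs by (simp only: sign_sq)
qed

end
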